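(* Let $V\in\mathcal{C}^\infty(\mathbb{T}^2,\mathbb{R})$ and let $(\varepsilon_\hbar)$ satisfy $\hbar\le\varepsilon_\hbar\le1$; set $\tau^c_\hbar=\hbar/\varepsilon_\hbar$. Let $(\psi_\hbar)$ be $L^2(\mathbb{T}^2)$-normalized with $\lim_{\delta\to0^+}\limsup_{\hbar\to0^+}\|\mathbf{1}_{[0,\delta]}(-\hbar^2\Delta)\psi_\hbar\|=0$ and $\lim_{R\to+\infty}\limsup_{\hbar\to0^+}\|\mathbf{1}_{[R,+\infty[}(-\hbar^2\Delta)\psi_\hbar\|=0$, and generating a unique semiclassical measure $F_0$, i.e. $\langle\psi_\hbar,\operatorname{Op}_\hbar(a)\psi_\hbar\rangle\to\int_{T^*\mathbb{T}^2}a\,dF_0$ for all $a\in\mathcal{C}^\infty_c(T^*\mathbb{T}^2)$. Let $u_\hbar(t)$, $u^\varepsilon_\hbar(t)$ solve $i\hbar\partial_tu_\hbar=-\frac{\hbar^2}{2}\Delta u_\hbar$ and $i\hbar\partial_tu^\varepsilon_\hbar=-\frac{\hbar^2}{2}\Delta u^\varepsilon_\hbar+\varepsilon_\hbar Vu^\varepsilon_\hbar$ with common initial datum $\psi_\hbar$. Then: (1) if $\varepsilon_\hbar=\hbar$, then for every $t\in\mathbb{R}$, $\lim_{\hbar\to0^+}|\langle u^\varepsilon_\hbar(t\tau^c_\hbar),u_\hbar(t\tau^c_\hbar)\rangle|^2=\big|\int_{T^*\mathbb{T}^2}e^{i\int_0^tV\circ\varphi^sds}\,dF_0\big|^2$;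 (2) if $\hbar\ll\varepsilon_\hbar\le1$, then for every $t\in\mathbb{R}$, $\lim_{\hbar\to0^+}|\langle u^\varepsilon_\hbar(t\tau^c_\hbar),u_\hbar(t\tau^c_\hbar)\rangle|^2=\big|\int_{T^*\mathbb{T}^2}e^{itV}\,dF_0\big|^2$.
   Context: $\mathbb{T}^2=\mathbb{R}^2/\mathbb{Z}^2$, $T^*\mathbb{T}^2=\mathbb{T}^2\times\mathbb{R}^2$, $\langle u,v\rangle=\int\overline uv$. $\operatorname{Op}_\hbar$ is the standard quantization: $\operatorname{Op}_\hbar(a)u(x)=(2\pi\hbar)^{-2}\iint e^{\frac{i}{\hbar}\langle x-y,\xi\rangle}a(x,\xi)u(y)dyd\xi$. $\varphi^s(x,\xi)=(x+s\xi,\xi)$ is the geodesic flow, and $V$ is viewed as a function on $T^*\mathbb{T}^2$ independent of $\xi$. *)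

theory Defs
  imports "HOL-Analysis.Analysis"
begin

(* Points of R^2 are pairs (x1,x2); the torus T^2 = R^2/Z^2 is modelled by Z^2-periodic
   functions on R^2, integrated over the fundamental domain [0,1]^2. *)

type_synonym pt = "real \<times> real"

fun Ck :: "nat \<Rightarrow> ('a::real_normed_vector \<Rightarrow> 'b::real_normed_vector) \<Rightarrow> bool" where
  "Ck 0 f = continuous_on UNIV f"
| "Ck (Suc n) f = (f differentiable_on UNIV \<and>
                   (\<forall>v. Ck n (\<lambda>x. frechet_derivative f (at x) v)))"

definition smooth :: "('a::real_normed_vector \<Rightarrow> 'b::real_normed_vector) \<Rightarrow> bool" where
  "smooth f \<longleftrightarrow> (\<forall>n. Ck n f)"

definition periodic :: "(pt \<Rightarrow> 'b) \<Rightarrow> bool" where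
  "periodic f \<longleftrightarrow> (\<forall>x (k1::int) (k2::int). f (fst x + of_int k1, snd x + of_int k2) = f x)"

definition sq :: "pt set" where
  "sq = {0..1} \<times> {0..1}"

definition L2 :: "(pt \<Rightarrow> complex) \<Rightarrow> bool" where
  "L2 u \<longleftrightarrow> u \<in> borel_measurable lborel \<and> periodic u \<and>
            set_integrable lborel sq (\<lambda>x. (cmod (u x))\<^sup>2)"

definition ip :: "(pt \<Rightarrow> complex) \<Rightarrow> (pt \<Rightarrow> complex) \<Rightarrow> complex" where
  "ip u v = (LINT x:sq|lborel. cnj (u x) * v x)"

definition L2norm :: "(pt \<Rightarrow> complex) \<Rightarrow> real" where
  "L2norm u = sqrt (LINT x:sq|lborel. (cmod (u x))\<^sup>2)"

(* Fourier coefficient w.r.t. the orthonormal eigenbasis e_k(x) = exp(2 pi i k.x) of -Delta *)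
definition fc :: "(pt \<Rightarrow> complex) \<Rightarrow> int \<times> int \<Rightarrow> complex" where
  "fc u k = (LINT x:sq|lborel. u x * cis (- 2 * pi * (of_int (fst k) * fst x + of_int (snd k) * snd x)))"

(* eigenvalue of -hbar^2 Delta on e_k *)
definition eigv :: "real \<Rightarrow> int \<times> int \<Rightarrow> real" where
  "eigv h k = h\<^sup>2 * (4 * pi\<^sup>2) * ((of_int (fst k))\<^sup>2 + (of_int (snd k))\<^sup>2)"

(* norm of the spectral projection 1_I(-hbar^2 Delta) u (functional calculus in the eigenbasis) *)
definition specproj_norm :: "real set \<Rightarrow> real \<Rightarrow> (pt \<Rightarrow> complex) \<Rightarrow> real" where
  "specproj_norm I h u = sqrt (infsum (\<lambda>k. (cmod (fc u k))\<^sup>2) {k. eigv h k \<in> I})"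

definition symbol :: "(pt \<times> pt \<Rightarrow> complex) \<Rightarrow> bool" where
  "symbol a \<longleftrightarrow> smooth a \<and> (\<forall>\<xi>. periodic (\<lambda>x. a (x, \<xi>))) \<and>
     (\<exists>R. \<forall>x \<xi>. norm \<xi> > R \<longrightarrow> a (x, \<xi>) = 0)"

(* standard quantization Op_hbar(a) acting on Z^2-periodic functions:
   Op_hbar(a) u (x) = sum_k a(x, 2 pi hbar k) \<hat>u(k) e^{2 pi i k.x} *)
definition Op :: "real \<Rightarrow> (pt \<times> pt \<Rightarrow> complex) \<Rightarrow> (pt \<Rightarrow> complex) \<Rightarrow> (pt \<Rightarrow> complex)" where
  "Op h a u = (\<lambda>x. infsum (\<lambda>k::int \<times> int.
       a (x, (2 * pi * h * of_int (fst k), 2 * pi * h * of_int (snd k))) * fc u k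
         * cis (2 * pi * (of_int (fst k) * fst x + of_int (snd k) * snd x))) UNIV)"

definition lap :: "(pt \<Rightarrow> complex) \<Rightarrow> pt \<Rightarrow> complex" where
  "lap f x =
     vector_derivative (\<lambda>s. vector_derivative (\<lambda>r. f (r, snd x)) (at s)) (at (fst x))
   + vector_derivative (\<lambda>s. vector_derivative (\<lambda>r. f (fst x, r)) (at s)) (at (snd x))"

(* u : R -> L^2(T^2) is a (weak/distributional) solution of
     i hbar d/dt u = -(hbar^2/2) Delta u + W u,  u(0) = psi,
   with W real; tested against smooth periodic functions, with locally bounded L^2 norm. *)
definition schr_sol :: "real \<Rightarrow> (pt \<Rightarrow> real) \<Rightarrow> (pt \<Rightarrow> complex) \<Rightarrow> (real \<Rightarrow> pt \<Rightarrow> complex) \<Rightarrow> bool" where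
  "schr_sol h W \<psi> u \<longleftrightarrow>
     u 0 = \<psi> \<and> (\<forall>t. L2 (u t)) \<and>
     (\<forall>T. \<exists>C. \<forall>t\<in>{-T..T}. L2norm (u t) \<le> C) \<and>
     (\<forall>\<phi>. smooth \<phi> \<and> periodic \<phi> \<longrightarrow>
        (\<forall>t. ((\<lambda>s. ip \<phi> (u s)) has_vector_derivative
               (- \<i> / complex_of_real h) *
                 ip (\<lambda>x. - (complex_of_real (h\<^sup>2 / 2)) * lap \<phi> x + complex_of_real (W x) * \<phi> x) (u t))
             (at t)))"

(* measures on T^* T^2 = T^2 x R^2, realized on [0,1)^2 x R^2 *)
definition cotorus_measure :: "(pt \<times> pt) measure \<Rightarrow> bool" where
  "cotorus_measure F \<longleftrightarrow> sets F = sets borel \<and> finite_measure F \<and>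
     emeasure F (- (({0..<1} \<times> {0..<1}) \<times> UNIV)) = 0"

end

(* Fourier series turn the Schroedinger equations into ODEs for coefficients. Pass to the
   interaction picture v(t) = U(-t T) u^eps(t T), T = hbar/eps, and test v(t) against the
   family chi(hbar D) psi shifted by n in frequency and modulated by exp(i eta.xi), i.e. against
   Op(e_n(x) exp(i eta.xi) chi(xi)) psi. Conjugating e_m by the free flow gives e_m times the
   modulation with parameter 2 pi t T m, up to a phase of size O(hbar); hence these
   correlations satisfy, up to o(1), a closed linear hierarchy of ODEs in (n, eta) whose
   coefficients are the absolutely summable Fourier coefficients of V. The integrals of
   e_n(x) exp(i eta.xi) chi(xi) exp(i int_0^t V(x + s tau xi) ds) against F0, tau = lim T,
   satisfy the limiting hierarchy, and at t = 0 the two sides agree in the limit because F0 is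
   the semiclassical measure. A Picard iteration propagates this to all t, and the tightness
   hypothesis at high frequency removes the cutoff chi. Both regimes are covered: T = 1, and T -> 0. *)
theory Submission
  imports Defs
begin

text \<open>The hierarchy closes exactly because moving \<open>e_m\<close> along the flow for time
  \<open>s\<close> gives \<open>e_m\<close> times a modulation in xi: multiplication by V only
  shifts \<open>(n, \<eta>)\<close> and never touches the cutoff. On the quantum side this is an
  identity between phases of Fourier coefficients with an explicit correction, so no symbol calculus
  enters. Correlations with psi are chosen because at time 0 they are what \<open>F0\<close>
  describes, and because the cutoff then acts on psi alone: tightness of the initial data removes
  it, and the frequencies of the perturbed solution need no control. The time scale makes the
  coupling \<open>T * eps / h\<close> equal to a sign \<open>\<sigma>\<close> for every h. The
  regimes then differ only in the limit \<open>\<tau>\<close> of T, which is \<open>\<sigma>\<close>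
  when eps = h and 0 when h << eps; the sign accounts for negative times. The obstacle is that the
  initial correlations converge for each \<open>(n, \<eta>)\<close> separately, over an infinite
  index set. Moreover the solutions are weak, so the conservation of the L2 norm, which bounds the
  correlations, has to be derived from the coefficients.\<close>

subsection \<open>Smooth functions\<close>

lemma Ck_of_closed:
  assumes "\<And>f. f \<in> S \<Longrightarrow> f differentiable_on UNIV"
    and "\<And>f v. f \<in> S \<Longrightarrow> (\<lambda>x. frechet_derivative f (at x) v) \<in> S"
    and "f \<in> S"
  shows "smooth f"
proof -
  have "Ck n f" if "f \<in> S" for n f
    using that
  proof (induction n arbitrary: f)
    case 0
    then show ?case using differentiable_imp_continuous_on[OF assms(1)] by simp
  next
    case (Suc n)
    then show ?case using assms by simp
  qed
  then show ?thesis using assms(3) by (simp add: smooth_def)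
qed

text \<open>The function \<open>exp (- 1 / y) / y ^ m\<close> continued by 0. Powers of
  \<open>1 / y\<close> are what differentiating \<open>exp (- 1 / y)\<close> brings out, so the
  family indexed by \<open>m\<close> is closed under differentiation up to linear
  combinations.\<close>

definition flat :: "nat \<Rightarrow> real \<Rightarrow> real" where
  "flat m y = (if y > 0 then exp (- inverse y) * inverse y ^ m else 0)"

text \<open>This quotient is the difference quotient of \<open>flat m\<close> at 0, the gluing
  point. On the right, with \<open>z = 1 / y\<close>, the claim is that \<open>exp z\<close>
  dominates \<open>z ^ (m + 1)\<close>.\<close>

lemma flat_over_y_tendsto: "((\<lambda>y. flat m y / y) \<longlongrightarrow> 0) (at 0)"
proof -
  have "((\<lambda>y. flat m y / y) \<longlongrightarrow> 0) (at_left 0)"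
    by (rule tendsto_eventually) (auto simp: flat_def eventually_at_left_field intro!: exI[of _ "-1"])
  moreover have "((\<lambda>y. flat m y / y) \<longlongrightarrow> 0) (at_right 0)"
  proof -
    have "((\<lambda>y::real. inverse y ^ Suc m / exp (inverse y)) \<longlongrightarrow> 0) (at_right 0)"
      by (rule filterlim_compose[OF tendsto_power_div_exp_0 filterlim_inverse_at_top_right])
    moreover have "\<forall>\<^sub>F y in at_right 0. inverse y ^ Suc m / exp (inverse y) = flat m y / y"
      by (auto simp: flat_def eventually_at_right_field exp_minus divide_inverse intro!: exI[of _ 1])
    ultimately show ?thesis
      by (rule Lim_transform_eventually)
  qed
  ultimately show ?thesis
    by (simp add: filterlim_split_at_real)
qed

lemma flat_deriv:
  "(flat m has_real_derivative (flat (m + 2) y - real m * flat (m + 1) y)) (at y)"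
proof -
  consider "y < 0" | "y = 0" | "y > 0" by linarith
  then show ?thesis
  proof cases
    case 1
    have "((\<lambda>_. 0::real) has_real_derivative 0) (at y)" by simp
    then have "(flat m has_real_derivative 0) (at y)"
      by (rule has_field_derivative_transform_within_open[where S="{..<0}"])
         (use 1 in \<open>auto simp: flat_def\<close>)
    then show ?thesis using 1 by (simp add: flat_def)
  next
    case 2
    have "(flat m has_real_derivative 0) (at 0)"
      using flat_over_y_tendsto[of m] by (simp add: DERIV_def flat_def cong: if_cong)
    then show ?thesis using 2 by (simp add: flat_def)
  next
    case 3
    \<comment> \<open>The case split is for truncated subtraction: at \<open>m = 0\<close> the
      exponent \<open>m - 1\<close> is 0 and not -1, and the factor \<open>real m\<close> hides
      this.\<close>
    have "real m * inverse y ^ (m - 1) * (- (inverse y ^ 2)) = - (real m * inverse y ^ (m + 1))"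
      by (cases m) (simp_all add: power2_eq_square)
    then have 1: "((\<lambda>y. inverse y ^ m) has_real_derivative - (real m * inverse y ^ (m + 1))) (at y)"
      using 3 by (intro DERIV_cong[OF DERIV_power[OF DERIV_inverse[of y UNIV], of m]]) (auto simp: power2_eq_square mult_ac)
    have 2: "((\<lambda>y. exp (- inverse y)) has_real_derivative (exp (- inverse y) * inverse y ^ 2)) (at y)"
      using 3 by (auto intro!: derivative_eq_intros simp: power2_eq_square)
    have "((\<lambda>y. exp (- inverse y) * inverse y ^ m) has_real_derivative
       (flat (m + 2) y - real m * flat (m + 1) y)) (at y)"
      by (rule DERIV_cong[OF DERIV_mult[OF 2 1]])
         (use 3 in \<open>simp add: flat_def algebra_simps power2_eq_square\<close>)
    then show ?thesis
      by (rule has_field_derivative_transform_within_open[where S="{0<..}"])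
         (use 3 in \<open>auto simp: flat_def\<close>)
  qed
qed

text \<open>A class of functions closed under directional derivatives: smoothness of all its members is
  then immediate from Ck_of_closed, without Leibniz or chain rules for iterated derivatives.\<close>

inductive_set smooth_alg :: "('a::real_normed_vector \<Rightarrow> complex) set" where
  lin: "bounded_linear l \<Longrightarrow> (\<lambda>x. complex_of_real (l x)) \<in> smooth_alg"
| const: "(\<lambda>x. c) \<in> smooth_alg"
| add: "f \<in> smooth_alg \<Longrightarrow> g \<in> smooth_alg \<Longrightarrow> (\<lambda>x. f x + g x) \<in> smooth_alg"
| mult: "f \<in> smooth_alg \<Longrightarrow> g \<in> smooth_alg \<Longrightarrow> (\<lambda>x. f x * g x) \<in> smooth_alg"
| cis: "bounded_linear l \<Longrightarrow> (\<lambda>x. cis (l x)) \<in> smooth_alg"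
| flat: "(\<And>x. (q has_derivative q' x) (at x)) \<Longrightarrow>
         (\<And>v. (\<lambda>x. complex_of_real (q' x v)) \<in> smooth_alg) \<Longrightarrow>
         (\<lambda>x. complex_of_real (flat m (q x))) \<in> smooth_alg"

text \<open>Each generator has a derivative built from generators. For \<open>flat\<close> the chain
  rule yields \<open>flat (m + 2)\<close> and \<open>flat (m + 1)\<close> of the same
  \<open>q\<close>, times \<open>q' x v\<close>; hence that rule leaves \<open>m\<close> free and
  asks for membership of the derivative of \<open>q\<close>.\<close>

lemma smooth_alg_deriv:
  assumes "f \<in> smooth_alg"
  shows "\<exists>f'. (\<forall>x. (f has_derivative f' x) (at x)) \<and> (\<forall>v. (\<lambda>x. f' x v) \<in> smooth_alg)"
  using assms
proof induction
  case (lin l)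
  have "((\<lambda>x. complex_of_real (l x)) has_derivative (\<lambda>v. complex_of_real (l v))) (at x)" for x
    by (intro bounded_linear.has_derivative[OF bounded_linear_of_real] bounded_linear_imp_has_derivative lin)
  then show ?case
    by (intro exI[of _ "\<lambda>x v. complex_of_real (l v)"]) (auto intro: smooth_alg.const)
next
  case (const c)
  show ?case by (intro exI[of _ "\<lambda>x v. 0"]) (auto intro: smooth_alg.const)
next
  case (add f g)
  then obtain f' g' where "\<forall>x. (f has_derivative f' x) (at x)" "\<forall>v. (\<lambda>x. f' x v) \<in> smooth_alg"
    "\<forall>x. (g has_derivative g' x) (at x)" "\<forall>v. (\<lambda>x. g' x v) \<in> smooth_alg" by blast
  then show ?case
    by (intro exI[of _ "\<lambda>x v. f' x v + g' x v"]) (auto intro: smooth_alg.add has_derivative_add)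
next
  case (mult f g)
  then obtain f' g' where "\<forall>x. (f has_derivative f' x) (at x)" "\<forall>v. (\<lambda>x. f' x v) \<in> smooth_alg"
    "\<forall>x. (g has_derivative g' x) (at x)" "\<forall>v. (\<lambda>x. g' x v) \<in> smooth_alg" by blast
  then show ?case using mult(1,2)
    by (intro exI[of _ "\<lambda>x v. f x * g' x v + f' x v * g x"])
       (auto intro!: smooth_alg.add smooth_alg.mult intro: has_derivative_mult)
next
  case (cis l)
  have "((\<lambda>x. cis (l x)) has_derivative (\<lambda>v. complex_of_real (l v) * (\<i> * cis (l x)))) (at x)" for x
  proof -
    have "((\<lambda>x. \<i> * complex_of_real (l x)) has_derivative (\<lambda>v. \<i> * complex_of_real (l v))) (at x)"
      by (intro has_derivative_mult_right
          bounded_linear.has_derivative[OF bounded_linear_of_real] bounded_linear_imp_has_derivative cis)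
    from has_derivative_compose[OF this DERIV_exp[unfolded has_field_derivative_def]]
    show ?thesis by (simp add: cis_conv_exp mult_ac)
  qed
  then show ?case
    by (intro exI[of _ "\<lambda>x v. complex_of_real (l v) * (\<i> * cis (l x))"])
       (auto intro!: smooth_alg.mult smooth_alg.const smooth_alg.cis cis)
next
  case (flat q q' m)
  have qd: "(q has_derivative q' x) (at x)" for x by fact
  have "((\<lambda>x. complex_of_real (flat m (q x))) has_derivative
      (\<lambda>v. complex_of_real (q' x v) * (complex_of_real (flat (m + 2) (q x)) + (- real m) * complex_of_real (flat (m + 1) (q x))))) (at x)" for x
  proof -
    from has_derivative_compose[OF qd flat_deriv[of m "q x", unfolded has_field_derivative_def]]
    have "((\<lambda>x. complex_of_real (flat m (q x))) has_derivative
       (\<lambda>v. complex_of_real ((flat (m + 2) (q x) - real m * flat (m + 1) (q x)) * q' x v))) (at x)"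
      by (intro bounded_linear.has_derivative[OF bounded_linear_of_real])
    then show ?thesis by (simp add: mult.commute)
  qed
  moreover have n: "(\<lambda>x. complex_of_real (flat n (q x))) \<in> smooth_alg" for n
    by (rule smooth_alg.flat[OF flat(1,2)])
  moreover have "(\<lambda>x. complex_of_real (q' x v) * (complex_of_real (flat (m + 2) (q x)) + (- real m) * complex_of_real (flat (m + 1) (q x)))) \<in> smooth_alg" for v
    by (intro smooth_alg.mult[OF flat(2) smooth_alg.add[OF n smooth_alg.mult[OF smooth_alg.const n]]])
  ultimately show ?case
    by (intro exI[of _ "\<lambda>x v. complex_of_real (q' x v) * (complex_of_real (flat (m + 2) (q x)) + (- real m) * complex_of_real (flat (m + 1) (q x)))"] conjI allI)
qed

lemma smooth_smooth_alg: "f \<in> smooth_alg \<Longrightarrow> smooth f"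
proof (rule Ck_of_closed[where S = smooth_alg])
  fix f :: "'a \<Rightarrow> complex" and v
  assume "f \<in> smooth_alg"
  then obtain f' where f': "\<And>x. (f has_derivative f' x) (at x)" "\<And>v. (\<lambda>x. f' x v) \<in> smooth_alg"
    using smooth_alg_deriv by blast
  then show "f differentiable_on UNIV"
    by (auto simp: differentiable_on_def differentiable_def)
  have "frechet_derivative f (at x) = f' x" for x
    using f' frechet_derivative_at by metis
  then show "(\<lambda>x. frechet_derivative f (at x) v) \<in> smooth_alg"
    using f' by simp
qed

subsection \<open>Fourier modes\<close>

definition ek :: "int \<times> int \<Rightarrow> pt \<Rightarrow> complex" where
  "ek k x = cis (2 * pi * (of_int (fst k) * fst x + of_int (snd k) * snd x))"

abbreviation "Q \<equiv> restrict_space lborel sq"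

lemma sq_cbox: "sq = cbox (0, 0) (1, 1)"
  by (simp add: sq_def cbox_Pair_eq)

lemma sq_sets [measurable, simp]: "sq \<in> sets borel"
  by (simp add: sq_cbox)

lemma space_Q [simp]: "space Q = sq"
  by (simp add: space_restrict_space)

lemma emeasure_Q: "emeasure Q (space Q) = 1"
  by (simp add: emeasure_restrict_space sq_cbox emeasure_lborel_cbox_eq Basis_prod_def prod.union_disjoint)

interpretation Q: finite_measure Q
  by standard (simp add: emeasure_Q[simplified])

lemma measure_Q: "measure Q sq = 1"
  using emeasure_Q by (simp add: measure_def)

text \<open>The boundary of the square is negligible, so pointwise limits may be checked in the open
  square, where the description of arcs by a cosine holds.\<close>

lemma AE_Q_box: "AE x in Q. x \<in> box (0, 0) (1, 1)"
proof -
  have "emeasure Q (sq - box (0, 0) (1, 1)) = emeasure lborel (sq - box (0,0) (1,1))"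
    by (subst emeasure_restrict_space) auto
  also have "\<dots> = 0"
    by (subst emeasure_Diff)
       (auto simp: sq_cbox emeasure_lborel_cbox_eq emeasure_lborel_box_eq box_subset_cbox Basis_prod_def)
  finally have "emeasure Q (sq - box (0, 0) (1, 1)) = 0" .
  moreover have "sq - box (0, 0) (1, 1) \<in> sets Q"
    by (simp add: sets_restrict_space_iff)
  ultimately show ?thesis
    by (intro AE_I[where N = "sq - box (0,0) (1,1)"]) auto
qed

lemma ip_Q: "ip u v = (\<integral>x. cnj (u x) * v x \<partial>Q)"
  by (simp add: ip_def set_lebesgue_integral_def integral_restrict_space)

lemma norm_ek [simp]: "cmod (ek k x) = 1"
  by (simp add: ek_def)

lemma cnj_ek: "cnj (ek k x) = ek (- k) x"
  by (simp add: ek_def cis_cnj algebra_simps)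

lemma ek_add: "ek (j + k) x = ek j x * ek k x"
  by (simp add: ek_def cis_mult algebra_simps)

lemma ek_zero [simp]: "ek 0 x = 1"
  by (simp add: ek_def)

lemma continuous_ek [continuous_intros]: "continuous_on A (ek k)"
  unfolding ek_def by (intro continuous_intros)

lemma measurable_ek [measurable]: "ek k \<in> borel_measurable borel"
  by (intro borel_measurable_continuous_onI continuous_ek)

lemma cis_2pi_int: "cis (2 * pi * of_int m) = 1"
  by (metis cis_multiple_2pi Ints_of_int)

lemma borel_measurable_cnj [measurable]: "cnj \<in> borel_measurable borel"
  by (intro borel_measurable_continuous_onI continuous_on_cnj continuous_on_id)

lemma periodic_ek: "periodic (ek k)"
proof -
  have "ek k (fst x + of_int k1, snd x + of_int k2) = ek k x * cis (2 * pi * of_int (fst k * k1 + snd k * k2))" for x k1 k2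
    by (simp add: ek_def cis_mult algebra_simps)
  then show ?thesis by (simp add: periodic_def cis_2pi_int del: of_int_add of_int_mult)
qed

lemma bounded_linear_phase:
  "bounded_linear (\<lambda>x::pt. 2 * pi * (of_int a * fst x + of_int b * snd x))"
  by (intro bounded_linear_const_mult[THEN bounded_linear_compose] bounded_linear_add
      bounded_linear_const_mult bounded_linear_fst bounded_linear_snd
      bounded_linear_mult_right[THEN bounded_linear_compose])

lemma smooth_ek: "smooth (ek k)"
  unfolding ek_def[abs_def] by (intro smooth_smooth_alg smooth_alg.cis bounded_linear_phase)

lemma fc_ip: "fc u k = ip (ek k) u"
  by (simp add: fc_def ip_def ek_def cis_cnj mult.commute algebra_simps)

subsection \<open>Integration by parts on the torus\<close>

lemma integral_Q_cbox:
  fixes g :: "pt \<Rightarrow> 'b::euclidean_space"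
  assumes "continuous_on UNIV g"
  shows "integrable Q g" "(\<integral>x. g x \<partial>Q) = integral (cbox (0,0) (1,1)) g"
proof -
  have "set_integrable lborel sq g"
    unfolding set_integrable_def sq_cbox
    by (intro borel_integrable_compact) (auto intro: continuous_on_subset[OF assms])
  then show "integrable Q g" "(\<integral>x. g x \<partial>Q) = integral (cbox (0,0) (1,1)) g"
    using set_borel_integral_eq_integral(2)[of sq g]
    by (auto simp: set_integrable_def integrable_restrict_space integral_restrict_space
        set_lebesgue_integral_def sq_cbox)
qed

text \<open>Fubini with the order swapped, then the fundamental theorem of calculus in the first
  variable; periodicity makes the boundary values cancel.\<close>

lemma integral_partial_fst_eq_0:
  fixes g g1 :: "pt \<Rightarrow> complex"
  assumes "\<And>x y. ((\<lambda>s. g (s, y)) has_vector_derivative g1 (x, y)) (at x)"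
    and c: "continuous_on UNIV g1" and "periodic g"
  shows "(\<integral>x. g1 x \<partial>Q) = 0"
proof -
  have "integral {0..1} (\<lambda>x. g1 (x, y)) = 0" for y
  proof -
    have "((\<lambda>x. g1 (x, y)) has_integral (g (1, y) - g (0, y))) {0..1}"
      by (intro fundamental_theorem_of_calculus)
         (auto intro: has_vector_derivative_at_within assms)
    moreover have "g (1, y) = g (0, y)"
      using \<open>periodic g\<close>[unfolded periodic_def, rule_format, of "(0,y)" 1 0] by simp
    ultimately show ?thesis by (simp add: integral_unique)
  qed
  moreover have "integral (cbox (0,0) (1,1)) g1 = integral {0..1} (\<lambda>y. integral {0..1} (\<lambda>x. g1 (x, y)))"
  proof -
    have c': "continuous_on (cbox (0, 0) (1, 1)) g1"
      by (rule continuous_on_subset[OF c]) simp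
    have "continuous_on (cbox (0, 0) (1, 1)) (\<lambda>(x, y). g1 (x, y))"
      using c' by simp
    then show ?thesis
      using integral_prod_continuous[OF c'] integral_swap_continuous[of 0 0 1 1 "\<lambda>x y. g1 (x, y)"]
      by (simp add: case_prod_unfold)
  qed
  ultimately show ?thesis
    using integral_Q_cbox[OF c] by simp
qed

lemma integral_partial_snd_eq_0:
  fixes g g2 :: "pt \<Rightarrow> complex"
  assumes "\<And>x y. ((\<lambda>s. g (x, s)) has_vector_derivative g2 (x, y)) (at y)"
    and c: "continuous_on UNIV g2" and "periodic g"
  shows "(\<integral>x. g2 x \<partial>Q) = 0"
proof -
  have "integral {0..1} (\<lambda>y. g2 (x, y)) = 0" for x
  proof -
    have "((\<lambda>y. g2 (x, y)) has_integral (g (x, 1) - g (x, 0))) {0..1}"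
      by (intro fundamental_theorem_of_calculus)
         (auto intro: has_vector_derivative_at_within assms)
    moreover have "g (x, 1) = g (x, 0)"
      using \<open>periodic g\<close>[unfolded periodic_def, rule_format, of "(x,0)" 0 1] by simp
    ultimately show ?thesis by (simp add: integral_unique)
  qed
  moreover have "integral (cbox (0,0) (1,1)) g2 = integral {0..1} (\<lambda>x. integral {0..1} (\<lambda>y. g2 (x, y)))"
    using integral_prod_continuous[of 0 0 1 1 g2] continuous_on_subset[OF c] by simp
  ultimately show ?thesis
    using integral_Q_cbox[OF c] by simp
qed

lemma has_vector_derivative_cis:
  assumes "(f has_real_derivative f') (at x within S)"
  shows "((\<lambda>x. cis (f x)) has_vector_derivative (\<i> * of_real f' * cis (f x))) (at x within S)"
proof -
  have "((\<lambda>x. \<i> * complex_of_real (f x)) has_vector_derivative \<i> * of_real f') (at x within S)"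
    using assms by (intro has_vector_derivative_mult_right has_vector_derivative_of_real)
      (simp add: has_real_derivative_iff_has_vector_derivative)
  then have "((exp \<circ> (\<lambda>x. \<i> * complex_of_real (f x))) has_vector_derivative
      (\<i> * of_real f') * exp (\<i> * complex_of_real (f x))) (at x within S)"
    by (rule field_vector_diff_chain_within) (rule DERIV_exp[THEN DERIV_subset], simp)
  then show ?thesis
    by (simp add: cis_conv_exp o_def mult_ac)
qed

lemma ek_deriv_fst: "((\<lambda>s. ek k (s, y)) has_vector_derivative (2 * pi * \<i> * of_int (fst k)) * ek k (x, y)) (at x)"
  unfolding ek_def
  by (rule has_vector_derivative_eq_rhs[OF has_vector_derivative_cis])
     (auto intro!: derivative_eq_intros)

lemma ek_deriv_snd: "((\<lambda>s. ek k (x, s)) has_vector_derivative (2 * pi * \<i> * of_int (snd k)) * ek k (x, y)) (at y)"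
  unfolding ek_def
  by (rule has_vector_derivative_eq_rhs[OF has_vector_derivative_cis])
     (auto intro!: derivative_eq_intros)

text \<open>For \<open>k \<noteq> 0\<close> the mode is a nonzero multiple of one of its own partial
  derivatives, and derivatives of periodic functions integrate to 0.\<close>

lemma integral_ek: "(\<integral>x. ek k x \<partial>Q) = (if k = 0 then 1 else 0)"
proof (cases "k = 0")
  case True
  then show ?thesis by (simp add: measure_Q)
next
  case False
  have "(\<integral>x. (2 * pi * \<i> * of_int (fst k)) * ek k x \<partial>Q) = 0"
    by (rule integral_partial_fst_eq_0[of "ek k"], rule ek_deriv_fst)
       (auto intro!: periodic_ek continuous_intros)
  moreover have "(\<integral>x. (2 * pi * \<i> * of_int (snd k)) * ek k x \<partial>Q) = 0"
    by (rule integral_partial_snd_eq_0[of "ek k"], rule ek_deriv_snd)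
       (auto intro!: periodic_ek continuous_intros)
  ultimately show ?thesis using False
    by (cases k) (auto simp: zero_prod_def)
qed

lemma ip_ek_ek: "ip (ek j) (ek k) = (if j = k then 1 else 0)"
proof -
  have "ip (ek j) (ek k) = (\<integral>x. ek (k - j) x \<partial>Q)"
    unfolding ip_Q by (rule Bochner_Integration.integral_cong) (auto simp: cnj_ek simp flip: ek_add)
  then show ?thesis by (simp add: integral_ek)
qed

subsection \<open>Square-integrable functions\<close>

text \<open>\<open>L2\<close> stripped of periodicity and seen on the unit square only: the
  indicators of Borel sets in the density argument are not periodic.\<close>

definition sqL2 :: "(pt \<Rightarrow> complex) \<Rightarrow> bool" where
  "sqL2 u \<longleftrightarrow> u \<in> borel_measurable Q \<and> integrable Q (\<lambda>x. (cmod (u x))\<^sup>2)"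

definition sqnorm :: "(pt \<Rightarrow> complex) \<Rightarrow> real" where
  "sqnorm u = (\<integral>x. (cmod (u x))\<^sup>2 \<partial>Q)"

lemma L2_sqL2: "L2 u \<Longrightarrow> sqL2 u"
  unfolding L2_def sqL2_def
  by (auto simp: set_integrable_def integrable_restrict_space measurable_restrict_space1)

lemma L2norm_sqnorm: "(L2norm u)\<^sup>2 = sqnorm u"
proof -
  have "(LINT x:sq|lborel. (cmod (u x))\<^sup>2) = sqnorm u"
    by (simp add: sqnorm_def integral_restrict_space set_lebesgue_integral_def)
  then show ?thesis by (simp add: L2norm_def sqnorm_def)
qed

lemma sqnorm_nonneg [simp]: "sqnorm u \<ge> 0"
  by (simp add: sqnorm_def)

lemma sqL2_prod:
  assumes "sqL2 u" "sqL2 v"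
  shows "integrable Q (\<lambda>x. cnj (u x) * v x)"
proof (rule Bochner_Integration.integrable_bound)
  show "integrable Q (\<lambda>x. (cmod (u x))\<^sup>2 + (cmod (v x))\<^sup>2)"
    using assms by (auto simp: sqL2_def)
  have [measurable]: "u \<in> borel_measurable Q" "v \<in> borel_measurable Q"
    using assms by (auto simp: sqL2_def)
  show "(\<lambda>x. cnj (u x) * v x) \<in> borel_measurable Q"
    by measurable
  have "cmod (u x) * cmod (v x) \<le> (cmod (u x))\<^sup>2 + (cmod (v x))\<^sup>2" for x
  proof -
    have "0 \<le> cmod (u x) * cmod (v x)" by simp
    with sum_squares_bound[of "cmod (u x)" "cmod (v x)"] show ?thesis by linarith
  qed
  then show "AE x in Q. norm (cnj (u x) * v x) \<le> norm ((cmod (u x))\<^sup>2 + (cmod (v x))\<^sup>2)"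
    by (simp add: norm_mult)
qed

text \<open>Young's inequality with a free weight, in place of Cauchy-Schwarz: choosing
  \<open>d\<close> small first and \<open>sqnorm v\<close> small afterwards makes the pairing
  small.\<close>

lemma cmod_ip_le:
  assumes "sqL2 u" "sqL2 v" "d > 0"
  shows "cmod (ip u v) \<le> d * sqnorm u + sqnorm v / d"
proof -
  have "cmod (ip u v) \<le> (\<integral>x. cmod (cnj (u x) * v x) \<partial>Q)"
    unfolding ip_Q by (rule integral_norm_bound)
  also have "\<dots> \<le> (\<integral>x. d * (cmod (u x))\<^sup>2 + (cmod (v x))\<^sup>2 / d \<partial>Q)"
  proof (rule integral_mono)
    show "integrable Q (\<lambda>x. cmod (cnj (u x) * v x))"
      using sqL2_prod assms by auto
    show "integrable Q (\<lambda>x. d * (cmod (u x))\<^sup>2 + (cmod (v x))\<^sup>2 / d)"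
      using assms by (auto simp: sqL2_def)
    fix x
    have "0 \<le> (d * cmod (u x) - cmod (v x))\<^sup>2 + (d * cmod (u x)) ^ 2 + (cmod (v x))\<^sup>2" by simp
    then have "d * (cmod (u x) * cmod (v x)) \<le> (d * cmod (u x)) ^ 2 + (cmod (v x))\<^sup>2"
      by (simp add: power2_diff)
    then show "cmod (cnj (u x) * v x) \<le> d * (cmod (u x))\<^sup>2 + (cmod (v x))\<^sup>2 / d"
      using \<open>d > 0\<close> by (simp add: norm_mult field_simps power2_eq_square)
  qed
  also have "\<dots> = d * sqnorm u + sqnorm v / d"
    using assms by (simp add: sqnorm_def sqL2_def)
  finally show ?thesis .
qed

lemma cmod_add_squared_le: "(cmod (a + b))\<^sup>2 \<le> 2 * (cmod a)\<^sup>2 + 2 * (cmod b)\<^sup>2"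
proof -
  have "(cmod (a + b))\<^sup>2 \<le> (cmod a + cmod b)\<^sup>2"
    by (intro power_mono norm_triangle_ineq) simp
  also have "\<dots> \<le> 2 * (cmod a)\<^sup>2 + 2 * (cmod b)\<^sup>2"
    using sum_squares_bound[of "cmod a" "cmod b"] by (simp add: power2_sum)
  finally show ?thesis .
qed

lemma sqL2_add:
  assumes "sqL2 u" "sqL2 v"
  shows "sqL2 (\<lambda>x. u x + v x)" "sqnorm (\<lambda>x. u x + v x) \<le> 2 * sqnorm u + 2 * sqnorm v"
proof -
  have i: "integrable Q (\<lambda>x. 2 * (cmod (u x))\<^sup>2 + 2 * (cmod (v x))\<^sup>2)"
    using assms by (auto simp: sqL2_def)
  have m: "(\<lambda>x. u x + v x) \<in> borel_measurable Q"
    using assms by (auto simp: sqL2_def)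
  have j: "integrable Q (\<lambda>x. (cmod (u x + v x))\<^sup>2)"
    by (rule Bochner_Integration.integrable_bound[OF i])
       (use m cmod_add_squared_le in auto)
  then show "sqL2 (\<lambda>x. u x + v x)"
    using m by (simp add: sqL2_def)
  have "sqnorm (\<lambda>x. u x + v x) \<le> (\<integral>x. 2 * (cmod (u x))\<^sup>2 + 2 * (cmod (v x))\<^sup>2 \<partial>Q)"
    unfolding sqnorm_def by (intro integral_mono i j cmod_add_squared_le)
  also have "\<dots> = 2 * sqnorm u + 2 * sqnorm v"
    using assms by (simp add: sqnorm_def sqL2_def)
  finally show "sqnorm (\<lambda>x. u x + v x) \<le> 2 * sqnorm u + 2 * sqnorm v" .
qed

lemma sqL2_mult_bounded:
  assumes "sqL2 u" "g \<in> borel_measurable Q" "\<And>x. x \<in> sq \<Longrightarrow> cmod (g x) \<le> B"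
  shows "sqL2 (\<lambda>x. g x * u x)" "sqnorm (\<lambda>x. g x * u x) \<le> B\<^sup>2 * sqnorm u"
proof -
  have i: "integrable Q (\<lambda>x. B\<^sup>2 * (cmod (u x))\<^sup>2)"
    using assms by (auto simp: sqL2_def)
  have m: "(\<lambda>x. g x * u x) \<in> borel_measurable Q"
    using assms by (auto simp: sqL2_def)
  have b: "(cmod (g x * u x))\<^sup>2 \<le> B\<^sup>2 * (cmod (u x))\<^sup>2" if "x \<in> sq" for x
    using assms(3)[OF that] by (auto simp: norm_mult power_mult_distrib intro!: mult_right_mono power_mono)
  have j: "integrable Q (\<lambda>x. (cmod (g x * u x))\<^sup>2)"
    by (rule Bochner_Integration.integrable_bound[OF i])
       (use m b in \<open>auto simp: AE_restrict_space_iff intro!: AE_I2\<close>)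
  then show "sqL2 (\<lambda>x. g x * u x)"
    using m by (simp add: sqL2_def)
  have "sqnorm (\<lambda>x. g x * u x) \<le> (\<integral>x. B\<^sup>2 * (cmod (u x))\<^sup>2 \<partial>Q)"
    unfolding sqnorm_def by (intro integral_mono i j b) simp
  then show "sqnorm (\<lambda>x. g x * u x) \<le> B\<^sup>2 * sqnorm u"
    using assms by (simp add: sqnorm_def sqL2_def)
qed

lemma sqL2_const: "sqL2 (\<lambda>x. c)"
  by (simp add: sqL2_def)

lemma sqL2_bounded:
  assumes "g \<in> borel_measurable Q" "\<And>x. x \<in> sq \<Longrightarrow> cmod (g x) \<le> B"
  shows "sqL2 g"
  using sqL2_mult_bounded(1)[OF sqL2_const[of 1] assms] by simp

lemma sqL2_cmult: "sqL2 u \<Longrightarrow> sqL2 (\<lambda>x. c * u x)"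
  by (rule sqL2_mult_bounded(1)[where B = "cmod c"]) auto

lemma sqL2_diff: "sqL2 u \<Longrightarrow> sqL2 v \<Longrightarrow> sqL2 (\<lambda>x. u x - v x)"
  using sqL2_add(1)[of u "\<lambda>x. (-1) * v x"] sqL2_cmult[of v "-1"] by simp

lemma sqL2_sum: "(\<And>i. i \<in> I \<Longrightarrow> sqL2 (f i)) \<Longrightarrow> sqL2 (\<lambda>x. \<Sum>i\<in>I. f i x)"
  by (induction I rule: infinite_finite_induct) (auto intro: sqL2_const sqL2_add)

lemma sqL2_ek: "sqL2 (ek k)"
  by (rule sqL2_bounded[where B = 1]) (auto intro: measurable_restrict_space1)

lemma ip_add_right: "sqL2 u \<Longrightarrow> sqL2 v \<Longrightarrow> sqL2 w \<Longrightarrow> ip u (\<lambda>x. v x + w x) = ip u v + ip u w"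
  using sqL2_prod[of u v] sqL2_prod[of u w] by (simp add: ip_Q distrib_left)

lemma ip_diff_right: "sqL2 u \<Longrightarrow> sqL2 v \<Longrightarrow> sqL2 w \<Longrightarrow> ip u (\<lambda>x. v x - w x) = ip u v - ip u w"
  using sqL2_prod[of u v] sqL2_prod[of u w] by (simp add: ip_Q right_diff_distrib)

lemma ip_cmult_right: "ip u (\<lambda>x. c * v x) = c * ip u v"
  by (simp add: ip_Q mult.left_commute)

lemma ip_sum_right:
  "sqL2 u \<Longrightarrow> (\<And>i. i \<in> I \<Longrightarrow> sqL2 (f i)) \<Longrightarrow> ip u (\<lambda>x. \<Sum>i\<in>I. f i x) = (\<Sum>i\<in>I. ip u (f i))"
  using sqL2_prod[of u] by (simp add: ip_Q sum_distrib_left)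

lemma cnj_ip: "cnj (ip u v) = ip v u"
proof -
  have "cnj (ip u v) = (\<integral>x. cnj (cnj (u x) * v x) \<partial>Q)"
    unfolding ip_Q by (rule Bochner_Integration.integral_cnj[symmetric])
  then show ?thesis
    unfolding ip_Q by (simp add: mult.commute)
qed

lemma sqnorm_ip: "of_real (sqnorm u) = ip u u"
proof -
  have "of_real (sqnorm u) = (\<integral>x. complex_of_real ((cmod (u x))\<^sup>2) \<partial>Q)"
    by (simp only: sqnorm_def integral_complex_of_real)
  also have "\<dots> = ip u u"
    unfolding ip_Q by (intro Bochner_Integration.integral_cong refl) (simp only: complex_norm_square mult.commute)
  finally show ?thesis .
qed

text \<open>Expands \<open>sqnorm (u - p) \<ge> 0\<close> for the partial Fourier sum
  \<open>p\<close>; the pairings \<open>ip u p\<close>, \<open>ip p u\<close> and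
  \<open>ip p p\<close> all equal the same real sum \<open>S\<close>.\<close>

lemma bessel:
  assumes "sqL2 u" "finite K"
  shows "(\<Sum>k\<in>K. (cmod (fc u k))\<^sup>2) \<le> sqnorm u"
proof -
  define p where "p = (\<lambda>x. \<Sum>k\<in>K. fc u k * ek k x)"
  have p: "sqL2 p"
    unfolding p_def by (intro sqL2_sum sqL2_cmult sqL2_ek)
  define S where "S = (\<Sum>k\<in>K. complex_of_real ((cmod (fc u k))\<^sup>2))"
  have ekp: "ip (ek j) p = fc u j" if "j \<in> K" for j
    unfolding p_def using that assms(2)
    by (subst ip_sum_right)
       (auto simp: ip_cmult_right ip_ek_ek sqL2_ek if_distrib[of "\<lambda>x. _ * x"] cong: if_cong intro!: sqL2_cmult)
  have pp: "ip w p = (\<Sum>k\<in>K. fc u k * cnj (ip (ek k) w))" if "sqL2 w" for w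
    unfolding p_def using that
    by (subst ip_sum_right) (auto simp: ip_cmult_right cnj_ip sqL2_ek intro!: sqL2_cmult)
  have up: "ip u p = S"
    unfolding pp[OF assms(1)] S_def
    by (intro sum.cong refl) (simp only: complex_norm_square fc_ip)
  have "ip p p = S"
    unfolding pp[OF p] S_def
    by (intro sum.cong refl) (simp only: ekp complex_norm_square)
  moreover have "ip p u = S"
    using up cnj_ip[of u p] by (simp add: S_def)
  moreover have "of_real (sqnorm (\<lambda>x. u x - p x)) = ip u u - ip u p - (ip p u - ip p p)"
  proof -
    have "ip (\<lambda>x. u x - p x) (\<lambda>x. u x - p x) = ip (\<lambda>x. u x - p x) u - ip (\<lambda>x. u x - p x) p"
      by (intro ip_diff_right sqL2_diff assms p)
    also have "ip (\<lambda>x. u x - p x) u = cnj (ip u u - ip u p)"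
      by (subst cnj_ip[symmetric]) (simp add: ip_diff_right assms p)
    also have "ip (\<lambda>x. u x - p x) p = cnj (ip p u - ip p p)"
      by (subst cnj_ip[symmetric]) (simp add: ip_diff_right assms p)
    finally show ?thesis by (simp add: sqnorm_ip cnj_ip)
  qed
  ultimately have "complex_of_real (sqnorm (\<lambda>x. u x - p x)) = of_real (sqnorm u) - S"
    using up by (simp add: sqnorm_ip)
  also have "\<dots> = of_real (sqnorm u - (\<Sum>k\<in>K. (cmod (fc u k))\<^sup>2))"
    by (simp add: S_def)
  finally have "sqnorm (\<lambda>x. u x - p x) = sqnorm u - (\<Sum>k\<in>K. (cmod (fc u k))\<^sup>2)"
    by (simp only: of_real_eq_iff)
  then show ?thesis
    using sqnorm_nonneg[of "\<lambda>x. u x - p x"] by linarith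
qed

subsection \<open>Density of trigonometric polynomials and Parseval's identity\<close>

inductive trig_poly :: "(pt \<Rightarrow> complex) \<Rightarrow> bool" where
  mono: "trig_poly (\<lambda>x. c * ek k x)"
| add: "trig_poly p \<Longrightarrow> trig_poly q \<Longrightarrow> trig_poly (\<lambda>x. p x + q x)"

lemma trig_poly_const: "trig_poly (\<lambda>x. c)"
  using trig_poly.mono[of c 0] by simp

lemma trig_poly_mult: "trig_poly p \<Longrightarrow> trig_poly q \<Longrightarrow> trig_poly (\<lambda>x. p x * q x)"
proof (induction rule: trig_poly.induct)
  case (mono c k)
  from \<open>trig_poly q\<close> show ?case
  proof (induction rule: trig_poly.induct)
    case (mono d j)
    have "c * ek k x * (d * ek j x) = (c * d) * ek (k + j) x" for x
      by (simp add: ek_add)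
    then show ?case using trig_poly.mono[of "c * d" "k + j"] by (simp only:)
  next
    case (add p q)
    then show ?case using trig_poly.add by (simp add: distrib_left)
  qed
next
  case (add p r)
  then show ?case using trig_poly.add by (simp add: distrib_right)
qed

lemma sqL2_trig_poly: "trig_poly p \<Longrightarrow> sqL2 p"
  by (induction rule: trig_poly.induct) (auto intro: sqL2_add sqL2_cmult sqL2_ek)

lemma trig_poly_polynomial:
  assumes "real_polynomial_function p" and "trig_poly (\<lambda>x. of_real (f x))"
  shows "trig_poly (\<lambda>x. of_real (p (f x)))"
  using assms(1)
proof (induction rule: real_polynomial_function.induct)
  case (linear l)
  then obtain c where "\<And>x. l x = x * c"
    using real_bounded_linear by auto
  then show ?case
    using trig_poly_mult[OF assms(2) trig_poly_const[of "of_real c"]] by simp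
next
  case (const c)
  show ?case by (rule trig_poly_const)
next
  case (add p q)
  then show ?case using trig_poly.add by simp
next
  case (mult p q)
  then show ?case using trig_poly_mult by simp
qed

lemma trig_poly_cos:
  "trig_poly (\<lambda>x. of_real (cos (2 * pi * (fst x - c))))"
  "trig_poly (\<lambda>x. of_real (cos (2 * pi * (snd x - c))))"
proof -
  have cos_cis: "complex_of_real (cos a) = (cis a + cis (- a)) / 2" for a
    by (simp add: complex_eq_iff)
  have "complex_of_real (cos (2 * pi * (fst x - c))) =
      cis (- 2 * pi * c) / 2 * ek (1, 0) x + cis (2 * pi * c) / 2 * ek (-1, 0) x" for x
    unfolding cos_cis ek_def by (simp add: cis_mult add_divide_distrib algebra_simps)
  then show "trig_poly (\<lambda>x. of_real (cos (2 * pi * (fst x - c))))"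
    using trig_poly.add[OF trig_poly.mono trig_poly.mono] by (simp only:)
  have "complex_of_real (cos (2 * pi * (snd x - c))) =
      cis (- 2 * pi * c) / 2 * ek (0, 1) x + cis (2 * pi * c) / 2 * ek (0, -1) x" for x
    unfolding cos_cis ek_def by (simp add: cis_mult add_divide_distrib algebra_simps)
  then show "trig_poly (\<lambda>x. of_real (cos (2 * pi * (snd x - c))))"
    using trig_poly.add[OF trig_poly.mono trig_poly.mono] by (simp only:)
qed

section \<open>Approximation by trigonometric polynomials in the square norm\<close>

definition approximable :: "(pt \<Rightarrow> complex) \<Rightarrow> bool" where
  "approximable u \<longleftrightarrow> sqL2 u \<and> (\<forall>\<epsilon>>0. \<exists>p. trig_poly p \<and> sqnorm (\<lambda>x. u x - p x) < \<epsilon>)"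

lemma approximable_trig_poly: "trig_poly p \<Longrightarrow> approximable p"
  unfolding approximable_def by (auto intro!: exI[of _ p] sqL2_trig_poly simp: sqnorm_def)

lemma approximable_add:
  assumes "approximable u" "approximable v"
  shows "approximable (\<lambda>x. u x + v x)"
  unfolding approximable_def
proof (intro conjI allI impI)
  show "sqL2 (\<lambda>x. u x + v x)"
    using assms by (auto simp: approximable_def intro: sqL2_add)
  fix \<epsilon> :: real assume "\<epsilon> > 0"
  then have "\<epsilon> / 4 > 0" by simp
  then obtain p q where p: "trig_poly p" "sqnorm (\<lambda>x. u x - p x) < \<epsilon> / 4" and q: "trig_poly q" "sqnorm (\<lambda>x. v x - q x) < \<epsilon> / 4"
    using assms unfolding approximable_def by metis
  have "sqnorm (\<lambda>x. u x + v x - (p x + q x)) = sqnorm (\<lambda>x. (u x - p x) + (v x - q x))"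
    by (simp add: algebra_simps)
  also have "\<dots> \<le> 2 * sqnorm (\<lambda>x. u x - p x) + 2 * sqnorm (\<lambda>x. v x - q x)"
    using assms p q by (intro sqL2_add sqL2_diff) (auto simp: approximable_def intro: sqL2_trig_poly)
  also have "\<dots> < \<epsilon>" using p q by simp
  finally show "\<exists>p. trig_poly p \<and> sqnorm (\<lambda>x. u x + v x - p x) < \<epsilon>"
    using trig_poly.add[OF p(1) q(1)] by blast
qed

lemma approximable_cmult:
  assumes "approximable u"
  shows "approximable (\<lambda>x. c * u x)"
  unfolding approximable_def
proof (intro conjI allI impI)
  show "sqL2 (\<lambda>x. c * u x)"
    using assms by (auto simp: approximable_def intro: sqL2_cmult)
  fix \<epsilon> :: real assume "\<epsilon> > 0"
  then have "\<epsilon> / ((cmod c)\<^sup>2 + 1) > 0" by (simp add: add_nonneg_pos)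
  then obtain p where p: "trig_poly p" "sqnorm (\<lambda>x. u x - p x) < \<epsilon> / ((cmod c)\<^sup>2 + 1)"
    using assms unfolding approximable_def by metis
  have "sqnorm (\<lambda>x. c * u x - c * p x) = sqnorm (\<lambda>x. c * (u x - p x))"
    by (simp add: right_diff_distrib)
  also have "\<dots> \<le> (cmod c)\<^sup>2 * sqnorm (\<lambda>x. u x - p x)"
    using assms p by (intro sqL2_mult_bounded sqL2_diff) (auto simp: approximable_def intro: sqL2_trig_poly)
  also have "\<dots> \<le> ((cmod c)\<^sup>2 + 1) * sqnorm (\<lambda>x. u x - p x)"
    by (simp add: distrib_right)
  also have "\<dots> < \<epsilon>"
    using p(2) by (simp add: pos_less_divide_eq add_nonneg_pos mult.commute)
  finally show "\<exists>p. trig_poly p \<and> sqnorm (\<lambda>x. c * u x - p x) < \<epsilon>"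
    using trig_poly_mult[OF trig_poly_const[of c] p(1)] by blast
qed

lemma approximable_sum:
  "(\<And>i. i \<in> I \<Longrightarrow> approximable (f i)) \<Longrightarrow> approximable (\<lambda>x. \<Sum>i\<in>I. f i x)"
  by (induction I rule: infinite_finite_induct) (auto intro: approximable_add approximable_trig_poly trig_poly_const)

text \<open>Dominated convergence brings \<open>f i\<close> close to \<open>u\<close> in the square
  norm; the factor 4 arises because both squares in the bound for a squared sum lie below
  \<open>w\<close>. This is the one limit passage behind boxes, Borel sets and simple
  functions.\<close>

lemma approximable_lim:
  assumes u: "\<And>i::nat. approximable (f i)" and v: "u \<in> borel_measurable Q"
    and lim: "AE x in Q. (\<lambda>i. f i x) \<longlonglongrightarrow> u x"
    and w: "integrable Q w" "\<And>i x. x \<in> sq \<Longrightarrow> (cmod (f i x))\<^sup>2 \<le> w x"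
    "\<And>x. x \<in> sq \<Longrightarrow> (cmod (u x))\<^sup>2 \<le> w x"
  shows "approximable u"
proof -
  have f: "sqL2 (f i)" for i
    using u by (auto simp: approximable_def)
  then have [measurable]: "f i \<in> borel_measurable Q" for i
    by (simp add: sqL2_def)
  note [measurable] = v
  have su: "sqL2 u"
    unfolding sqL2_def
  proof
    show "integrable Q (\<lambda>x. (cmod (u x))\<^sup>2)"
      by (rule Bochner_Integration.integrable_bound[OF w(1)])
         (use w(3) in \<open>auto intro!: AE_I2 order_trans[OF _ abs_ge_self]\<close>)
  qed (rule v)
  have "(\<lambda>i. \<integral>x. (cmod (f i x - u x))\<^sup>2 \<partial>Q) \<longlonglongrightarrow> (\<integral>x. 0 \<partial>Q)"
  proof (rule integral_dominated_convergence[where w = "\<lambda>x. 4 * w x"])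
    show "integrable Q (\<lambda>x. 4 * w x)" using w by simp
    show "AE x in Q. (\<lambda>i. (cmod (f i x - u x))\<^sup>2) \<longlonglongrightarrow> 0"
      using lim
    proof eventually_elim
      case (elim x)
      have "(\<lambda>i. (cmod (f i x - u x))\<^sup>2) \<longlonglongrightarrow> (cmod (u x - u x))\<^sup>2"
        by (intro tendsto_intros elim)
      then show ?case by simp
    qed
    have "(cmod (f i x - u x))\<^sup>2 \<le> 4 * w x" if "x \<in> sq" for i x
      using cmod_add_squared_le[of "f i x" "- u x"] w(2,3)[OF that] by (smt (verit) norm_minus_cancel add_uminus_conv_diff)
    then show "AE x in Q. norm ((cmod (f i x - u x))\<^sup>2) \<le> 4 * w x" for i
      by (intro AE_I2) auto
  qed auto
  then have n: "(\<lambda>i. sqnorm (\<lambda>x. f i x - u x)) \<longlonglongrightarrow> 0"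
    by (simp add: sqnorm_def)
  show ?thesis
    unfolding approximable_def
  proof (intro conjI allI impI su)
    fix \<epsilon> :: real assume "\<epsilon> > 0"
    then have e: "\<epsilon> / 4 > 0" by simp
    from order_tendstoD(2)[OF n e] obtain i where i: "sqnorm (\<lambda>x. f i x - u x) < \<epsilon> / 4"
      by (auto simp: eventually_sequentially)
    obtain p where p: "trig_poly p" "sqnorm (\<lambda>x. f i x - p x) < \<epsilon> / 4"
      using u[of i] e unfolding approximable_def by metis
    have i': "sqnorm (\<lambda>x. u x - f i x) < \<epsilon> / 4"
      using i by (simp add: sqnorm_def norm_minus_commute)
    have "sqnorm (\<lambda>x. u x - p x) = sqnorm (\<lambda>x. (u x - f i x) + (f i x - p x))"
      by simp
    also have "\<dots> \<le> 2 * sqnorm (\<lambda>x. u x - f i x) + 2 * sqnorm (\<lambda>x. f i x - p x)"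
      using f su p by (intro sqL2_add sqL2_diff) (auto intro: sqL2_trig_poly)
    also have "\<dots> < \<epsilon>" using i' p by simp
    finally show "\<exists>p. trig_poly p \<and> sqnorm (\<lambda>x. u x - p x) < \<epsilon>" using p by blast
  qed
qed

text \<open>Density is obtained without Fejer kernels: an arc of the circle is a superlevel set of
  \<open>cos (2 * pi * (x - c))\<close>, so its indicator is a bounded pointwise limit of polynomials in
  this cosine, which are trigonometric polynomials.\<close>

lemma polynomials_to_step:
  obtains p :: "nat \<Rightarrow> real \<Rightarrow> real" where "\<And>n. real_polynomial_function (p n)"
    "\<And>n y. y \<in> {-1..1} \<Longrightarrow> \<bar>p n y\<bar> \<le> 2"
    "\<And>y. y \<in> {-1..1} \<Longrightarrow> (\<lambda>n. p n y) \<longlonglongrightarrow> (if y > a then 1 else 0)"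
proof -
  \<comment> \<open>Ramps of slope \<open>n\<close> starting at \<open>a\<close>. They vanish for
    \<open>y \<le> a\<close>, so the limit is the indicator of the strict superlevel set; the
    polynomial \<open>p n\<close> follows the ramp within \<open>1 / (n + 1)\<close>.\<close>
  define r where "r n y = max 0 (min 1 (real n * (y - a)))" for n y
  have "\<exists>p. real_polynomial_function p \<and> (\<forall>y\<in>{-1..1}. \<bar>r n y - p y\<bar> < 1 / real (Suc n))" for n
  proof -
    have "continuous_on {-1..1} (r n)"
      unfolding r_def by (intro continuous_intros)
    from Stone_Weierstrass_real_polynomial_function[OF compact_Icc this, of "1 / real (Suc n)"]
    show ?thesis by (metis of_nat_0_less_iff zero_less_Suc zero_less_divide_1_iff)
  qed
  then obtain p where p: "\<And>n. real_polynomial_function (p n)"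
    "\<And>n y. y \<in> {-1..1} \<Longrightarrow> \<bar>r n y - p n y\<bar> < 1 / real (Suc n)"
    by metis
  show ?thesis
  proof (rule that[of p])
    show "real_polynomial_function (p n)" for n by (rule p)
    show "\<bar>p n y\<bar> \<le> 2" if "y \<in> {-1..1}" for n y
    proof -
      have "1 / real (Suc n) \<le> 1" by simp
      moreover have "0 \<le> r n y" "r n y \<le> 1" by (auto simp: r_def)
      ultimately show ?thesis using p(2)[OF that, of n] by linarith
    qed
    show "(\<lambda>n. p n y) \<longlonglongrightarrow> (if y > a then 1 else 0)" if "y \<in> {-1..1}" for y
    proof -
      have "(\<lambda>n. r n y) \<longlonglongrightarrow> (if y > a then 1 else 0)"
      proof (cases "y > a")
        case True
        obtain N where N: "real N * (y - a) > 1"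
          using reals_Archimedean3[of "y - a"] True by auto
        have "r n y = 1" if "n \<ge> N" for n
        proof -
          have "real N * (y - a) \<le> real n * (y - a)"
            using that True by (intro mult_right_mono) auto
          then show ?thesis using N by (simp add: r_def)
        qed
        then show ?thesis using True
          by (intro tendsto_eventually) (auto simp: eventually_sequentially)
      next
        case False
        then have "r n y = 0" for n
          using mult_nonneg_nonpos[of "real n" "y - a"] by (simp add: r_def)
        then show ?thesis using False by simp
      qed
      moreover have "(\<lambda>n. r n y - p n y) \<longlonglongrightarrow> 0"
        by (rule tendsto_rabs_zero_cancel, rule tendsto_sandwich[OF _ _ tendsto_const LIMSEQ_Suc[OF lim_1_over_n]])
           (use p(2)[OF that] in \<open>auto intro!: always_eventually less_imp_le\<close>)
      ultimately have "(\<lambda>n. r n y - (r n y - p n y)) \<longlonglongrightarrow> (if y > a then 1 else 0) - 0"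
        by (rule tendsto_diff)
      then show ?thesis by simp
    qed
  qed
qed

text \<open>Here \<open>y\<close> is the distance from \<open>x\<close> to the midpoint of the arc.
  The angle \<open>2 * pi * y\<close> stays in the range where the cosine decreases only for
  \<open>y \<le> 1 / 2\<close>. Beyond that, reflecting \<open>y\<close> to \<open>1 - y\<close>
  shows that \<open>x\<close> is too far from the midpoint also the other way round the circle, so
  both sides are false.\<close>

lemma arc_iff:
  assumes "0 \<le> l" "l < r" "r \<le> 1" "0 < x" "x < 1"
  shows "cos (2 * pi * (x - (l + r) / 2)) > cos (pi * (r - l)) \<longleftrightarrow> l < x \<and> x < r"
proof -
  define y where "y = \<bar>x - (l + r) / 2\<bar>"
  have cosy: "cos (2 * pi * (x - (l + r) / 2)) = cos (2 * pi * y)"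
    unfolding y_def by (cases "x - (l + r) / 2 \<ge> 0") (auto simp: abs_if algebra_simps cos_diff cos_add)
  have y: "0 \<le> y" "y < 1 - (r - l) / 2"
    using assms by (auto simp: y_def abs_if field_simps)
  have iff: "l < x \<and> x < r \<longleftrightarrow> y < (r - l) / 2"
    by (auto simp: y_def abs_if field_simps)
  have l: "0 \<le> pi * (r - l)" "pi * (r - l) \<le> pi"
    using assms by auto
  show ?thesis
  proof (cases "y \<le> 1 / 2")
    case True
    have "cos (2 * pi * y) > cos (pi * (r - l)) \<longleftrightarrow> 2 * pi * y < pi * (r - l)"
      using y l True by (intro cos_mono_less_eq) auto
    also have "\<dots> \<longleftrightarrow> pi * (2 * y) < pi * (r - l)" by (simp add: mult_ac)
    also have "\<dots> \<longleftrightarrow> y < (r - l) / 2" by (subst mult_less_cancel_left_pos) auto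
    finally show ?thesis by (simp add: cosy iff)
  next
    case False
    have y2: "2 * y < 2 - (r - l)" using y(2) by (simp add: field_simps)
    have y1: "y < 1" using y2 \<open>l < r\<close> by linarith
    have "cos (2 * pi * y) = cos (2 * pi * (1 - y))"
      by (simp add: right_diff_distrib cos_diff)
    moreover have "cos (2 * pi * (1 - y)) > cos (pi * (r - l)) \<longleftrightarrow> 2 * pi * (1 - y) < pi * (r - l)"
      using y1 l False by (intro cos_mono_less_eq) auto
    moreover have "2 * pi * (1 - y) < pi * (r - l) \<longleftrightarrow> pi * (2 * (1 - y)) < pi * (r - l)" by (simp add: mult_ac)
    moreover have "\<dots> \<longleftrightarrow> 2 * (1 - y) < r - l" by (subst mult_less_cancel_left_pos) auto
    moreover have "\<not> 2 * (1 - y) < r - l" "\<not> y < (r - l) / 2"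
      using y2 False assms by auto
    ultimately show ?thesis by (simp only: cosy iff)
  qed
qed

lemma measurable_indicator_Q:
  assumes [measurable]: "A \<in> sets borel"
  shows "(indicator A :: pt \<Rightarrow> complex) \<in> borel_measurable Q"
  unfolding indicator_def of_bool_def by (intro measurable_restrict_space1) measurable

text \<open>Inside the open unit square the box is a product of two arcs, so its indicator is a
  limit of products of polynomials in two cosines. The empty product is separate since arcs need
  positive length.\<close>

lemma approximable_box: "approximable (indicator (box a b))"
proof -
  define l1 r1 l2 r2 where "l1 = max 0 (fst a)" and "r1 = min 1 (fst b)"
    and "l2 = max 0 (snd a)" and "r2 = min 1 (snd b)"
  have *: "x \<in> box a b \<longleftrightarrow> (l1 < fst x \<and> fst x < r1) \<and> (l2 < snd x \<and> snd x < r2)"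
    if "x \<in> box (0,0) (1,1)" for x
    using that by (auto simp: l1_def r1_def l2_def r2_def box_prod mem_Times_iff)
  note m = measurable_indicator_Q[OF borel_open[OF open_box[of a b]]]
  show ?thesis
  proof (cases "l1 < r1 \<and> l2 < r2")
    case False
    have "AE x in Q. (\<lambda>i::nat. 0) \<longlonglongrightarrow> (indicator (box a b) x :: complex)"
      using AE_Q_box by eventually_elim (use * False in \<open>auto simp: indicator_def\<close>)
    moreover have "(cmod (indicator (box a b) x))\<^sup>2 \<le> 1" for x
      by (cases "x \<in> box a b") auto
    ultimately show ?thesis
      by (intro approximable_lim[where f = "\<lambda>_ _. 0" and w = "\<lambda>_. 1", OF approximable_trig_poly[OF trig_poly_const] m]) auto
  next
    case True
    obtain p where p: "\<And>n. real_polynomial_function (p n)"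
      "\<And>n y. y \<in> {-1..1} \<Longrightarrow> \<bar>p n y\<bar> \<le> 2"
      "\<And>y. y \<in> {-1..1} \<Longrightarrow> (\<lambda>n::nat. p n y) \<longlonglongrightarrow> (if y > cos (pi * (r1 - l1)) then 1 else 0)"
      by (rule polynomials_to_step[of "cos (pi * (r1 - l1))"]) (rule that)
    obtain q where q: "\<And>n. real_polynomial_function (q n)"
      "\<And>n y. y \<in> {-1..1} \<Longrightarrow> \<bar>q n y\<bar> \<le> 2"
      "\<And>y. y \<in> {-1..1} \<Longrightarrow> (\<lambda>n::nat. q n y) \<longlonglongrightarrow> (if y > cos (pi * (r2 - l2)) then 1 else 0)"
      by (rule polynomials_to_step[of "cos (pi * (r2 - l2))"]) (rule that)
    define f where "f n x = complex_of_real (p n (cos (2 * pi * (fst x - (l1 + r1) / 2)))) *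
        complex_of_real (q n (cos (2 * pi * (snd x - (l2 + r2) / 2))))" for n x
    have 1: "approximable (f n)" for n
      unfolding f_def
      by (rule approximable_trig_poly[OF trig_poly_mult[OF trig_poly_polynomial[OF p(1) trig_poly_cos(1)] trig_poly_polynomial[OF q(1) trig_poly_cos(2)]]])
    have 2: "AE x in Q. (\<lambda>n. f n x) \<longlonglongrightarrow> indicator (box a b) x"
      using AE_Q_box
    proof eventually_elim
      case (elim x)
      have "(\<lambda>n. f n x) \<longlonglongrightarrow> of_real (if cos (2 * pi * (fst x - (l1 + r1) / 2)) > cos (pi * (r1 - l1)) then 1 else 0) *
         of_real (if cos (2 * pi * (snd x - (l2 + r2) / 2)) > cos (pi * (r2 - l2)) then 1 else 0)"
        unfolding f_def by (intro tendsto_intros p q) auto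
      moreover have "cos (2 * pi * (fst x - (l1 + r1) / 2)) > cos (pi * (r1 - l1)) \<longleftrightarrow> l1 < fst x \<and> fst x < r1"
        using elim True by (intro arc_iff) (auto simp: l1_def r1_def box_prod mem_Times_iff)
      moreover have "cos (2 * pi * (snd x - (l2 + r2) / 2)) > cos (pi * (r2 - l2)) \<longleftrightarrow> l2 < snd x \<and> snd x < r2"
        using elim True by (intro arc_iff) (auto simp: l2_def r2_def box_prod mem_Times_iff)
      ultimately show ?case
        using *[OF elim] by (auto simp: indicator_def split: if_splits)
    qed
    have 3: "(cmod (f n x))\<^sup>2 \<le> 16" for n x
    proof -
      have "cmod (f n x) \<le> 2 * 2"
        unfolding f_def norm_mult by (intro mult_mono) (auto intro!: p(2) q(2))
      then have "(cmod (f n x))\<^sup>2 \<le> 4\<^sup>2"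
        by (intro power_mono) auto
      then show ?thesis by simp
    qed
    have 4: "(cmod (indicator (box a b) x))\<^sup>2 \<le> 16" for x
      by (cases "x \<in> box a b") auto
    show ?thesis
      by (rule approximable_lim[OF 1 m 2, of "\<lambda>_. 16"]) (simp, rule 3, rule 4)
  qed
qed

text \<open>Dynkin's argument: boxes are stable under intersection and generate the Borel sets,
  while complements and countable disjoint unions preserve approximability, the latter by dominated
  convergence of the partial unions.\<close>

lemma approximable_indicator:
  assumes "A \<in> sets borel"
  shows "approximable (indicator A)"
proof -
  have s: "sigma_sets UNIV (range (\<lambda>(a, b). box a b :: pt set)) = sets borel"
    by (simp add: borel_eq_box)
  note m = measurable_indicator_Q
  have stable: "Int_stable (range (\<lambda>(a, b). box a b :: pt set))"
    by (auto simp: Int_stable_def box_Int_box)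
  have sub: "range (\<lambda>(a, b). box a b :: pt set) \<subseteq> Pow UNIV" by simp
  have "A \<in> sigma_sets UNIV (range (\<lambda>(a, b). box a b :: pt set))"
    using assms s by simp
  with stable sub show ?thesis
  proof (induction rule: sigma_sets_induct_disjoint)
    case (basic A)
    then show ?case by (auto intro: approximable_box)
  next
    case empty
    then show ?case using approximable_trig_poly[OF trig_poly_const[of 0]] by (simp add: indicator_def[abs_def])
  next
    case (compl A)
    have "indicator (UNIV - A) x = 1 + (-1) * (indicator A x :: complex)" for x
      by (simp add: indicator_def)
    then show ?case
      using approximable_add[OF approximable_trig_poly[OF trig_poly_const[of 1]] approximable_cmult[OF compl(2), of "-1"]]
      by (simp add: fun_eq_iff[symmetric] cong del: if_weak_cong)
  next
    case (union A)
    have "approximable (\<lambda>x. \<Sum>i<n. indicator (A i) x)" for n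
      by (intro approximable_sum union)
    moreover have su: "(\<Sum>i<n. indicator (A i) x) = (indicator (\<Union>i<n. A i) x :: complex)" for n x
      using union(1) by (subst indicator_UN_disjoint) (auto simp: disjoint_family_on_def)
    moreover have "(\<lambda>x. \<Sum>i<n. indicator (A i) x) = (indicator (\<Union>i<n. A i) :: pt \<Rightarrow> complex)" for n
      by (rule ext) (rule su)
    ultimately have 1: "approximable (indicator (\<Union>i<n. A i))" for n
      by metis
    have 2: "AE x in Q. (\<lambda>n. indicator (\<Union>i<n. A i) x :: complex) \<longlonglongrightarrow> indicator (\<Union>i. A i) x"
      by (intro AE_I2 LIMSEQ_indicator_UN)
    have 3: "(\<Union>i. A i) \<in> sets borel"
      using union(2) s by auto
    have 4: "(cmod (indicator B x))\<^sup>2 \<le> 1" for B :: "pt set" and x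
      by (cases "x \<in> B") auto
    show ?case
      by (rule approximable_lim[OF 1 m[OF 3] 2, of "\<lambda>_. 1"]) (simp, rule 4, rule 4)
  qed
qed

lemma approximable_sqL2:
  assumes "sqL2 u"
  shows "approximable u"
proof -
  have [measurable]: "u \<in> borel_measurable Q" using assms by (simp add: sqL2_def)
  obtain s where s: "\<And>i. simple_function Q (s i)" "\<And>x. x \<in> sq \<Longrightarrow> (\<lambda>i. s i x) \<longlonglongrightarrow> u x"
    "\<And>i x. x \<in> sq \<Longrightarrow> cmod (s i x) \<le> 2 * cmod (u x)"
    using borel_measurable_implies_sequence_metric[of u Q 0] by auto metis
  \<comment> \<open>A finite combination of Borel indicators that agrees with \<open>s i\<close> on
    the square; off the square \<open>s i\<close> is arbitrary.\<close>
  define f where "f i x = (\<Sum>y\<in>s i ` sq. y * indicator (s i -` {y} \<inter> sq) x)" for i x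
  have fs: "f i x = s i x" if "x \<in> sq" for i x
  proof -
    have "s i x = (\<Sum>y\<in>s i ` space Q. indicator (s i -` {y} \<inter> space Q) x *\<^sub>R y)"
      using that by (intro simple_function_indicator_representation_banach s) simp
    also have "\<dots> = f i x"
      unfolding f_def by (intro sum.cong) (auto simp: indicator_def)
    finally show ?thesis by simp
  qed
  have "s i -` {y} \<inter> sq \<in> sets borel" for i y
  proof -
    have "s i -` {y} \<inter> space Q \<in> sets Q"
      using s(1)[of i] by (rule simple_functionD)
    then show ?thesis by (auto simp: sets_restrict_space)
  qed
  then have "approximable (f i)" for i
    unfolding f_def by (intro approximable_sum approximable_cmult approximable_indicator)
  then show ?thesis
  proof (rule approximable_lim[where w = "\<lambda>x. 4 * (cmod (u x))\<^sup>2"])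
    show "integrable Q (\<lambda>x. 4 * (cmod (u x))\<^sup>2)"
      using assms by (simp add: sqL2_def)
    show "(cmod (f i x))\<^sup>2 \<le> 4 * (cmod (u x))\<^sup>2" if "x \<in> sq" for i x
      using power_mono[OF s(3)[OF that, of i], of 2] by (simp add: fs that power_mult_distrib)
    show "AE x in Q. (\<lambda>i. f i x) \<longlonglongrightarrow> u x"
      by (intro AE_I2) (simp add: fs s)
  qed auto
qed

section \<open>Parseval's identity\<close>

lemma fc_add: "sqL2 u \<Longrightarrow> sqL2 v \<Longrightarrow> fc (\<lambda>x. u x + v x) k = fc u k + fc v k"
  by (simp add: fc_ip ip_add_right sqL2_ek)

lemma fc_diff: "sqL2 u \<Longrightarrow> sqL2 v \<Longrightarrow> fc (\<lambda>x. u x - v x) k = fc u k - fc v k"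
  by (simp add: fc_ip ip_diff_right sqL2_ek)

lemma parseval_trig_poly:
  assumes "sqL2 u" "trig_poly p"
  shows "((\<lambda>k. cnj (fc u k) * fc p k) has_sum ip u p) UNIV"
  using assms(2)
proof induction
  case (mono c j)
  have eq: "cnj (fc u k) * fc (\<lambda>x. c * ek j x) k = (if k = j then cnj (fc u j) * c else 0)" for k
    by (simp add: fc_ip ip_cmult_right ip_ek_ek)
  have "ip u (\<lambda>x. c * ek j x) = cnj (fc u j) * c"
    by (simp add: ip_cmult_right fc_ip cnj_ip)
  moreover have "((\<lambda>k. if k = j then cnj (fc u j) * c else 0) has_sum (cnj (fc u j) * c)) UNIV"
    by (subst has_sum_cong_neutral[where T = "{j}" and g = "\<lambda>_. cnj (fc u j) * c"])
       (auto intro!: has_sum_finiteI)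
  ultimately show ?case by (simp only: eq)
next
  case (add p q)
  have "sqL2 p" "sqL2 q" using add by (auto intro: sqL2_trig_poly)
  then show ?case
    using has_sum_add[OF add.IH] by (simp add: fc_add distrib_left ip_add_right assms)
qed

lemma sum_cmod_prod_le:
  fixes f g :: "'a \<Rightarrow> complex"
  assumes "(\<Sum>k\<in>K. (cmod (f k))\<^sup>2) \<le> A\<^sup>2" "(\<Sum>k\<in>K. (cmod (g k))\<^sup>2) \<le> B\<^sup>2" "A \<ge> 0" "B \<ge> 0"
  shows "(\<Sum>k\<in>K. cmod (f k) * cmod (g k)) \<le> A * B"
proof -
  have "(\<Sum>k\<in>K. cmod (f k) * cmod (g k)) \<le> L2_set (\<lambda>k. cmod (f k)) K * L2_set (\<lambda>k. cmod (g k)) K"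
    using L2_set_mult_ineq[of "\<lambda>k. cmod (f k)" "\<lambda>k. cmod (g k)" K] by simp
  also have "\<dots> \<le> A * B"
    using assms by (intro mult_mono) (auto simp: L2_set_def intro: real_le_lsqrt sum_nonneg)
  finally show ?thesis .
qed

text \<open>Cauchy-Schwarz for series, stated through bounds uniform over finite index sets, the
  form in which Bessel's inequality delivers them.\<close>

lemma abs_summable_prod:
  fixes f g :: "'a \<Rightarrow> complex"
  assumes "\<And>K. finite K \<Longrightarrow> (\<Sum>k\<in>K. (cmod (f k))\<^sup>2) \<le> A\<^sup>2"
    "\<And>K. finite K \<Longrightarrow> (\<Sum>k\<in>K. (cmod (g k))\<^sup>2) \<le> B\<^sup>2" "A \<ge> 0" "B \<ge> 0"
  shows "(\<lambda>k. cnj (f k) * g k) summable_on UNIV"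
    and "cmod (\<Sum>\<^sub>\<infinity>k. cnj (f k) * g k) \<le> A * B"
proof -
  have b: "(\<Sum>k\<in>K. norm (cnj (f k) * g k)) \<le> A * B" if "finite K" for K
    using sum_cmod_prod_le[OF assms(1,2)[OF that] assms(3,4)] by (simp add: norm_mult)
  have s: "(\<lambda>k. norm (cnj (f k) * g k)) summable_on UNIV"
    by (rule nonneg_bdd_above_summable_on) (use b in \<open>auto intro!: bdd_aboveI2\<close>)
  then show "(\<lambda>k. cnj (f k) * g k) summable_on UNIV"
    by (rule abs_summable_summable)
  have "cmod (\<Sum>\<^sub>\<infinity>k. cnj (f k) * g k) \<le> (\<Sum>\<^sub>\<infinity>k. norm (cnj (f k) * g k))"
    by (rule norm_infsum_bound[OF s])
  also have "\<dots> \<le> A * B"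
    by (rule infsum_le_finite_sums[OF s]) (use b in auto)
  finally show "cmod (\<Sum>\<^sub>\<infinity>k. cnj (f k) * g k) \<le> A * B" .
qed

text \<open>Both sides are continuous in \<open>v\<close> for the square norm and agree on
  trigonometric polynomials, which are dense.\<close>

theorem parseval:
  assumes u: "sqL2 u" and v: "sqL2 v"
  shows "((\<lambda>k. cnj (fc u k) * fc v k) has_sum ip u v) UNIV"
proof -
  define A where "A = sqrt (sqnorm u)"
  have bes: "finite K \<Longrightarrow> (\<Sum>k\<in>K. (cmod (fc w k))\<^sup>2) \<le> (sqrt (sqnorm w))\<^sup>2" if "sqL2 w" for w K
    using bessel[OF that] by simp
  have bs: "(\<lambda>k. cnj (fc u k) * fc w k) summable_on UNIV"
    "cmod (\<Sum>\<^sub>\<infinity>k. cnj (fc u k) * fc w k) \<le> A * sqrt (sqnorm w)" if "sqL2 w" for w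
    unfolding A_def
    by (rule abs_summable_prod[OF bes[OF u] bes[OF that]]; simp)+
  have "cmod ((\<Sum>\<^sub>\<infinity>k. cnj (fc u k) * fc v k) - ip u v) \<le> 0"
  proof (rule field_le_epsilon)
    fix \<epsilon> :: real assume e: "\<epsilon> > 0"
    \<comment> \<open>With \<open>w = v - p\<close>, the series is at most
      \<open>A * sqrt (sqnorm w)\<close> and \<open>ip u w\<close> is at most
      \<open>\<delta> * sqnorm u + sqnorm w / \<delta>\<close>. The choices of
      \<open>\<delta>\<close> and \<open>\<eta>\<close> make each of these three terms at most
      \<open>\<epsilon> / 3\<close>; the added 1 keeps denominators positive.\<close>
    define \<delta> where "\<delta> = \<epsilon> / (3 * (sqnorm u + 1))"
    have d: "\<delta> > 0" using e by (simp add: \<delta>_def add_nonneg_pos)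
    define \<eta> where "\<eta> = min (\<delta> * \<epsilon> / 3) ((\<epsilon> / (3 * (A + 1)))\<^sup>2)"
    have A0: "A \<ge> 0" by (simp add: A_def)
    have "\<eta> > 0" using e d A0 by (simp add: \<eta>_def)
    then obtain p where p: "trig_poly p" "sqnorm (\<lambda>x. v x - p x) < \<eta>"
      using approximable_sqL2[OF v] unfolding approximable_def by metis
    define w where "w = (\<lambda>x. v x - p x)"
    have sp: "sqL2 p" by (rule sqL2_trig_poly) fact
    have sw: "sqL2 w" unfolding w_def by (intro sqL2_diff v sp)
    have v_eq: "v = (\<lambda>x. p x + w x)" by (simp add: w_def)
    have "(\<Sum>\<^sub>\<infinity>k. cnj (fc u k) * fc v k) = (\<Sum>\<^sub>\<infinity>k. cnj (fc u k) * fc p k) + (\<Sum>\<^sub>\<infinity>k. cnj (fc u k) * fc w k)"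
      unfolding v_eq fc_add[OF sp sw] distrib_left by (intro infsum_add bs sp sw)
    also have "(\<Sum>\<^sub>\<infinity>k. cnj (fc u k) * fc p k) = ip u p"
      by (intro infsumI parseval_trig_poly u p)
    finally have eq: "(\<Sum>\<^sub>\<infinity>k. cnj (fc u k) * fc v k) - ip u v = (\<Sum>\<^sub>\<infinity>k. cnj (fc u k) * fc w k) - ip u w"
      by (subst (2) v_eq) (simp add: ip_add_right u sp sw)
    have "sqrt (sqnorm w) \<le> \<epsilon> / (3 * (A + 1))"
      using p(2) e A0 by (intro real_le_lsqrt) (auto simp: w_def \<eta>_def)
    then have "A * sqrt (sqnorm w) \<le> A * (\<epsilon> / (3 * (A + 1)))"
      using A0 by (intro mult_left_mono)
    also have "\<dots> \<le> \<epsilon> / 3"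
      using A0 e by (simp add: field_simps)
    finally have 1: "cmod (\<Sum>\<^sub>\<infinity>k. cnj (fc u k) * fc w k) \<le> \<epsilon> / 3"
      using bs(2)[OF sw] by linarith
    have "sqnorm w / \<delta> \<le> \<epsilon> / 3"
      using p(2) d by (simp add: w_def \<eta>_def field_simps)
    moreover have "\<delta> * sqnorm u \<le> \<epsilon> / 3"
    proof -
      have "\<delta> * sqnorm u \<le> \<delta> * (sqnorm u + 1)" using d by simp
      also have "\<dots> = \<epsilon> / 3"
        using add_nonneg_pos[OF sqnorm_nonneg[of u], of 1] by (simp add: \<delta>_def divide_simps)
      finally show ?thesis .
    qed
    ultimately have 2: "cmod (ip u w) \<le> 2 * \<epsilon> / 3"
      using cmod_ip_le[OF u sw d] by linarith
    show "cmod ((\<Sum>\<^sub>\<infinity>k. cnj (fc u k) * fc v k) - ip u v) \<le> 0 + \<epsilon>"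
      unfolding eq using norm_triangle_ineq4[of "\<Sum>\<^sub>\<infinity>k. cnj (fc u k) * fc w k" "ip u w"] 1 2 by linarith
  qed
  then show ?thesis
    using has_sum_infsum[OF bs(1)[OF v]] by simp
qed

subsection \<open>Fourier series of smooth functions\<close>

lemma sqL2_continuous:
  fixes f :: "pt \<Rightarrow> complex"
  assumes "continuous_on UNIV f"
  shows "sqL2 f" "\<exists>B. \<forall>x\<in>sq. cmod (f x) \<le> B"
proof -
  have m: "f \<in> borel_measurable Q"
    using assms by (intro measurable_restrict_space1) (simp add: borel_measurable_continuous_onI)
  have "compact (f ` sq)"
    using assms by (intro compact_continuous_image) (auto simp: sq_cbox intro: continuous_on_subset)
  from compact_imp_bounded[OF this] show B: "\<exists>B. \<forall>x\<in>sq. cmod (f x) \<le> B"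
    by (auto simp: bounded_iff)
  then show "sqL2 f" using m sqL2_bounded by blast
qed

lemma cmod_fc_le:
  assumes "f \<in> borel_measurable Q" "\<And>x. x \<in> sq \<Longrightarrow> cmod (f x) \<le> B"
  shows "cmod (fc f k) \<le> B"
proof -
  have i: "integrable Q (\<lambda>x. cnj (ek k x) * f x)"
    by (intro sqL2_prod sqL2_ek sqL2_bounded[OF assms])
  have "cmod (fc f k) \<le> (\<integral>x. cmod (cnj (ek k x) * f x) \<partial>Q)"
    unfolding fc_ip ip_Q by (rule integral_norm_bound)
  also have "\<dots> \<le> (\<integral>x. B \<partial>Q)"
    by (intro integral_mono integrable_norm i) (use assms(2) in \<open>auto simp: norm_mult\<close>)
  also have "\<dots> = B" by (simp add: measure_Q)
  finally show ?thesis .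
qed

lemma fc_partial_fst:
  assumes d: "\<And>x y. ((\<lambda>s. f (s, y)) has_vector_derivative f1 (x, y)) (at x)"
    and c: "continuous_on UNIV f" "continuous_on UNIV f1" and p: "periodic f"
  shows "fc f1 k = 2 * pi * \<i> * of_int (fst k) * fc f k"
proof -
  have "(\<integral>x. f1 x * ek (- k) x + f x * ((2 * pi * \<i> * of_int (fst (- k))) * ek (- k) x) \<partial>Q) = 0"
  proof (rule integral_partial_fst_eq_0[of "\<lambda>x. f x * ek (- k) x"])
    show "((\<lambda>s. f (s, y) * ek (- k) (s, y)) has_vector_derivative
        f1 (x, y) * ek (- k) (x, y) + f (x, y) * ((2 * pi * \<i> * of_int (fst (- k))) * ek (- k) (x, y))) (at x)" for x y
      using has_vector_derivative_mult[OF d ek_deriv_fst[of "- k"]] by (simp add: add.commute)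
    show "continuous_on UNIV (\<lambda>x. f1 x * ek (- k) x + f x * ((2 * pi * \<i> * of_int (fst (- k))) * ek (- k) x))"
      by (intro continuous_intros c)
    show "periodic (\<lambda>x. f x * ek (- k) x)"
      using p periodic_ek[of "- k"] by (simp add: periodic_def)
  qed
  also have "(\<lambda>x. f1 x * ek (- k) x + f x * ((2 * pi * \<i> * of_int (fst (- k))) * ek (- k) x)) =
     (\<lambda>x. cnj (ek k x) * f1 x - (2 * pi * \<i> * of_int (fst k)) * (cnj (ek k x) * f x))"
    by (auto simp: cnj_ek fun_eq_iff)
  finally show ?thesis
    using sqL2_prod[OF sqL2_ek sqL2_continuous(1)[OF c(1)], of k] sqL2_prod[OF sqL2_ek sqL2_continuous(1)[OF c(2)], of k]
    by (simp add: fc_ip ip_Q)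
qed

lemma fc_partial_snd:
  assumes d: "\<And>x y. ((\<lambda>s. f (x, s)) has_vector_derivative f2 (x, y)) (at y)"
    and c: "continuous_on UNIV f" "continuous_on UNIV f2" and p: "periodic f"
  shows "fc f2 k = 2 * pi * \<i> * of_int (snd k) * fc f k"
proof -
  have "(\<integral>x. f2 x * ek (- k) x + f x * ((2 * pi * \<i> * of_int (snd (- k))) * ek (- k) x) \<partial>Q) = 0"
  proof (rule integral_partial_snd_eq_0[of "\<lambda>x. f x * ek (- k) x"])
    show "((\<lambda>s. f (x, s) * ek (- k) (x, s)) has_vector_derivative
        f2 (x, y) * ek (- k) (x, y) + f (x, y) * ((2 * pi * \<i> * of_int (snd (- k))) * ek (- k) (x, y))) (at y)" for x y
      using has_vector_derivative_mult[OF d ek_deriv_snd[of "- k"]] by (simp add: add.commute)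
    show "continuous_on UNIV (\<lambda>x. f2 x * ek (- k) x + f x * ((2 * pi * \<i> * of_int (snd (- k))) * ek (- k) x))"
      by (intro continuous_intros c)
    show "periodic (\<lambda>x. f x * ek (- k) x)"
      using p periodic_ek[of "- k"] by (simp add: periodic_def)
  qed
  also have "(\<lambda>x. f2 x * ek (- k) x + f x * ((2 * pi * \<i> * of_int (snd (- k))) * ek (- k) x)) =
     (\<lambda>x. cnj (ek k x) * f2 x - (2 * pi * \<i> * of_int (snd k)) * (cnj (ek k x) * f x))"
    by (auto simp: cnj_ek fun_eq_iff)
  finally show ?thesis
    using sqL2_prod[OF sqL2_ek sqL2_continuous(1)[OF c(1)], of k] sqL2_prod[OF sqL2_ek sqL2_continuous(1)[OF c(2)], of k]
    by (simp add: fc_ip ip_Q)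
qed

section \<open>Decay and summability of Fourier coefficients of smooth functions\<close>

definition dir_deriv :: "pt \<Rightarrow> (pt \<Rightarrow> real) \<Rightarrow> pt \<Rightarrow> real" where
  "dir_deriv v f x = frechet_derivative f (at x) v"

lemma smooth_continuous: "smooth f \<Longrightarrow> continuous_on UNIV f"
  by (metis Ck.simps(1) smooth_def)

lemma smooth_has_derivative: "smooth f \<Longrightarrow> (f has_derivative frechet_derivative f (at x)) (at x)"
  unfolding smooth_def frechet_derivative_works[symmetric]
  by (metis Ck.simps(2) UNIV_I differentiable_on_def)

lemma smooth_dir_deriv: "smooth f \<Longrightarrow> smooth (dir_deriv v f)"
  unfolding smooth_def dir_deriv_def[abs_def] by (metis Ck.simps(2))

lemma periodic_dir_deriv:
  assumes "smooth f" "periodic f"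
  shows "periodic (dir_deriv v f)"
  unfolding periodic_def
proof (intro allI)
  fix x :: pt and k1 k2 :: int
  define a where "a = (of_int k1 :: real, of_int k2 :: real)"
  have "f (y + a) = f y" for y
    using assms(2) by (cases y) (auto simp: periodic_def a_def)
  then have eq: "(\<lambda>y. f (y + a)) = f" by auto
  have "((\<lambda>y. f (y + a)) has_derivative frechet_derivative f (at (x + a))) (at x)"
    using has_derivative_compose[OF has_derivative_add_const[OF has_derivative_ident] smooth_has_derivative[OF assms(1)]]
    by simp
  then have "frechet_derivative f (at (x + a)) = frechet_derivative f (at x)"
    unfolding eq by (rule frechet_derivative_at)
  then show "dir_deriv v f (fst x + of_int k1, snd x + of_int k2) = dir_deriv v f x"
    by (cases x) (simp add: dir_deriv_def a_def)
qed

lemma dir_deriv_partials: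
  assumes "smooth f"
  shows "((\<lambda>s. complex_of_real (f (s, y))) has_vector_derivative of_real (dir_deriv (1, 0) f (x, y))) (at x)"
    and "((\<lambda>s. complex_of_real (f (x, s))) has_vector_derivative of_real (dir_deriv (0, 1) f (x, y))) (at y)"
proof -
  let ?D = "frechet_derivative f (at (x, y))"
  have D: "(f has_derivative ?D) (at (x, y))"
    by (rule smooth_has_derivative[OF assms])
  have l: "?D (c *\<^sub>R v) = c *\<^sub>R ?D v" for c v
    using has_derivative_bounded_linear[OF D] by (simp add: linear_simps)
  have "((\<lambda>s. f (s, y)) has_derivative (\<lambda>s. ?D (s, 0))) (at x)"
    by (rule has_derivative_compose[of "\<lambda>s. (s, y)"])
       (auto intro!: has_derivative_Pair has_derivative_ident has_derivative_const D)
  moreover have "(\<lambda>s. ?D (s, 0)) = (\<lambda>s. s *\<^sub>R dir_deriv (1, 0) f (x, y))"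
    unfolding dir_deriv_def l[symmetric] by simp
  ultimately show "((\<lambda>s. complex_of_real (f (s, y))) has_vector_derivative of_real (dir_deriv (1, 0) f (x, y))) (at x)"
    by (intro has_vector_derivative_of_real) (simp only: has_real_derivative_iff_has_vector_derivative has_vector_derivative_def)
  have "((\<lambda>s. f (x, s)) has_derivative (\<lambda>s. ?D (0, s))) (at y)"
    by (rule has_derivative_compose[of "\<lambda>s. (x, s)"])
       (auto intro!: has_derivative_Pair has_derivative_ident has_derivative_const D)
  moreover have "(\<lambda>s. ?D (0, s)) = (\<lambda>s. s *\<^sub>R dir_deriv (0, 1) f (x, y))"
    unfolding dir_deriv_def l[symmetric] by simp
  ultimately show "((\<lambda>s. complex_of_real (f (x, s))) has_vector_derivative of_real (dir_deriv (0, 1) f (x, y))) (at y)"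
    by (intro has_vector_derivative_of_real) (simp only: has_real_derivative_iff_has_vector_derivative has_vector_derivative_def)
qed

definition rfc :: "(pt \<Rightarrow> real) \<Rightarrow> int \<times> int \<Rightarrow> complex" where
  "rfc f = fc (\<lambda>x. complex_of_real (f x))"

lemma rfc_dir_deriv:
  assumes "smooth f" "periodic f"
  shows "rfc (dir_deriv (1, 0) f) k = 2 * pi * \<i> * of_int (fst k) * rfc f k"
    and "rfc (dir_deriv (0, 1) f) k = 2 * pi * \<i> * of_int (snd k) * rfc f k"
  unfolding rfc_def using assms
  by (intro fc_partial_fst fc_partial_snd;
      auto intro!: dir_deriv_partials continuous_intros smooth_continuous smooth_dir_deriv simp: periodic_def)+

lemma rfc_bounded:
  assumes "smooth f"
  shows "\<exists>B. \<forall>k. cmod (rfc f k) \<le> B"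
proof -
  have c: "continuous_on UNIV (\<lambda>x. complex_of_real (f x))"
    using assms by (intro continuous_intros smooth_continuous)
  obtain B where "\<forall>x\<in>sq. cmod (complex_of_real (f x)) \<le> B"
    using sqL2_continuous(2)[OF c] by blast
  then show ?thesis
    using sqL2_continuous(1)[OF c] cmod_fc_le[of "\<lambda>x. complex_of_real (f x)" B]
    unfolding rfc_def sqL2_def by blast
qed

text \<open>The expanded weight has the terms 1, \<open>k1^2\<close>, \<open>k2^2\<close> and
  \<open>k1^2 k2^2\<close>, controlled by \<open>f\<close> and by its second derivatives in the
  first, the second and both variables. The inverse of this product weight is summable over Z^2 as a
  product of one-dimensional sums.\<close>

lemma rfc_decay:
  assumes "smooth f" "periodic f"
  obtains B where "\<And>k. cmod (rfc f k) * ((1 + (of_int (fst k))\<^sup>2) * (1 + (of_int (snd k))\<^sup>2)) \<le> B"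
proof -
  let ?d1 = "dir_deriv (1, 0)" and ?d2 = "dir_deriv (0, 1)"
  have fst2: "cmod (rfc (?d1 (?d1 g)) k) = (2 * pi)\<^sup>2 * (of_int (fst k))\<^sup>2 * cmod (rfc g k)"
    and snd2: "cmod (rfc (?d2 (?d2 g)) k) = (2 * pi)\<^sup>2 * (of_int (snd k))\<^sup>2 * cmod (rfc g k)"
    if "smooth g" "periodic g" for g k
    using that by (simp_all add: rfc_dir_deriv smooth_dir_deriv periodic_dir_deriv norm_mult power2_eq_square)
  note sp = smooth_dir_deriv periodic_dir_deriv assms
  obtain B0 where B0: "\<And>k. cmod (rfc f k) \<le> B0" using rfc_bounded[OF assms(1)] by blast
  obtain B1 where B1: "\<And>k. cmod (rfc (?d1 (?d1 f)) k) \<le> B1"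
    using rfc_bounded[OF smooth_dir_deriv[OF smooth_dir_deriv[OF assms(1)]]] by blast
  obtain B2 where B2: "\<And>k. cmod (rfc (?d2 (?d2 f)) k) \<le> B2"
    using rfc_bounded[OF smooth_dir_deriv[OF smooth_dir_deriv[OF assms(1)]]] by blast
  obtain B3 where B3: "\<And>k. cmod (rfc (?d1 (?d1 (?d2 (?d2 f)))) k) \<le> B3"
    using rfc_bounded[OF smooth_dir_deriv[OF smooth_dir_deriv[OF smooth_dir_deriv[OF smooth_dir_deriv[OF assms(1)]]]]] by blast
  show ?thesis
  proof (rule that)
    fix k :: "int \<times> int"
    define a b c where "a = (real_of_int (fst k))\<^sup>2" and "b = (real_of_int (snd k))\<^sup>2" and "c = cmod (rfc f k)"
    have nn: "a \<ge> 0" "b \<ge> 0" "c \<ge> 0" by (auto simp: a_def b_def c_def)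
    define P where "P = (2 * pi)\<^sup>2"
    have "2 * pi \<ge> 1" using pi_gt3 by linarith
    then have P: "P \<ge> 1" unfolding P_def by (rule one_le_power)
    have 1: "c * a \<le> B1"
    proof -
      have "1 * (c * a) \<le> P * (c * a)" using P nn by (intro mult_right_mono) auto
      also have "\<dots> = cmod (rfc (?d1 (?d1 f)) k)"
        using fst2[OF assms, of k] by (simp add: a_def c_def P_def)
      finally show ?thesis using B1[of k] by linarith
    qed
    have 2: "c * b \<le> B2"
    proof -
      have "1 * (c * b) \<le> P * (c * b)" using P nn by (intro mult_right_mono) auto
      also have "\<dots> = cmod (rfc (?d2 (?d2 f)) k)"
        using snd2[OF assms, of k] by (simp add: b_def c_def P_def)
      finally show ?thesis using B2[of k] by linarith
    qed
    have 3: "c * a * b \<le> B3"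
    proof -
      have "1 * 1 * (c * a * b) \<le> P * P * (c * a * b)"
        using P nn by (intro mult_right_mono mult_mono) auto
      also have "\<dots> = cmod (rfc (?d1 (?d1 (?d2 (?d2 f)))) k)"
        using fst2[of "?d2 (?d2 f)" k] snd2[OF assms, of k] sp by (simp add: a_def b_def c_def P_def)
      finally show ?thesis using B3[of k] by linarith
    qed
    show "cmod (rfc f k) * ((1 + (of_int (fst k))\<^sup>2) * (1 + (of_int (snd k))\<^sup>2)) \<le> B0 + B1 + B2 + B3"
      using 1 2 3 B0[of k] unfolding a_def[symmetric] b_def[symmetric] c_def[symmetric]
      by (simp add: algebra_simps)
  qed
qed

lemma sum_inverse_squares_int_bounded:
  obtains S :: real where "S \<ge> 0" "\<And>A::int set. finite A \<Longrightarrow> (\<Sum>k\<in>A. 1 / (1 + (of_int k)\<^sup>2)) \<le> S"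
proof -
  let ?g = "\<lambda>n::nat. 1 / (1 + (real n)\<^sup>2)"
  have "summable (\<lambda>n::nat. inverse (real (n ^ 2)))"
    using inverse_power_summable[of 2, where 'a = real] by simp
  then have s: "summable ?g"
  proof (rule summable_comparison_test'[where N = 1])
    fix n :: nat assume "n \<ge> 1"
    then have "(real n)\<^sup>2 > 0" by simp
    then show "norm (?g n) \<le> inverse (real (n ^ 2))"
      by (simp add: inverse_eq_divide) (intro divide_left_mono; simp add: add_pos_pos)
  qed
  have "(\<Sum>k\<in>A. 1 / (1 + (of_int k)\<^sup>2)) \<le> 2 * suminf ?g" if "finite A" for A :: "int set"
  proof -
    obtain N where N: "A \<subseteq> {- int N..int N}"
    proof -
      obtain c where "\<And>x. x \<in> A \<Longrightarrow> abs x \<le> c"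
        using \<open>finite A\<close> by (metis finite_imageI Max_ge imageI)
      then show ?thesis by (intro that[of "nat c"]) force
    qed
    have "{- int N..int N} \<subseteq> int ` {..N} \<union> (\<lambda>n. - int n) ` {..N}"
    proof
      fix k assume "k \<in> {- int N..int N}"
      then show "k \<in> int ` {..N} \<union> (\<lambda>n. - int n) ` {..N}"
        by (cases k) (auto intro!: image_eqI[of _ _ "nat (abs k)"])
    qed
    then have "(\<Sum>k\<in>A. 1 / (1 + (of_int k)\<^sup>2)) \<le> (\<Sum>k\<in>int ` {..N} \<union> (\<lambda>n. - int n) ` {..N}. 1 / (1 + (real_of_int k)\<^sup>2))"
      using N by (intro sum_mono2) auto
    also have "\<dots> \<le> (\<Sum>k\<in>int ` {..N}. 1 / (1 + (real_of_int k)\<^sup>2)) + (\<Sum>k\<in>(\<lambda>n. - int n) ` {..N}. 1 / (1 + (real_of_int k)\<^sup>2))"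
      by (subst sum_Un) (auto intro: sum_nonneg)
    also have "\<dots> = (\<Sum>n\<le>N. ?g n) + (\<Sum>n\<le>N. ?g n)"
      by (subst (1 2) sum.reindex) (auto simp: inj_on_def)
    also have "\<dots> \<le> 2 * suminf ?g"
      using sum_le_suminf[OF s, of "{..N}"] by simp
    finally show ?thesis .
  qed
  moreover have "2 * suminf ?g \<ge> 0" using suminf_nonneg[OF s] by simp
  ultimately show ?thesis using that by blast
qed

lemma rfc_summable:
  assumes "smooth f" "periodic f"
  shows "(\<lambda>k. cmod (rfc f k)) summable_on UNIV"
proof -
  obtain B where B: "\<And>k. cmod (rfc f k) * ((1 + (of_int (fst k))\<^sup>2) * (1 + (of_int (snd k))\<^sup>2)) \<le> B"
    by (rule rfc_decay[OF assms]) (rule that)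
  have "B \<ge> 0" using order_trans[OF norm_ge_zero B[of 0, simplified]] .
  obtain S :: real where S: "S \<ge> 0" "\<And>A::int set. finite A \<Longrightarrow> (\<Sum>k\<in>A. 1 / (1 + (of_int k)\<^sup>2)) \<le> S"
    by (rule sum_inverse_squares_int_bounded) (rule that)
  have "(\<Sum>k\<in>F. cmod (rfc f k)) \<le> B * (S * S)" if "finite F" for F
  proof -
    \<comment> \<open>Enlarging \<open>F\<close> to the rectangle spanned by its projections lets
      the double sum factor.\<close>
    have "(\<Sum>k\<in>F. cmod (rfc f k)) \<le> (\<Sum>k\<in>fst ` F \<times> snd ` F. cmod (rfc f k))"
      using that by (intro sum_mono2 subsetI) (auto simp: mem_Times_iff)
    also have "\<dots> \<le> (\<Sum>k\<in>fst ` F \<times> snd ` F. B * (1 / (1 + (of_int (fst k))\<^sup>2) * (1 / (1 + (of_int (snd k))\<^sup>2))))"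
    proof (intro sum_mono)
      fix k :: "int \<times> int"
      have "(1 + (real_of_int (fst k))\<^sup>2) * (1 + (real_of_int (snd k))\<^sup>2) > 0"
        by (intro mult_pos_pos add_pos_nonneg) auto
      then show "cmod (rfc f k) \<le> B * (1 / (1 + (of_int (fst k))\<^sup>2) * (1 / (1 + (of_int (snd k))\<^sup>2)))"
        using B[of k] by (simp add: pos_le_divide_eq)
    qed
    also have "\<dots> = B * ((\<Sum>a\<in>fst ` F. 1 / (1 + (of_int a)\<^sup>2)) * (\<Sum>b\<in>snd ` F. 1 / (1 + (of_int b)\<^sup>2)))"
      by (simp only: sum_product sum.cartesian_product case_prod_unfold) (simp only: sum_distrib_left)
    also have "\<dots> \<le> B * (S * S)"
      using S that \<open>B \<ge> 0\<close> by (intro mult_left_mono mult_mono sum_nonneg) auto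
    finally show ?thesis .
  qed
  then show ?thesis
    by (intro nonneg_bdd_above_summable_on) (auto intro!: bdd_aboveI2)
qed

text \<open>The uniform error of the Fourier series truncated to \<open>F\<close>. As
  \<open>tail v {}\<close> is the full l1 norm, sup bounds come out as the case of an empty
  truncation.\<close>

definition tail :: "(int \<times> int \<Rightarrow> complex) \<Rightarrow> (int \<times> int) set \<Rightarrow> real" where
  "tail v F = (\<Sum>\<^sub>\<infinity>k\<in>- F. cmod (v k))"

lemma tail_eq:
  assumes "(\<lambda>k. cmod (v k)) summable_on UNIV" "finite F"
  shows "tail v F = tail v {} - (\<Sum>k\<in>F. cmod (v k))"
proof -
  have "infsum (\<lambda>k. cmod (v k)) (UNIV - F) = infsum (\<lambda>k. cmod (v k)) UNIV - infsum (\<lambda>k. cmod (v k)) F"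
    using assms by (intro infsum_Diff) auto
  then show ?thesis using assms by (simp add: tail_def Compl_eq_Diff_UNIV)
qed

lemma tail_nonneg: "tail v F \<ge> 0"
  unfolding tail_def by (intro infsum_nonneg) auto

lemma tail_small:
  assumes "(\<lambda>k. cmod (v k)) summable_on UNIV" "\<epsilon> > 0"
  obtains F where "finite F" "tail v F < \<epsilon>"
proof -
  have "((\<lambda>F. \<Sum>k\<in>F. cmod (v k)) \<longlongrightarrow> tail v {}) (finite_subsets_at_top UNIV)"
    using infsum_tendsto[OF assms(1)] by (simp add: tail_def)
  then have "\<forall>\<^sub>F F in finite_subsets_at_top UNIV. (\<Sum>k\<in>F. cmod (v k)) > tail v {} - \<epsilon>"
    using assms(2) by (intro order_tendstoD(1)) auto
  then obtain F where F: "finite F" "(\<Sum>k\<in>F. cmod (v k)) > tail v {} - \<epsilon>"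
    by (auto simp: eventually_finite_subsets_at_top)
  then have "tail v F < \<epsilon>" using tail_eq[OF assms(1) F(1)] by linarith
  then show ?thesis using F that by blast
qed

lemma periodic_eqI:
  assumes "periodic f" "periodic g" "\<And>x. x \<in> sq \<Longrightarrow> f x = g x"
  shows "f x = g x"
proof -
  let ?a = "- \<lfloor>fst x\<rfloor>" and ?b = "- \<lfloor>snd x\<rfloor>"
  let ?y = "(fst x + of_int ?a, snd x + of_int ?b)"
  have "?y \<in> sq"
    by (auto simp: sq_def) linarith+
  then have "f ?y = g ?y" by (rule assms(3))
  moreover have "f ?y = f x" "g ?y = g x"
    using assms(1,2) unfolding periodic_def by blast+
  ultimately show ?thesis by simp
qed

text \<open>The series converges uniformly to a continuous \<open>S\<close> with the same
  coefficients as \<open>f\<close>. By Parseval the difference has norm 0, by continuity it vanishes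
  on the square, and by periodicity everywhere.\<close>

lemma fourier_series:
  assumes f: "smooth f" "periodic f" and F: "finite F"
  shows "cmod (complex_of_real (f x) - (\<Sum>m\<in>F. rfc f m * ek m x)) \<le> tail (rfc f) F"
proof -
  let ?v = "rfc f"
  define S where "S x = (\<Sum>\<^sub>\<infinity>m. ?v m * ek m x)" for x
  note sv = rfc_summable[OF f]
  have svx: "(\<lambda>m. ?v m * ek m x) summable_on A" for x A
  proof (rule abs_summable_summable)
    have "(\<lambda>k. cmod (?v k)) summable_on A"
      using sv by (rule summable_on_subset_banach) simp
    then show "(\<lambda>m. norm (?v m * ek m x)) summable_on A" by (simp add: norm_mult)
  qed
  have tl: "cmod (S x - (\<Sum>m\<in>F. ?v m * ek m x)) \<le> tail ?v F" if "finite F" for F x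
  proof -
    have "S x - (\<Sum>m\<in>F. ?v m * ek m x) = (\<Sum>\<^sub>\<infinity>m\<in>UNIV - F. ?v m * ek m x)"
      unfolding S_def using that by (subst infsum_Diff) (auto intro: svx)
    also have "cmod \<dots> \<le> (\<Sum>\<^sub>\<infinity>m\<in>UNIV - F. cmod (?v m * ek m x))"
      using summable_on_subset_banach[OF sv, of "UNIV - F"] by (intro norm_infsum_bound) (simp add: norm_mult)
    finally show ?thesis by (simp add: tail_def norm_mult Compl_eq_Diff_UNIV)
  qed
  have cS: "continuous_on UNIV S"
    unfolding S_def[abs_def]
  proof (rule uniform_limit_theorem)
    show "uniform_limit UNIV (\<lambda>X y. \<Sum>m\<in>X. ?v m * ek m y) (\<lambda>y. \<Sum>\<^sub>\<infinity>m. ?v m * ek m y) (finite_subsets_at_top UNIV)"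
      by (rule Weierstrass_m_test_general[OF _ sv]) (simp add: norm_mult)
    show "\<forall>\<^sub>F F in finite_subsets_at_top UNIV. continuous_on UNIV (\<lambda>y. \<Sum>m\<in>F. ?v m * ek m y)"
      by (intro always_eventually allI continuous_intros)
  qed simp
  have cf: "continuous_on UNIV (\<lambda>x. complex_of_real (f x))"
    by (intro continuous_intros smooth_continuous f)
  note sS = sqL2_continuous(1)[OF cS] and sf = sqL2_continuous(1)[OF cf]
  have fS: "fc S k = ?v k" for k
  proof -
    have "cmod (fc S k - ?v k) \<le> 0"
    proof (rule field_le_epsilon)
      fix \<epsilon> :: real assume "\<epsilon> > 0"
      then obtain F where F: "finite F" "tail ?v F < \<epsilon>" using tail_small[OF sv] by blast
      let ?G = "insert k F"
      let ?p = "\<lambda>x. \<Sum>m\<in>?G. ?v m * ek m x"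
      have p: "sqL2 ?p" by (intro sqL2_sum sqL2_cmult sqL2_ek)
      have "fc ?p k = (\<Sum>m\<in>?G. ip (ek k) (\<lambda>x. ?v m * ek m x))"
        unfolding fc_ip by (intro ip_sum_right sqL2_cmult sqL2_ek)
      also have "\<dots> = ?v k"
        using F by (simp only: ip_cmult_right ip_ek_ek) (simp add: if_distrib[of "\<lambda>x. _ * x"] cong: if_cong)
      finally have "fc (\<lambda>x. S x - ?p x) k = fc S k - ?v k"
        using fc_diff[OF sS p] by simp
      moreover have "cmod (fc (\<lambda>x. S x - ?p x) k) \<le> tail ?v ?G"
        using F sqL2_diff[OF sS p] tl[of ?G] by (intro cmod_fc_le) (auto simp: sqL2_def)
      moreover have "tail ?v ?G \<le> tail ?v F"
      proof -
        have "(\<Sum>k\<in>F. cmod (?v k)) \<le> (\<Sum>k\<in>?G. cmod (?v k))"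
          using F by (intro sum_mono2) auto
        then show ?thesis
          using tail_eq[OF sv F(1)] tail_eq[OF sv, of ?G] F by simp
      qed
      ultimately show "cmod (fc S k - ?v k) \<le> 0 + \<epsilon>" using F(2) by simp
    qed
    then show ?thesis by simp
  qed
  let ?d = "\<lambda>x. S x - complex_of_real (f x)"
  have sd: "sqL2 ?d" by (intro sqL2_diff sS sf)
  have "fc ?d k = 0" for k
    using fc_diff[OF sS sf, of k] by (simp add: fS rfc_def)
  then have "((\<lambda>k::int \<times> int. 0) has_sum ip ?d ?d) UNIV"
    using parseval[OF sd sd] by simp
  then have "ip ?d ?d = 0"
    using has_sum_unique has_sum_0[of UNIV "\<lambda>_::int \<times> int. 0 :: complex"] by blast
  then have "sqnorm ?d = 0"
    using sqnorm_ip[of ?d] by (metis of_real_eq_0_iff)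
  moreover have cd: "continuous_on UNIV (\<lambda>x. (cmod (?d x))\<^sup>2)"
    by (intro continuous_intros cS smooth_continuous f)
  ultimately have "integral (cbox (0, 0) (1, 1)) (\<lambda>x. (cmod (?d x))\<^sup>2) = 0"
    using integral_Q_cbox(2)[OF cd] by (simp add: sqnorm_def)
  then have "\<forall>x\<in>cbox (0, 0) (1, 1). (cmod (?d x))\<^sup>2 = 0"
    by (subst (asm) integral_cbox_eq_0_iff)
       (auto intro: continuous_on_subset[OF cd] simp: box_prod)
  then have 1: "S x = complex_of_real (f x)" if "x \<in> sq" for x
    using that by (simp add: sq_cbox)
  have 2: "periodic S"
    unfolding S_def[abs_def] periodic_def
    by (simp only: periodic_ek[unfolded periodic_def, rule_format] simp_thms)
  have 3: "periodic (\<lambda>x. complex_of_real (f x))"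
    using f(2) by (simp add: periodic_def)
  have "S x = complex_of_real (f x)"
    by (rule periodic_eqI[OF 2 3 1])
  then show ?thesis using tl[OF F, of x] by simp
qed

subsection \<open>Fourier coefficients of solutions\<close>

text \<open>Angular frequency of the mode \<open>k\<close> under the free equation: the eigenvalue
  of \<open>- (h^2 / 2)\<close> times the Laplacian, divided by \<open>h\<close>.\<close>

definition freq :: "real \<Rightarrow> int \<times> int \<Rightarrow> real" where
  "freq h k = 2 * pi\<^sup>2 * h * ((of_int (fst k))\<^sup>2 + (of_int (snd k))\<^sup>2)"

lemma lap_ek: "lap (ek k) x = - (4 * pi\<^sup>2 * ((of_int (fst k))\<^sup>2 + (of_int (snd k))\<^sup>2)) * ek k x"
proof -
  have "vector_derivative (\<lambda>s. vector_derivative (\<lambda>r. ek k (r, snd x)) (at s)) (at (fst x)) =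
     (2 * pi * \<i> * of_int (fst k)) * ((2 * pi * \<i> * of_int (fst k)) * ek k (fst x, snd x))"
    unfolding vector_derivative_at[OF ek_deriv_fst]
    by (intro vector_derivative_at has_vector_derivative_mult_right ek_deriv_fst)
  moreover have "vector_derivative (\<lambda>s. vector_derivative (\<lambda>r. ek k (fst x, r)) (at s)) (at (snd x)) =
     (2 * pi * \<i> * of_int (snd k)) * ((2 * pi * \<i> * of_int (snd k)) * ek k (fst x, snd x))"
    unfolding vector_derivative_at[OF ek_deriv_snd]
    by (intro vector_derivative_at has_vector_derivative_mult_right ek_deriv_snd)
  ultimately show ?thesis
    by (simp add: lap_def algebra_simps power2_eq_square)
qed

lemma sqL2_real_mult:
  fixes W :: "pt \<Rightarrow> real"
  assumes "continuous_on UNIV W" "sqL2 u"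
  shows "sqL2 (\<lambda>x. of_real (W x) * u x)"
proof -
  have c: "continuous_on UNIV (\<lambda>x. complex_of_real (W x))"
    using assms by (intro continuous_intros)
  obtain B where "\<forall>x\<in>sq. cmod (complex_of_real (W x)) \<le> B"
    using sqL2_continuous(2)[OF c] by blast
  then show ?thesis
    using sqL2_continuous(1)[OF c] assms(2)
    by (intro sqL2_mult_bounded(1)[where B = B]) (auto simp: sqL2_def)
qed

text \<open>The weak formulation tested against \<open>ek k\<close>, an eigenfunction of the
  Laplacian. Since \<open>W\<close> is real, it moves from the mode to the solution.\<close>

lemma schr_coeff:
  assumes sol: "schr_sol h W \<psi> u" and h: "h > 0" and W: "continuous_on UNIV W"
  shows "((\<lambda>s. fc (u s) k) has_vector_derivative
     (- \<i> * freq h k * fc (u t) k - \<i> / h * fc (\<lambda>x. of_real (W x) * u t x) k)) (at t)"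
proof -
  have ut: "sqL2 (u t)"
    using sol L2_sqL2 by (simp add: schr_sol_def)
  let ?c = "complex_of_real (h * freq h k)"
  have e: "(\<lambda>x. - (complex_of_real (h\<^sup>2 / 2)) * lap (ek k) x + complex_of_real (W x) * ek k x) =
      (\<lambda>x. ?c * ek k x + of_real (W x) * ek k x)"
    by (rule ext) (simp add: lap_ek freq_def power2_eq_square algebra_simps)
  have "ip (\<lambda>x. ?c * ek k x + of_real (W x) * ek k x) (u t) =
      cnj (ip (u t) (\<lambda>x. ?c * ek k x) + ip (u t) (\<lambda>x. of_real (W x) * ek k x))"
    by (subst cnj_ip[symmetric])
       (simp add: ip_add_right ut sqL2_cmult sqL2_ek sqL2_real_mult W)
  also have "\<dots> = ?c * fc (u t) k + fc (\<lambda>x. of_real (W x) * u t x) k"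
  proof -
    have "ip (\<lambda>x. of_real (W x) * ek k x) (u t) = ip (ek k) (\<lambda>x. of_real (W x) * u t x)"
      unfolding ip_Q by (intro Bochner_Integration.integral_cong) auto
    then show ?thesis
      by (simp add: ip_cmult_right cnj_ip fc_ip)
  qed
  finally have ip_eq: "ip (\<lambda>x. ?c * ek k x + of_real (W x) * ek k x) (u t) = ?c * fc (u t) k + fc (\<lambda>x. of_real (W x) * u t x) k" .
  have "((\<lambda>s. ip \<phi> (u s)) has_vector_derivative (- \<i> / complex_of_real h) *
      ip (\<lambda>x. - (complex_of_real (h\<^sup>2 / 2)) * lap \<phi> x + complex_of_real (W x) * \<phi> x) (u t)) (at t)"
    if "smooth \<phi>" "periodic \<phi>" for \<phi>
    using sol that unfolding schr_sol_def by blast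
  from this[OF smooth_ek periodic_ek, of k]
  have "((\<lambda>s. ip (ek k) (u s)) has_vector_derivative
     (- \<i> / complex_of_real h) * (?c * fc (u t) k + fc (\<lambda>x. of_real (W x) * u t x) k)) (at t)"
    unfolding e ip_eq .
  moreover have "(- \<i> / complex_of_real h) * (?c * a + b) = - \<i> * freq h k * a - \<i> / h * b" for a b
    using h by (simp add: field_simps)
  ultimately show ?thesis
    by (simp only: fc_ip)
qed

lemma has_vector_derivative_scaled_time:
  fixes f :: "real \<Rightarrow> complex"
  assumes "(f has_vector_derivative f') (at (t * T))"
  shows "((\<lambda>s. f (s * T)) has_vector_derivative T *\<^sub>R f') (at t)"
proof -
  have "((\<lambda>s. s * T) has_vector_derivative T) (at t)"
    by (auto intro!: derivative_eq_intros simp: has_vector_derivative_def)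
  from vector_diff_chain_at[OF this assms] show ?thesis
    by (simp add: o_def)
qed

text \<open>The factor \<open>cis\<close> undoes the free evolution, so its derivative cancels the
  kinetic term and only the potential survives. The constant \<open>T / h\<close> combines the
  change of time scale with the \<open>1 / h\<close> of the equation.\<close>

lemma interaction_coeff:
  assumes sol: "schr_sol h W \<psi> u" and h: "h > 0" and W: "continuous_on UNIV W"
  shows "((\<lambda>s. cis (freq h k * s * T) * fc (u (s * T)) k) has_vector_derivative
     (- \<i> * of_real (T / h) * cis (freq h k * t * T) * fc (\<lambda>x. of_real (W x) * u (t * T) x) k)) (at t)"
proof -
  have 1: "((\<lambda>s. freq h k * s * T) has_real_derivative (freq h k * T)) (at t)"
    by (auto intro!: derivative_eq_intros)
  show ?thesis
    by (rule has_vector_derivative_eq_rhs[OF has_vector_derivative_mult[OF has_vector_derivative_cis[OF 1]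
          has_vector_derivative_scaled_time[OF schr_coeff[OF sol h W]]]])
       (simp add: algebra_simps scaleR_conv_of_real)
qed

text \<open>With zero potential the interaction picture is constant; \<open>T = 1\<close> gives
  unscaled time.\<close>

lemma free_coeff:
  assumes "schr_sol h (\<lambda>x. 0) \<psi> u" "h > 0"
  shows "fc (u t) k = cis (- (freq h k * t)) * fc \<psi> k"
proof -
  let ?g = "\<lambda>s. cis (freq h k * s * 1) * fc (u (s * 1)) k"
  have "fc (\<lambda>x. 0) k = 0" by (simp add: fc_def)
  then have "(?g has_vector_derivative 0) (at s)" for s
    using interaction_coeff[OF assms continuous_on_const, of k 1 s] by simp
  then obtain c where "\<And>s. ?g s = c"
    using has_vector_derivative_zero_constant[of UNIV ?g] by auto
  then have "?g t = ?g 0" by metis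
  moreover have "u 0 = \<psi>" using assms by (simp add: schr_sol_def)
  ultimately have "cis (freq h k * t) * fc (u t) k = fc \<psi> k" by simp
  then have "cis (- (freq h k * t)) * (cis (freq h k * t) * fc (u t) k) = cis (- (freq h k * t)) * fc \<psi> k" by simp
  then show ?thesis by (simp add: cis_mult flip: mult.assoc)
qed

text \<open>An exhaustion of the index set by a sequence: dominated convergence in time works along
  sequences, not along the filter of finite subsets.\<close>

definition modes :: "nat \<Rightarrow> (int \<times> int) set" where
  "modes i = from_nat ` {..<i}"

lemma finite_modes [simp]: "finite (modes i)"
  by (simp add: modes_def)

lemma filterlim_modes: "filterlim modes (finite_subsets_at_top UNIV) sequentially"
  unfolding filterlim_finite_subsets_at_top
proof (intro allI impI)
  fix X :: "(int \<times> int) set" assume "finite X \<and> X \<subseteq> UNIV"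
  then have fin: "finite (to_nat ` X)" by simp
  show "\<forall>\<^sub>F i in sequentially. finite (modes i) \<and> X \<subseteq> modes i \<and> modes i \<subseteq> UNIV"
    unfolding eventually_sequentially
  proof (intro exI allI impI)
    fix i assume i: "Suc (Max (to_nat ` X)) \<le> i"
    have "x \<in> modes i" if "x \<in> X" for x
    proof -
      have "to_nat x \<le> Max (to_nat ` X)" using fin that by simp
      then have "to_nat x < i" using i by simp
      then show ?thesis unfolding modes_def by (intro image_eqI[of _ _ "to_nat x"]) auto
    qed
    then show "finite (modes i) \<and> X \<subseteq> modes i \<and> modes i \<subseteq> UNIV" by auto
  qed
qed

lemma parseval_modes:
  assumes "sqL2 u" "sqL2 v"
  shows "(\<lambda>i. \<Sum>k\<in>modes i. cnj (fc u k) * fc v k) \<longlonglongrightarrow> ip u v"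
  using filterlim_compose[OF parseval[OF assms, unfolded has_sum_def] filterlim_modes] .

lemma Re_cnj_mult_self: "Re (cnj z * z) = (cmod z)\<^sup>2"
  unfolding cmod_power2 by (simp add: power2_eq_square)

text \<open>For a weak solution the energy identity is not available directly. The partial Parseval sums
  are differentiable, and their derivatives tend to a multiple of
  \<open>Im (ip u (W u)) = 0\<close> boundedly.\<close>

lemma norm_conservation:
  assumes sol: "schr_sol h W \<psi> u" and h: "h > 0" and W: "continuous_on UNIV W" and t: "t \<ge> 0"
  shows "sqnorm (u (t * T)) = sqnorm \<psi>"
proof -
  have su: "sqL2 (u s)" for s
    using sol L2_sqL2 by (simp add: schr_sol_def)
  let ?W = "\<lambda>s x. complex_of_real (W x) * u s x"
  have sW: "sqL2 (?W s)" for s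
    by (intro sqL2_real_mult W su)
  obtain C where "\<forall>s\<in>{-(\<bar>t * T\<bar>)..\<bar>t * T\<bar>}. L2norm (u s) \<le> C"
    using sol unfolding schr_sol_def by blast
  moreover have L2norm_nn: "L2norm v \<ge> 0" for v
    by (simp add: L2norm_def set_lebesgue_integral_def Bochner_Integration.integral_nonneg)
  ultimately have C: "sqnorm (u (s * T)) \<le> C\<^sup>2" "C \<ge> 0" if "s \<in> {0..t}" for s
  proof -
    have "\<bar>s * T\<bar> \<le> \<bar>t * T\<bar>"
      using that t by (auto simp: abs_mult intro!: mult_right_mono)
    then have "s * T \<in> {-(\<bar>t * T\<bar>)..\<bar>t * T\<bar>}" by auto
    then have "L2norm (u (s * T)) \<le> C"
      using \<open>\<forall>s\<in>_. _\<close> by blast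
    then show "sqnorm (u (s * T)) \<le> C\<^sup>2" "C \<ge> 0"
      using L2norm_nn[of "u (s * T)"] by (auto simp: L2norm_sqnorm[symmetric] intro!: power_mono)
  qed
  have C0: "C \<ge> 0" using C(2)[of 0] t by simp
  have cW: "continuous_on UNIV (\<lambda>x. complex_of_real (W x))"
    using W by (intro continuous_intros)
  obtain B' where B': "\<forall>x\<in>sq. cmod (complex_of_real (W x)) \<le> B'"
    using sqL2_continuous(2)[OF cW] by blast
  define B where "B = max B' 0"
  have B: "cmod (complex_of_real (W x)) \<le> B" if "x \<in> sq" for x
    using B' that by (auto simp: B_def)
  have nW: "sqnorm (?W (s * T)) \<le> (B * C)\<^sup>2" if "s \<in> {0..t}" for s
  proof -
    have "sqnorm (?W (s * T)) \<le> B\<^sup>2 * sqnorm (u (s * T))"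
      using B sqL2_continuous(1)[OF cW] su by (intro sqL2_mult_bounded) (auto simp: sqL2_def)
    also have "\<dots> \<le> B\<^sup>2 * C\<^sup>2" using C(1)[OF that] by (intro mult_left_mono) auto
    finally show ?thesis by (simp add: power_mult_distrib)
  qed
  define N where "N i s = (\<Sum>k\<in>modes i. (cmod (fc (u (s * T)) k))\<^sup>2)" for i s
  define R where "R i s = 2 * (T / h) * Im (\<Sum>k\<in>modes i. cnj (fc (u (s * T)) k) * fc (?W (s * T)) k)" for i s
  have dN: "(N i has_vector_derivative R i s) (at s)" for i s
  proof -
    \<comment> \<open>The free phase leaves the moduli of the coefficients unchanged but removes
      from the derivative the kinetic term, which grows with \<open>k\<close>. What is left is
      bounded through the potential, uniformly in \<open>i\<close>.\<close>
    define d where "d k s = cis (freq h k * s * T) * fc (u (s * T)) k" for k s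
    define d' where "d' k s = - \<i> * of_real (T / h) * cis (freq h k * s * T) * fc (?W (s * T)) k" for k s
    have dd: "(d k has_vector_derivative d' k s) (at s)" for k
      unfolding d_def[abs_def] d'_def by (rule interaction_coeff[OF sol h W])
    have "((\<lambda>s. Re (\<Sum>k\<in>modes i. cnj (d k s) * d k s)) has_vector_derivative
        Re (\<Sum>k\<in>modes i. cnj (d k s) * d' k s + cnj (d' k s) * d k s)) (at s)"
      by (intro bounded_linear.has_vector_derivative[OF bounded_linear_Re] has_vector_derivative_sum
          has_vector_derivative_mult bounded_linear.has_vector_derivative[OF bounded_linear_cnj] dd)
    moreover have "Re (\<Sum>k\<in>modes i. cnj (d k s) * d k s) = N i s" for s
      unfolding N_def Re_sum
      by (intro sum.cong refl) (simp only: Re_cnj_mult_self d_def norm_mult norm_cis mult_1)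
    moreover have "Re (\<Sum>k\<in>modes i. cnj (d k s) * d' k s + cnj (d' k s) * d k s) = R i s"
    proof -
      have "Re (cnj (d k s) * d' k s + cnj (d' k s) * d k s) = 2 * (T / h) * Im (cnj (fc (u (s * T)) k) * fc (?W (s * T)) k)" for k
      proof -
        have "cnj (d k s) * d' k s = (cnj (cis (freq h k * s * T)) * cis (freq h k * s * T)) *
           (- \<i> * of_real (T / h) * (cnj (fc (u (s * T)) k) * fc (?W (s * T)) k))"
          by (simp add: d_def d'_def mult_ac)
        also have "cnj (cis (freq h k * s * T)) * cis (freq h k * s * T) = 1"
          by (simp add: cis_cnj cis_mult)
        finally have "Re (cnj (d k s) * d' k s) = (T / h) * Im (cnj (fc (u (s * T)) k) * fc (?W (s * T)) k)"
          by simp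
        moreover have "Re (cnj (d' k s) * d k s) = Re (cnj (d k s) * d' k s)"
          by (simp add: mult.commute)
        ultimately show ?thesis by simp
      qed
      then show ?thesis unfolding R_def Re_sum Im_sum sum_distrib_left by simp
    qed
    ultimately show ?thesis by simp
  qed
  have R_int: "(R i has_integral (N i t - N i 0)) {0..t}" for i
    by (rule fundamental_theorem_of_calculus[OF t]) (rule has_vector_derivative_at_within[OF dN])
  have "(\<lambda>i. integral {0..t} (R i)) \<longlonglongrightarrow> integral {0..t} (\<lambda>_. 0)"
  proof (rule dominated_convergence(2))
    show "R i integrable_on {0..t}" for i using R_int by blast
    show "(\<lambda>_. 2 * \<bar>T / h\<bar> * (C * (B * C))) integrable_on {0..t}" by (rule integrable_const_ivl)
    fix i s assume s: "s \<in> {0..t}"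
    have "\<bar>Im (\<Sum>k\<in>modes i. cnj (fc (u (s * T)) k) * fc (?W (s * T)) k)\<bar> \<le> (\<Sum>k\<in>modes i. cmod (fc (u (s * T)) k) * cmod (fc (?W (s * T)) k))"
      by (rule order_trans[OF abs_Im_le_cmod]) (rule sum_norm_le, simp add: norm_mult)
    also have "\<dots> \<le> C * (B * C)"
      using bessel[OF su finite_modes, of "s * T" i] bessel[OF sW finite_modes, of "s * T" i] C(1)[OF s] nW[OF s] C0
      by (intro sum_cmod_prod_le) (auto simp: B_def)
    finally show "norm (R i s) \<le> 2 * \<bar>T / h\<bar> * (C * (B * C))"
      unfolding R_def by (simp only: real_norm_def abs_mult) (intro mult_mono; simp)
  next
    fix s assume "s \<in> {0..t}"
    \<comment> \<open>Multiplication by the real function \<open>W\<close> is symmetric, so this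
      pairing is its own conjugate.\<close>
    have "ip (u (s * T)) (?W (s * T)) = cnj (ip (u (s * T)) (?W (s * T)))"
      unfolding cnj_ip unfolding ip_Q by (intro Bochner_Integration.integral_cong) auto
    then have "Im (ip (u (s * T)) (?W (s * T))) = 0"
      by (metis cnj.simps(2) equal_neg_zero)
    then have "(\<lambda>i. R i s) \<longlonglongrightarrow> 2 * (T / h) * 0"
      unfolding R_def using tendsto_Im[OF parseval_modes[OF su sW, of "s * T" "s * T"]]
      by (intro tendsto_mult_left) simp
    then show "(\<lambda>i. R i s) \<longlonglongrightarrow> 0" by simp
  qed
  then have 0: "(\<lambda>i. N i t - N i 0) \<longlonglongrightarrow> 0"
    using integral_unique[OF R_int] by simp
  have N: "(\<lambda>i. N i s) \<longlonglongrightarrow> sqnorm (u (s * T))" for s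
  proof -
    have "(\<lambda>i. Re (\<Sum>k\<in>modes i. cnj (fc (u (s * T)) k) * fc (u (s * T)) k)) \<longlonglongrightarrow> Re (ip (u (s * T)) (u (s * T)))"
      by (intro tendsto_Re parseval_modes su)
    then show ?thesis
      by (simp only: N_def Re_sum sqnorm_ip[symmetric] Re_complex_of_real Re_cnj_mult_self)
  qed
  have "sqnorm (u (t * T)) - sqnorm (u (0 * T)) = 0"
    by (rule LIMSEQ_unique[OF tendsto_diff[OF N N] 0])
  then show ?thesis using sol by (simp add: schr_sol_def)
qed

subsection \<open>Infinite hierarchies of differential inequalities\<close>

text \<open>The derivatives integrated below are not assumed continuous; they are gauge integrable
  because they are derivatives. Boundedness upgrades this to absolute integrability, which passes to
  positive parts.\<close>

lemma pos_part_integrable: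
  fixes f :: "real \<Rightarrow> real"
  assumes "f integrable_on {a..b}" "\<And>x. x \<in> {a..b} \<Longrightarrow> \<bar>f x\<bar> \<le> B"
  shows "(\<lambda>x. max (f x) 0) integrable_on {a..b}"
proof -
  have "f absolutely_integrable_on {a..b}"
    by (rule absolutely_integrable_integrable_bound[where g = "\<lambda>_. B"]) (use assms in auto)
  then have "(\<lambda>x. \<bar>f x\<bar>) integrable_on {a..b}"
    by (simp add: absolutely_integrable_on_def)
  then have "(\<lambda>x. (1/2) * (f x + \<bar>f x\<bar>)) integrable_on {a..b}"
    by (intro integrable_on_mult_right integrable_add assms)
  moreover have "(1/2) * (f x + \<bar>f x\<bar>) = max (f x) 0" for x by auto
  ultimately show ?thesis by simp
qed

text \<open>The convergences are not uniform in the index \<open>b\<close>, so Gronwall does not apply. Instead one shows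
  by induction on \<open>j\<close> that the limsup of \<open>cmod (D i t b)\<close> is at most \<open>B * (C * t) ^ j / fact j\<close>;
  each step passes a pointwise limsup through the time integral by dominated convergence.\<close>

lemma hierarchy_vanishes:
  fixes D D' :: "nat \<Rightarrow> real \<Rightarrow> 'b \<Rightarrow> complex" and sh :: "real \<Rightarrow> 'm \<Rightarrow> 'b \<Rightarrow> 'b"
  assumes bound: "\<And>i t b. t \<in> {0..T} \<Longrightarrow> cmod (D i t b) \<le> B"
    and bound': "\<And>i t b. t \<in> {0..T} \<Longrightarrow> cmod (D' i t b) \<le> B'"
    and deriv: "\<And>i t b. t \<in> {0..T} \<Longrightarrow> ((\<lambda>t. D i t b) has_vector_derivative D' i t b) (at t within {0..T})"
    and step: "\<And>t b \<epsilon>. t \<in> {0..T} \<Longrightarrow> \<epsilon> > 0 \<Longrightarrow>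
       \<exists>F. finite F \<and> (\<forall>\<^sub>F i in sequentially. cmod (D' i t b) \<le> (\<Sum>m\<in>F. w m * cmod (D i t (sh t m b))) + \<epsilon>)"
    and w: "\<And>m. w m \<ge> 0" "\<And>F. finite F \<Longrightarrow> sum w F \<le> C"
    and init: "\<And>b. (\<lambda>i. D i 0 b) \<longlonglongrightarrow> 0"
    and t: "t \<in> {0..T}"
  shows "(\<lambda>i. D i t b) \<longlonglongrightarrow> 0"
proof -
  have C: "C \<ge> 0" using w(2)[of "{}"] by simp
  have B: "B \<ge> 0" using order_trans[OF norm_ge_zero bound[OF t]] .
  have B': "B' \<ge> 0" using order_trans[OF norm_ge_zero bound'[OF t]] .
  define bnd where "bnd j t = B * (C * t) ^ j / fact j" for j :: nat and t :: real
  have P: "\<forall>t\<in>{0..T}. \<forall>b. \<forall>\<epsilon>>0. \<forall>\<^sub>F i in sequentially. cmod (D i t b) \<le> bnd j t + \<epsilon>" for j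
  proof (induction j)
    case 0
    then show ?case
      using bound by (fastforce simp: bnd_def intro!: always_eventually intro: add_increasing2)
  next
    case (Suc j)
    show ?case
    proof (intro ballI allI impI)
      fix t b and \<epsilon> :: real assume t: "t \<in> {0..T}" and e: "\<epsilon> > 0"
      \<comment> \<open>The limsup bound for \<open>D'\<close> that level \<open>j\<close> provides.
        It is the derivative of \<open>bnd (Suc j)\<close>, so integrating it gives the bound at the
        next level.\<close>
      define \<beta> where "\<beta> s = C * bnd j s" for s
      have \<beta>: "\<beta> s \<ge> 0" if "s \<in> {0..t}" for s
        using that C B by (simp add: \<beta>_def bnd_def)
      have ev: "\<forall>\<^sub>F i in sequentially. cmod (D' i s b) \<le> \<beta> s + \<delta>" if s: "s \<in> {0..t}" and d: "\<delta> > 0" for s \<delta>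
      proof -
        have sT: "s \<in> {0..T}" using s t by auto
        obtain F where F: "finite F"
          "\<forall>\<^sub>F i in sequentially. cmod (D' i s b) \<le> (\<Sum>m\<in>F. w m * cmod (D i s (sh s m b))) + \<delta> / 2"
          using step[OF sT, of "\<delta> / 2" b] d by auto
        let ?d = "\<delta> / (2 * (C + 1))"
        have dp: "?d > 0" using d C by simp
        have "\<forall>\<^sub>F i in sequentially. \<forall>m\<in>F. cmod (D i s (sh s m b)) \<le> bnd j s + ?d"
          using Suc sT dp by (intro eventually_ball_finite F) auto
        with F(2) show ?thesis
        proof eventually_elim
          case (elim i)
          have "(\<Sum>m\<in>F. w m * cmod (D i s (sh s m b))) \<le> (\<Sum>m\<in>F. w m * (bnd j s + ?d))"
            using elim w by (intro sum_mono mult_left_mono) auto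
          also have "\<dots> = sum w F * (bnd j s + ?d)" by (simp add: sum_distrib_right)
          also have "\<dots> \<le> C * (bnd j s + ?d)"
            using w(2)[OF F(1)] C B s dp by (intro mult_right_mono add_nonneg_nonneg) (auto simp: bnd_def)
          also have "\<dots> \<le> \<beta> s + \<delta> / 2"
            using C d by (simp add: \<beta>_def distrib_left field_simps)
          finally show ?case using elim(1) by linarith
        qed
      qed
      \<comment> \<open>Only a limsup bound on \<open>D'\<close> is known, so dominated convergence
        is applied to the excess of its modulus over \<open>\<beta>\<close>, which tends to 0 for
        each \<open>s\<close>.\<close>
      define g where "g i s = max (cmod (D' i s b) - \<beta> s) 0" for i s
      have \<beta>_int: "(\<beta> has_integral (bnd (Suc j) t - bnd (Suc j) 0)) {0..t}"
      proof (rule fundamental_theorem_of_calculus)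
        fix s assume "s \<in> {0..t}"
        have "(bnd (Suc j) has_real_derivative B * (real (Suc j) * (C * s) ^ j * C) / fact (Suc j)) (at s within {0..t})"
          unfolding bnd_def by (rule derivative_eq_intros refl | simp)+
        moreover have "B * (real (Suc j) * (C * s) ^ j * C) / fact (Suc j) = \<beta> s"
        proof -
          have "fact (Suc j) = real (Suc j) * fact j" by simp
          then show ?thesis
            by (simp add: \<beta>_def bnd_def del: of_nat_Suc fact_Suc)
        qed
        ultimately show "(bnd (Suc j) has_vector_derivative \<beta> s) (at s within {0..t})"
          by (simp add: has_real_derivative_iff_has_vector_derivative)
      qed (use t in simp)
      have D'_int: "((\<lambda>s. D' i s b) has_integral (D i t b - D i 0 b)) {0..t}" for i
        by (rule fundamental_theorem_of_calculus)
           (use t in \<open>auto intro!: has_vector_derivative_within_subset[OF deriv]\<close>)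
      have bd: "cmod (D' i s b) \<le> B'" if "s \<in> {0..t}" for i s
        using that t by (intro bound') auto
      have nD'_int: "(\<lambda>s. cmod (D' i s b)) integrable_on {0..t}" for i
      proof -
        have "(\<lambda>s. D' i s b) absolutely_integrable_on {0..t}"
          by (rule absolutely_integrable_integrable_bound[where g = "\<lambda>_. B'"]) (use D'_int bd in auto)
        then show ?thesis by (simp add: absolutely_integrable_on_def)
      qed
      have \<beta>_bd: "\<beta> s \<le> C * bnd j t" if "s \<in> {0..t}" for s
        unfolding \<beta>_def bnd_def
        using that C B by (intro mult_left_mono divide_right_mono power_mono) auto
      have g_int: "g i integrable_on {0..t}" for i
        unfolding g_def[abs_def]
      proof (rule pos_part_integrable[where B = "B' + C * bnd j t"])
        show "(\<lambda>s. cmod (D' i s b) - \<beta> s) integrable_on {0..t}"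
          using \<beta>_int by (intro integrable_diff nD'_int) blast
        show "\<bar>cmod (D' i s b) - \<beta> s\<bar> \<le> B' + C * bnd j t" if "s \<in> {0..t}" for s
          using bd[OF that, of i] \<beta>[OF that] \<beta>_bd[OF that] norm_ge_zero[of "D' i s b"] by linarith
      qed
      have "(\<lambda>i. integral {0..t} (g i)) \<longlonglongrightarrow> integral {0..t} (\<lambda>_. 0)"
      proof (rule dominated_convergence(2)[OF g_int])
        show "(\<lambda>_. B') integrable_on {0..t}" by (rule integrable_const_ivl)
        show "norm (g i s) \<le> B'" if "s \<in> {0..t}" for i s
          using bd[OF that, of i] \<beta>[OF that] B' by (simp add: g_def)
        show "(\<lambda>i. g i s) \<longlonglongrightarrow> 0" if s: "s \<in> {0..t}" for s
        proof (rule LIMSEQ_I)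
          fix r :: real assume r: "r > 0"
          have "\<forall>\<^sub>F i in sequentially. norm (g i s - 0) < r"
            using ev[OF s, of "r / 2"] r by (auto elim!: eventually_mono simp: g_def)
          then show "\<exists>no. \<forall>n\<ge>no. norm (g n s - 0) < r"
            by (simp add: eventually_sequentially)
        qed
      qed
      then have g0: "\<forall>\<^sub>F i in sequentially. integral {0..t} (g i) < \<epsilon> / 2"
        using e by (intro order_tendstoD(2)) auto
      have "(\<lambda>i. cmod (D i 0 b)) \<longlonglongrightarrow> 0"
        by (rule tendsto_norm_zero[OF init])
      then have "\<forall>\<^sub>F i in sequentially. cmod (D i 0 b) < \<epsilon> / 2"
        using e by (intro order_tendstoD(2)) auto
      with g0 show "\<forall>\<^sub>F i in sequentially. cmod (D i t b) \<le> bnd (Suc j) t + \<epsilon>"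
      proof eventually_elim
        case (elim i)
        have "cmod (D i t b - D i 0 b) = cmod (integral {0..t} (\<lambda>s. D' i s b))"
          using integral_unique[OF D'_int] by simp
        also have "\<dots> \<le> integral {0..t} (\<lambda>s. g i s + \<beta> s)"
        proof (rule integral_norm_bound_integral)
          show "(\<lambda>s. D' i s b) integrable_on {0..t}" using D'_int by blast
          show "(\<lambda>s. g i s + \<beta> s) integrable_on {0..t}"
            using \<beta>_int by (intro integrable_add g_int) blast
        qed (simp add: g_def)
        also have "\<dots> = integral {0..t} (g i) + integral {0..t} \<beta>"
          using \<beta>_int g_int by (intro Henstock_Kurzweil_Integration.integral_add) auto
        also have "integral {0..t} \<beta> = bnd (Suc j) t"
          using integral_unique[OF \<beta>_int] by (simp add: bnd_def)
        finally show ?case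
          using elim norm_triangle_ineq[of "D i t b - D i 0 b" "D i 0 b"] by simp
      qed
    qed
  qed
  show ?thesis
  proof (rule LIMSEQ_I)
    fix r :: real assume r: "r > 0"
    \<comment> \<open>Terms of a convergent exponential series tend to 0, so some level
      \<open>j\<close> brings the bound below \<open>r / 2\<close>.\<close>
    have "(\<lambda>j. B * (inverse (fact j) * (C * t) ^ j)) \<longlonglongrightarrow> B * 0"
      by (intro tendsto_mult_left summable_LIMSEQ_zero summable_exp)
    moreover have "(\<lambda>j. B * (inverse (fact j) * (C * t) ^ j)) = (\<lambda>j. bnd j t)"
      by (simp add: bnd_def field_simps)
    ultimately have "(\<lambda>j. bnd j t) \<longlonglongrightarrow> 0"
      by simp
    then have "\<forall>\<^sub>F j in sequentially. bnd j t < r / 2"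
      using r by (intro order_tendstoD(2)) auto
    then obtain j where j: "bnd j t < r / 2" by (auto simp: eventually_sequentially)
    have "\<forall>\<^sub>F i in sequentially. cmod (D i t b) \<le> bnd j t + r / 2"
      using P[of j] t half_gt_zero[OF r] by blast
    then have "\<forall>\<^sub>F i in sequentially. norm (D i t b - 0) < r"
      by eventually_elim (use j in simp)
    then show "\<exists>no. \<forall>n\<ge>no. norm (D n t b - 0) < r"
      by (simp add: eventually_sequentially)
  qed
qed

subsection \<open>Phase-space observables\<close>

definition vec :: "int \<times> int \<Rightarrow> pt" where
  "vec k = (of_int (fst k), of_int (snd k))"

definition xi :: "real \<Rightarrow> int \<times> int \<Rightarrow> pt" where
  "xi h k = (2 * pi * h) *\<^sub>R vec k"

lemma vec_add: "vec (j + k) = vec j + vec k"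
  by (simp add: vec_def)

lemma ek_vec: "ek k x = cis (2 * pi * (vec k \<bullet> x))"
  by (simp add: ek_def vec_def inner_prod_def)

lemma freq_vec: "freq h k = 2 * pi\<^sup>2 * h * (vec k \<bullet> vec k)"
  by (simp add: freq_def vec_def inner_prod_def power2_eq_square)

lemma eigv_xi: "eigv h k = (norm (xi h k))\<^sup>2"
  unfolding power2_norm_eq_inner xi_def vec_def eigv_def
  by (simp add: inner_prod_def power2_eq_square algebra_simps)

text \<open>A cutoff without plateau; \<open>exp 1\<close> normalises it to \<open>chi \<rho> 0 = 1\<close>. It tends to 1 locally
  uniformly as \<open>\<rho>\<close> tends to infinity, which is all that is needed.\<close>

definition chi :: "real \<Rightarrow> pt \<Rightarrow> real" where
  "chi \<rho> \<xi> = exp 1 * flat 0 (1 - (norm \<xi>)\<^sup>2 / \<rho>\<^sup>2)"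

lemma chi_bounds: "0 \<le> chi \<rho> \<xi>" "chi \<rho> \<xi> \<le> 1"
proof -
  show "0 \<le> chi \<rho> \<xi>" by (simp add: chi_def flat_def)
  define y where "y = 1 - (norm \<xi>)\<^sup>2 / \<rho>\<^sup>2"
  have "y \<le> 1" by (simp add: y_def)
  then have "flat 0 y \<le> exp (- 1)"
    by (auto simp: flat_def one_le_inverse)
  then have "exp 1 * flat 0 y \<le> exp 1 * exp (- 1)"
    by (intro mult_left_mono) auto
  then show "chi \<rho> \<xi> \<le> 1"
    by (simp add: chi_def y_def exp_minus)
qed

lemma chi_nonzero: "\<rho> > 0 \<Longrightarrow> chi \<rho> \<xi> \<noteq> 0 \<Longrightarrow> norm \<xi> < \<rho>"
proof -
  assume "\<rho> > 0" "chi \<rho> \<xi> \<noteq> 0"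
  then have "(norm \<xi>)\<^sup>2 / \<rho>\<^sup>2 < 1" by (auto simp: chi_def flat_def split: if_splits)
  then have "(norm \<xi>)\<^sup>2 < \<rho>\<^sup>2" using \<open>\<rho> > 0\<close> by simp
  then show "norm \<xi> < \<rho>" using \<open>\<rho> > 0\<close> by (intro power2_less_imp_less[of "norm \<xi>"]) auto
qed

lemma chi_lower: "\<rho> > 0 \<Longrightarrow> norm \<xi> \<le> r \<Longrightarrow> 1 - (r / \<rho>)\<^sup>2 > 0 \<Longrightarrow> chi \<rho> \<xi> \<ge> exp (1 - inverse (1 - (r / \<rho>)\<^sup>2))"
proof -
  assume r: "\<rho> > 0" "norm \<xi> \<le> r" "1 - (r / \<rho>)\<^sup>2 > 0"
  have "(norm \<xi>)\<^sup>2 / \<rho>\<^sup>2 \<le> (r / \<rho>)\<^sup>2"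
    using r by (simp add: power_divide divide_right_mono power_mono)
  then have y: "1 - (r / \<rho>)\<^sup>2 \<le> 1 - (norm \<xi>)\<^sup>2 / \<rho>\<^sup>2" by simp
  then have "inverse (1 - (norm \<xi>)\<^sup>2 / \<rho>\<^sup>2) \<le> inverse (1 - (r / \<rho>)\<^sup>2)"
    using r(3) by (rule le_imp_inverse_le)
  then have "exp (1 - inverse (1 - (r / \<rho>)\<^sup>2)) \<le> exp (1 - inverse (1 - (norm \<xi>)\<^sup>2 / \<rho>\<^sup>2))"
    by simp
  also have "\<dots> = chi \<rho> \<xi>"
    using y r(3) by (simp add: chi_def flat_def exp_diff exp_minus divide_inverse)
  finally show ?thesis .
qed

text \<open>Uniformity over a ball is what removes the cutoff for all momenta of bounded energy at
  once. \<open>Suc n\<close> keeps the radius positive.\<close>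

lemma chi_eventually_ge:
  assumes "\<epsilon> > 0"
  shows "\<forall>\<^sub>F n in sequentially. \<forall>\<xi>. norm \<xi> \<le> r \<longrightarrow> 1 - \<epsilon> \<le> chi (real (Suc n)) \<xi>"
proof -
  have q: "(\<lambda>n. 1 - (r / real (Suc n))\<^sup>2) \<longlonglongrightarrow> 1 - 0\<^sup>2"
    by (intro tendsto_intros LIMSEQ_Suc[OF lim_const_over_n])
  then have "(\<lambda>n. exp (1 - inverse (1 - (r / real (Suc n))\<^sup>2))) \<longlonglongrightarrow> exp (1 - inverse (1 - 0\<^sup>2))"
    by (intro tendsto_exp tendsto_diff tendsto_const tendsto_inverse q) simp
  then have "\<forall>\<^sub>F n in sequentially. exp (1 - inverse (1 - (r / real (Suc n))\<^sup>2)) > 1 - \<epsilon>"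
    using assms by (intro order_tendstoD(1)) auto
  moreover have "\<forall>\<^sub>F n in sequentially. 1 - (r / real (Suc n))\<^sup>2 > 0"
    using q by (intro order_tendstoD(1)) auto
  ultimately show ?thesis
  proof eventually_elim
    case (elim n)
    then show ?case using chi_lower[of "real (Suc n)" _ r] by fastforce
  qed
qed

lemma chi_tendsto_1: "(\<lambda>n. chi (real (Suc n)) \<xi>) \<longlonglongrightarrow> 1"
proof (rule LIMSEQ_I)
  fix e :: real assume "e > 0"
  then have "\<forall>\<^sub>F n in sequentially. \<forall>\<zeta>. norm \<zeta> \<le> norm \<xi> \<longrightarrow> 1 - e / 2 \<le> chi (real (Suc n)) \<zeta>"
    by (intro chi_eventually_ge) simp
  then have "\<forall>\<^sub>F n in sequentially. norm (chi (real (Suc n)) \<xi> - 1) < e"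
  proof eventually_elim
    case (elim n)
    then have "1 - e / 2 \<le> chi (real (Suc n)) \<xi>" by blast
    then show ?case
      using chi_bounds[of "real (Suc n)" \<xi>] \<open>e > 0\<close> unfolding real_norm_def by linarith
  qed
  then show "\<exists>no. \<forall>n\<ge>no. norm (chi (real (Suc n)) \<xi> - 1) < e"
    by (simp add: eventually_sequentially)
qed

lemma continuous_chi: "continuous_on UNIV (chi \<rho>)"
proof -
  have f: "continuous_on UNIV (flat 0)"
    using flat_deriv[of 0] DERIV_isCont by (auto simp: continuous_on_eq_continuous_at)
  have "continuous_on UNIV (\<lambda>\<xi>::pt. 1 - (norm \<xi>)\<^sup>2 * inverse (\<rho>\<^sup>2))"
    by (intro continuous_intros)
  from continuous_on_compose2[OF f this] show ?thesis
    unfolding chi_def[abs_def] divide_inverse by (intro continuous_on_mult_left) simp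
qed

definition obs :: "real \<Rightarrow> int \<times> int \<Rightarrow> pt \<Rightarrow> pt \<times> pt \<Rightarrow> complex" where
  "obs \<rho> n \<eta> z = ek n (fst z) * cis (\<eta> \<bullet> snd z) * of_real (chi \<rho> (snd z))"

lemma symbol_obs:
  assumes "\<rho> > 0"
  shows "symbol (obs \<rho> n \<eta>)"
  unfolding symbol_def
proof (intro conjI allI exI impI)
  have lin: "bounded_linear (\<lambda>z::pt \<times> pt. 2 * pi * (vec n \<bullet> fst z))" "bounded_linear (\<lambda>z::pt \<times> pt. \<eta> \<bullet> snd z)"
    by (intro bounded_linear_intros bounded_linear_compose[OF bounded_linear_mult_right]
        bounded_linear_compose[OF bounded_linear_inner_right] bounded_linear_fst bounded_linear_snd)+
  \<comment> \<open>The squared norm is written as an inner product: its derivative in a fixed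
    direction is linear in \<open>z\<close>, hence a generator of \<open>smooth_alg\<close>.\<close>
  have fl: "(\<lambda>z::pt \<times> pt. complex_of_real (flat 0 (1 - (snd z \<bullet> snd z) / \<rho>\<^sup>2))) \<in> smooth_alg"
  proof (rule smooth_alg.flat[where q' = "\<lambda>z v. - (2 * (snd z \<bullet> snd v)) / \<rho>\<^sup>2"])
    show "((\<lambda>z::pt \<times> pt. 1 - (snd z \<bullet> snd z) / \<rho>\<^sup>2) has_derivative (\<lambda>v. - (2 * (snd z \<bullet> snd v)) / \<rho>\<^sup>2)) (at z)" for z
      using assms by (auto intro!: derivative_eq_intros simp: inner_commute field_simps)
    fix v :: "pt \<times> pt"
    have "bounded_linear (\<lambda>z::pt \<times> pt. (- 2 / \<rho>\<^sup>2) * (snd v \<bullet> snd z))"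
      by (intro bounded_linear_compose[OF bounded_linear_mult_right]
        bounded_linear_compose[OF bounded_linear_inner_right] bounded_linear_snd)
    moreover have "(- 2 / \<rho>\<^sup>2) * (snd v \<bullet> snd z) = - (2 * (snd z \<bullet> snd v)) / \<rho>\<^sup>2" for z :: "pt \<times> pt"
      by (simp add: inner_commute)
    ultimately have "bounded_linear (\<lambda>z::pt \<times> pt. - (2 * (snd z \<bullet> snd v)) / \<rho>\<^sup>2)"
      by (simp only:)
    then show "(\<lambda>z::pt \<times> pt. complex_of_real (- (2 * (snd z \<bullet> snd v)) / \<rho>\<^sup>2)) \<in> smooth_alg"
      by (rule smooth_alg.lin)
  qed
  show "smooth (obs \<rho> n \<eta>)"
    unfolding obs_def[abs_def] ek_vec chi_def of_real_mult power2_norm_eq_inner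
    by (intro smooth_smooth_alg smooth_alg.mult smooth_alg.cis smooth_alg.const lin fl)
  show "periodic (\<lambda>x. obs \<rho> n \<eta> (x, \<xi>))" for \<xi>
    using periodic_ek[of n] unfolding periodic_def obs_def by simp
  show "obs \<rho> n \<eta> (x, \<xi>) = 0" if "norm \<xi> > \<rho>" for x \<xi>
    using chi_nonzero[OF assms, of \<xi>] that by (auto simp: obs_def)
qed

section \<open>Correlations along the perturbed evolution\<close>

definition supp :: "real \<Rightarrow> real \<Rightarrow> (int \<times> int) set" where
  "supp \<rho> h = {k. chi \<rho> (xi h k) \<noteq> 0}"

text \<open>Finiteness at fixed \<open>h\<close> makes \<open>corr\<close> a finite sum that can be
  differentiated term by term. The number of modes grows as \<open>h\<close> tends to 0, so later
  estimates never count them.\<close>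

lemma finite_supp:
  assumes "\<rho> > 0" "h > 0"
  shows "finite (supp \<rho> h)"
proof (rule finite_subset)
  define N where "N = \<lceil>\<rho> / (2 * pi * h)\<rceil>"
  show "supp \<rho> h \<subseteq> {-N..N} \<times> {-N..N}"
  proof
    fix k assume "k \<in> supp \<rho> h"
    then have "norm (xi h k) < \<rho>" using chi_nonzero assms by (simp add: supp_def)
    moreover have "norm (xi h k) = 2 * pi * h * norm (vec k)" using assms by (simp add: xi_def)
    ultimately have "2 * pi * h * norm (vec k) < \<rho>" by simp
    then have "norm (vec k) < \<rho> / (2 * pi * h)"
      using assms by (simp add: field_simps)
    moreover have "\<bar>of_int (fst k)\<bar> \<le> norm (vec k)" "\<bar>of_int (snd k)\<bar> \<le> norm (vec k)"
      using norm_fst_le[of "of_int (fst k) :: real" "of_int (snd k) :: real"]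
        norm_snd_le[of "of_int (snd k) :: real" "of_int (fst k) :: real"] by (auto simp: vec_def)
    moreover have "\<rho> / (2 * pi * h) \<le> of_int N" unfolding N_def by (rule le_of_int_ceiling)
    ultimately have "\<bar>of_int (fst k)\<bar> \<le> (of_int N :: real)" "\<bar>of_int (snd k)\<bar> \<le> (of_int N :: real)"
      by linarith+
    then have "\<bar>fst k\<bar> \<le> N" "\<bar>snd k\<bar> \<le> N" by linarith+
    then show "k \<in> {-N..N} \<times> {-N..N}" by (cases k) auto
  qed
qed simp

text \<open>For \<open>d = fc v\<close> this is the pairing of \<open>v\<close> with \<open>Op h (obs \<rho> n \<eta>) \<psi>\<close>.\<close>

definition corr :: "real \<Rightarrow> real \<Rightarrow> (pt \<Rightarrow> complex) \<Rightarrow> (int \<times> int \<Rightarrow> complex) \<Rightarrow> int \<times> int \<Rightarrow> pt \<Rightarrow> complex" where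
  "corr \<rho> h \<psi> d n \<eta> = (\<Sum>k\<in>supp \<rho> h. cnj (d (k + n)) * cis (\<eta> \<bullet> xi h k) * (of_real (chi \<rho> (xi h k)) * fc \<psi> k))"

lemma ip_Op_obs:
  assumes "\<rho> > 0" "h > 0" "sqL2 \<psi>"
  shows "ip \<psi> (Op h (obs \<rho> n \<eta>) \<psi>) = corr \<rho> h \<psi> (fc \<psi>) n \<eta>"
proof -
  let ?c = "\<lambda>k. cis (\<eta> \<bullet> xi h k) * (of_real (chi \<rho> (xi h k)) * fc \<psi> k)"
  have "Op h (obs \<rho> n \<eta>) \<psi> = (\<lambda>x. \<Sum>k\<in>supp \<rho> h. ?c k * ek (k + n) x)"
  proof
    fix x
    have xi': "(2 * pi * h * of_int (fst k), 2 * pi * h * of_int (snd k)) = xi h k" for k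
      by (simp add: xi_def vec_def)
    have "Op h (obs \<rho> n \<eta>) \<psi> x = (\<Sum>\<^sub>\<infinity>k. obs \<rho> n \<eta> (x, xi h k) * fc \<psi> k * ek k x)"
      unfolding Op_def xi' ek_def ..
    also have "\<dots> = (\<Sum>\<^sub>\<infinity>k\<in>supp \<rho> h. ?c k * ek (k + n) x)"
      by (rule infsum_cong_neutral) (auto simp: obs_def supp_def ek_add)
    also have "\<dots> = (\<Sum>k\<in>supp \<rho> h. ?c k * ek (k + n) x)"
      by (rule infsum_finite) (rule finite_supp[OF assms(1,2)])
    finally show "Op h (obs \<rho> n \<eta>) \<psi> x = (\<Sum>k\<in>supp \<rho> h. ?c k * ek (k + n) x)" .
  qed
  then have "ip \<psi> (Op h (obs \<rho> n \<eta>) \<psi>) = (\<Sum>k\<in>supp \<rho> h. ip \<psi> (\<lambda>x. ?c k * ek (k + n) x))"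
    by (simp only:) (intro ip_sum_right assms sqL2_cmult sqL2_ek)
  also have "\<dots> = corr \<rho> h \<psi> (fc \<psi>) n \<eta>"
    unfolding corr_def
    by (intro sum.cong refl) (simp only: ip_cmult_right fc_ip cnj_ip, simp only: mult_ac)
  finally show ?thesis .
qed

lemma sum_shifted_le:
  fixes d :: "int \<times> int \<Rightarrow> complex"
  assumes "\<And>K. finite K \<Longrightarrow> (\<Sum>k\<in>K. (cmod (d k))\<^sup>2) \<le> A" "finite K"
  shows "(\<Sum>k\<in>K. (cmod (d (k + n)))\<^sup>2) \<le> A"
proof -
  have "(\<Sum>k\<in>K. (cmod (d (k + n)))\<^sup>2) = (\<Sum>k\<in>(\<lambda>k. k + n) ` K. (cmod (d k))\<^sup>2)"
    by (subst sum.reindex) (auto simp: inj_on_def)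
  then show ?thesis using assms by simp
qed

text \<open>Cauchy-Schwarz with the shifted coefficients on one side and weight, cutoff and
  \<open>\<psi>\<close> on the other, so the size of \<open>supp \<rho> h\<close> does not enter. A
  general weight \<open>g\<close> covers both a single modulation and a difference of two.\<close>

lemma weighted_corr_bound:
  assumes \<rho>: "\<rho> > 0" and h: "h > 0" and \<psi>: "sqL2 \<psi>" "sqnorm \<psi> \<le> 1"
    and d: "\<And>K. finite K \<Longrightarrow> (\<Sum>k\<in>K. (cmod (d k))\<^sup>2) \<le> A\<^sup>2" "A \<ge> 0"
    and g: "\<And>k. k \<in> supp \<rho> h \<Longrightarrow> cmod (g k) \<le> B" "B \<ge> 0"
  shows "cmod (\<Sum>k\<in>supp \<rho> h. cnj (d (k + n)) * g k * (of_real (chi \<rho> (xi h k)) * fc \<psi> k)) \<le> A * B"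
proof -
  let ?p = "\<lambda>k. g k * (of_real (chi \<rho> (xi h k)) * fc \<psi> k)"
  have f: "finite (supp \<rho> h)" by (rule finite_supp[OF \<rho> h])
  have "(cmod (?p k))\<^sup>2 \<le> B\<^sup>2 * (cmod (fc \<psi> k))\<^sup>2" if "k \<in> supp \<rho> h" for k
  proof -
    have "cmod (?p k) \<le> B * (1 * cmod (fc \<psi> k))"
      unfolding norm_mult using chi_bounds[of \<rho> "xi h k"] g that by (intro mult_mono) auto
    then have "(cmod (?p k))\<^sup>2 \<le> (B * (1 * cmod (fc \<psi> k)))\<^sup>2"
      by (intro power_mono) auto
    then show ?thesis by (simp add: power_mult_distrib)
  qed
  then have "(\<Sum>k\<in>supp \<rho> h. (cmod (?p k))\<^sup>2) \<le> B\<^sup>2 * (\<Sum>k\<in>supp \<rho> h. (cmod (fc \<psi> k))\<^sup>2)"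
    unfolding sum_distrib_left by (rule sum_mono)
  also have "\<dots> \<le> B\<^sup>2 * 1"
    using bessel[OF \<psi>(1) f] \<psi>(2) by (intro mult_left_mono) auto
  finally have p: "(\<Sum>k\<in>supp \<rho> h. (cmod (?p k))\<^sup>2) \<le> B\<^sup>2" by simp
  have "cmod (\<Sum>k\<in>supp \<rho> h. cnj (d (k + n)) * g k * (of_real (chi \<rho> (xi h k)) * fc \<psi> k)) \<le>
     (\<Sum>k\<in>supp \<rho> h. cmod (d (k + n)) * cmod (?p k))"
    by (rule sum_norm_le) (simp add: norm_mult mult_ac)
  also have "\<dots> \<le> A * B"
    by (rule sum_cmod_prod_le[OF sum_shifted_le[OF d(1) f] p d(2) g(2)])
  finally show ?thesis .
qed

lemma corr_bound:
  assumes "\<rho> > 0" "h > 0" "sqL2 \<psi>" "sqnorm \<psi> \<le> 1"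
    and "\<And>K. finite K \<Longrightarrow> (\<Sum>k\<in>K. (cmod (d k))\<^sup>2) \<le> A\<^sup>2" "A \<ge> 0"
  shows "cmod (corr \<rho> h \<psi> d n \<eta>) \<le> A"
  unfolding corr_def using weighted_corr_bound[OF assms, of "\<lambda>k. cis (\<eta> \<bullet> xi h k)" 1 n] by simp

lemma cmod_cis_diff_le: "cmod (cis a - cis b) \<le> \<bar>a - b\<bar>"
proof -
  have "cis a - cis b = cis b * (exp (\<i> * of_real (a - b)) - 1)"
    by (simp only: cis_conv_exp[symmetric] right_diff_distrib cis_mult) simp
  then have "cmod (cis a - cis b) = 2 * \<bar>sin ((a - b) / 2)\<bar>"
    by (simp only: norm_mult norm_cis dist_exp_i_1)
  also have "\<dots> \<le> 2 * \<bar>(a - b) / 2\<bar>"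
    by (intro mult_left_mono abs_sin_x_le_abs_x) auto
  finally show ?thesis by simp
qed

text \<open>The cutoff keeps momenta below \<open>\<rho>\<close>, so modulations are Lipschitz in
  \<open>\<eta>\<close> uniformly in \<open>h\<close>. This permits replacing the time scale by its
  limit inside the modulation parameter.\<close>

lemma corr_diff:
  assumes "\<rho> > 0" "h > 0" "sqL2 \<psi>" "sqnorm \<psi> \<le> 1"
    and "\<And>K. finite K \<Longrightarrow> (\<Sum>k\<in>K. (cmod (d k))\<^sup>2) \<le> 1"
  shows "cmod (corr \<rho> h \<psi> d n \<eta> - corr \<rho> h \<psi> d n \<eta>') \<le> norm (\<eta> - \<eta>') * \<rho>"
proof -
  have eq: "corr \<rho> h \<psi> d n \<eta> - corr \<rho> h \<psi> d n \<eta>' =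
    (\<Sum>k\<in>supp \<rho> h. cnj (d (k + n)) * (cis (\<eta> \<bullet> xi h k) - cis (\<eta>' \<bullet> xi h k)) * (of_real (chi \<rho> (xi h k)) * fc \<psi> k))"
    by (simp add: corr_def algebra_simps flip: sum_subtractf)
  have "cmod (corr \<rho> h \<psi> d n \<eta> - corr \<rho> h \<psi> d n \<eta>') \<le> 1 * (norm (\<eta> - \<eta>') * \<rho>)"
    unfolding eq
  proof (rule weighted_corr_bound[OF assms(1-4)])
    fix k assume k: "k \<in> supp \<rho> h"
    have "cmod (cis (\<eta> \<bullet> xi h k) - cis (\<eta>' \<bullet> xi h k)) \<le> \<bar>(\<eta> - \<eta>') \<bullet> xi h k\<bar>"
      using cmod_cis_diff_le by (simp add: inner_diff_left)
    also have "\<dots> \<le> norm (\<eta> - \<eta>') * norm (xi h k)"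
      by (rule Cauchy_Schwarz_ineq2)
    also have "\<dots> \<le> norm (\<eta> - \<eta>') * \<rho>"
      using chi_nonzero[OF assms(1), of "xi h k"] k by (intro mult_left_mono) (auto simp: supp_def)
    finally show "cmod (cis (\<eta> \<bullet> xi h k) - cis (\<eta>' \<bullet> xi h k)) \<le> norm (\<eta> - \<eta>') * \<rho>" .
  qed (use assms in auto)
  then show ?thesis by simp
qed

text \<open>\<open>V\<close> is replaced by a finite part of its Fourier series, and
  \<open>g\<close> collects the uniformly small remainder. As \<open>V\<close> is real, the
  conjugated series may be used: it shifts frequencies by \<open>+ m\<close>, and its coefficients
  become \<open>rfc V m\<close> once \<open>corr\<close> conjugates them.\<close>

lemma fc_potential:
  fixes V :: "pt \<Rightarrow> real"
  assumes V: "smooth V" "periodic V" and w: "sqL2 w" and F: "finite F"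
  obtains g where "sqL2 g" "sqnorm g \<le> (tail (rfc V) F)\<^sup>2 * sqnorm w"
    "\<And>j. fc (\<lambda>x. of_real (V x) * w x) j = (\<Sum>m\<in>F. cnj (rfc V m) * fc w (j + m)) + fc g j"
proof -
  define r where "r x = complex_of_real (V x) - (\<Sum>m\<in>F. cnj (rfc V m) * cnj (ek m x))" for x
  define g where "g x = r x * w x" for x
  have r_bound: "cmod (r x) \<le> tail (rfc V) F" for x
  proof -
    have "r x = cnj (complex_of_real (V x) - (\<Sum>m\<in>F. rfc V m * ek m x))"
      by (simp add: r_def)
    then show ?thesis
      using fourier_series[OF V F, of x] by (simp only: complex_mod_cnj)
  qed
  have "continuous_on UNIV r"
    unfolding r_def[abs_def] by (intro continuous_intros smooth_continuous V)
  then have "r \<in> borel_measurable Q"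
    using sqL2_continuous(1) by (auto simp: sqL2_def)
  then have g: "sqL2 g" "sqnorm g \<le> (tail (rfc V) F)\<^sup>2 * sqnorm w"
    unfolding g_def[abs_def] using r_bound w by (auto intro!: sqL2_mult_bounded)
  have ekw: "sqL2 (\<lambda>x. cnj (ek m x) * w x)" for m
    using w sqL2_ek[of "- m"] by (intro sqL2_mult_bounded(1)[where B = 1]) (auto simp: sqL2_def cnj_ek)
  have sh: "ip (ek j) (\<lambda>x. cnj (ek m x) * w x) = fc w (j + m)" for j m
    unfolding fc_ip ip_Q by (intro Bochner_Integration.integral_cong refl) (simp add: ek_add)
  have "fc (\<lambda>x. of_real (V x) * w x) j = (\<Sum>m\<in>F. cnj (rfc V m) * fc w (j + m)) + fc g j" for j
  proof -
    have "(\<lambda>x. of_real (V x) * w x) = (\<lambda>x. (\<Sum>m\<in>F. cnj (rfc V m) * (cnj (ek m x) * w x)) + g x)"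
      by (simp add: fun_eq_iff g_def r_def left_diff_distrib sum_distrib_right mult.assoc)
    then have "fc (\<lambda>x. of_real (V x) * w x) j = ip (ek j) (\<lambda>x. \<Sum>m\<in>F. cnj (rfc V m) * (cnj (ek m x) * w x)) + fc g j"
      by (simp only: fc_ip) (intro ip_add_right sqL2_ek sqL2_sum sqL2_cmult ekw g)
    also have "ip (ek j) (\<lambda>x. \<Sum>m\<in>F. cnj (rfc V m) * (cnj (ek m x) * w x)) = (\<Sum>m\<in>F. ip (ek j) (\<lambda>x. cnj (rfc V m) * (cnj (ek m x) * w x)))"
      by (intro ip_sum_right sqL2_ek sqL2_cmult ekw)
    finally show ?thesis
      by (simp only: ip_cmult_right sh)
  qed
  then show ?thesis using that g by blast
qed

text \<open>What remains of \<open>|k + n + m|^2 - |k + n|^2\<close> when the part linear in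
  \<open>k\<close> is removed. It is used with \<open>s = h * (t * T)\<close>, so for fixed
  \<open>n\<close> and \<open>m\<close> and bounded \<open>T\<close> it tends to 1 with
  \<open>h\<close>.\<close>

definition phase :: "real \<Rightarrow> int \<times> int \<Rightarrow> int \<times> int \<Rightarrow> complex" where
  "phase s n m = cis (2 * pi\<^sup>2 * s * (2 * (vec n \<bullet> vec m) + vec m \<bullet> vec m))"

text \<open>Conjugation turns the factor \<open>- \<i> * \<sigma>\<close> of the equation into
  \<open>\<i> * \<sigma>\<close>, and each mode of \<open>V\<close> shifts the index. One exact
  derivative \<open>D'\<close> serves all truncations \<open>F\<close>; only the error depends on
  \<open>F\<close>. That error is itself a correlation, with coefficients coming from the remainder
  of the potential, so \<open>corr_bound\<close> applies to it.\<close>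

lemma corr_deriv:
  fixes V :: "pt \<Rightarrow> real"
  assumes V: "smooth V" "periodic V" and \<rho>: "\<rho> > 0" and h: "h > 0"
    and sol: "schr_sol h (\<lambda>x. \<epsilon> * V x) \<psi> u" and \<psi>: "sqL2 \<psi>" "sqnorm \<psi> \<le> 1" "sqnorm (u (t * T)) \<le> 1"
    and \<sigma>: "T / h * \<epsilon> = \<sigma>"
    and d: "\<And>s k. d s k = cis (freq h k * s * T) * fc (u (s * T)) k"
  obtains D' where "\<And>n \<eta>. ((\<lambda>s. corr \<rho> h \<psi> (d s) n \<eta>) has_vector_derivative D' n \<eta>) (at t)"
    "\<And>n \<eta> F. finite F \<Longrightarrow> cmod (D' n \<eta> - \<i> * \<sigma> * (\<Sum>m\<in>F. rfc V m * (phase (h * (t * T)) n m *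
        corr \<rho> h \<psi> (d t) (n + m) (\<eta> + (2 * pi * (t * T)) *\<^sub>R vec m)))) \<le> \<bar>\<sigma>\<bar> * tail (rfc V) F"
proof -
  let ?s = "t * T"
  have cV: "continuous_on UNIV (\<lambda>x. \<epsilon> * V x)"
    by (intro continuous_intros smooth_continuous V)
  have su: "sqL2 (u ?s)" using sol L2_sqL2 by (simp add: schr_sol_def)
  define d' where "d' k = - \<i> * \<sigma> * cis (freq h k * t * T) * fc (\<lambda>x. of_real (V x) * u ?s x) k" for k
  have dd: "((\<lambda>s. d s k) has_vector_derivative d' k) (at t)" for k
  proof -
    have "fc (\<lambda>x. of_real (\<epsilon> * V x) * u ?s x) k = \<epsilon> * fc (\<lambda>x. of_real (V x) * u ?s x) k"
      by (simp add: fc_ip ip_cmult_right mult.assoc)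
    then show ?thesis
      using interaction_coeff[OF sol h cV, of k T t] by (simp add: d[abs_def] d'_def \<sigma>[symmetric] mult_ac)
  qed
  show ?thesis
  proof (rule that[of "corr \<rho> h \<psi> d'"])
    fix n \<eta>
    show "((\<lambda>s. corr \<rho> h \<psi> (d s) n \<eta>) has_vector_derivative corr \<rho> h \<psi> d' n \<eta>) (at t)"
      unfolding corr_def
      by (intro has_vector_derivative_sum has_vector_derivative_mult_left
          bounded_linear.has_vector_derivative[OF bounded_linear_cnj] dd)
  next
    fix n \<eta> and F :: "(int \<times> int) set" assume F: "finite F"
    obtain g where g: "sqL2 g" "sqnorm g \<le> (tail (rfc V) F)\<^sup>2 * sqnorm (u ?s)"
      "\<And>j. fc (\<lambda>x. of_real (V x) * u ?s x) j = (\<Sum>m\<in>F. cnj (rfc V m) * fc (u ?s) (j + m)) + fc g j"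
      by (rule fc_potential[OF V su F]) (rule that)
    define e where "e k = - \<i> * \<sigma> * cis (freq h k * t * T) * fc g k" for k
    let ?P = "\<lambda>k. of_real (chi \<rho> (xi h k)) * fc \<psi> k"
    let ?\<eta> = "\<lambda>m. \<eta> + (2 * pi * ?s) *\<^sub>R vec m"
    \<comment> \<open>Egorov's theorem for a single mode, as an identity. The part of the frequency
      difference that is linear in \<open>k\<close> is linear in \<open>xi h k\<close> and becomes
      the modulation; the rest is the same for all \<open>k\<close> and leaves the sum as
      \<open>phase\<close>.\<close>
    have trm: "cnj (- \<i> * \<sigma> * cis (freq h (k + n) * t * T) * (cnj (rfc V m) * fc (u ?s) (k + n + m))) * cis (\<eta> \<bullet> xi h k) =
        \<i> * \<sigma> * (rfc V m * (phase (h * ?s) n m * (cnj (d t (k + (n + m))) * cis (?\<eta> m \<bullet> xi h k))))" for k m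
    proof -
      have "cis (- (freq h (k + n) * t * T)) * cis (\<eta> \<bullet> xi h k) = phase (h * ?s) n m * (cis (- (freq h (k + n + m) * t * T)) * cis (?\<eta> m \<bullet> xi h k))"
        unfolding phase_def cis_mult
        by (rule arg_cong[where f = cis])
           (simp add: freq_vec vec_add xi_def inner_add_left inner_add_right inner_commute power2_eq_square algebra_simps)
      then have "cnj (cis (freq h (k + n) * t * T)) * cis (\<eta> \<bullet> xi h k) =
         phase (h * ?s) n m * (cnj (cis (freq h (k + n + m) * t * T)) * cis (?\<eta> m \<bullet> xi h k))"
        by (simp only: cis_cnj)
      then show ?thesis
        by (simp add: d add.assoc mult_ac)
    qed
    have "corr \<rho> h \<psi> d' n \<eta> = (\<Sum>k\<in>supp \<rho> h. (\<Sum>m\<in>F. \<i> * \<sigma> * (rfc V m * (phase (h * ?s) n m * (cnj (d t (k + (n + m))) * cis (?\<eta> m \<bullet> xi h k)))) * ?P k)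
       + cnj (e (k + n)) * cis (\<eta> \<bullet> xi h k) * ?P k)"
      unfolding corr_def trm[symmetric]
      by (intro sum.cong refl) (simp add: d'_def e_def g(3) distrib_left distrib_right sum_distrib_left sum_distrib_right mult.assoc)
    also have "\<dots> = (\<Sum>m\<in>F. \<Sum>k\<in>supp \<rho> h. \<i> * \<sigma> * (rfc V m * (phase (h * ?s) n m * (cnj (d t (k + (n + m))) * cis (?\<eta> m \<bullet> xi h k)))) * ?P k)
       + corr \<rho> h \<psi> e n \<eta>"
      unfolding sum.distrib corr_def by (subst sum.swap) (rule refl)
    also have "(\<Sum>m\<in>F. \<Sum>k\<in>supp \<rho> h. \<i> * \<sigma> * (rfc V m * (phase (h * ?s) n m * (cnj (d t (k + (n + m))) * cis (?\<eta> m \<bullet> xi h k)))) * ?P k) =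
      \<i> * \<sigma> * (\<Sum>m\<in>F. rfc V m * (phase (h * ?s) n m * corr \<rho> h \<psi> (d t) (n + m) (?\<eta> m)))"
      by (simp add: corr_def sum_distrib_left mult.assoc)
    finally have eq: "corr \<rho> h \<psi> d' n \<eta> - \<i> * \<sigma> * (\<Sum>m\<in>F. rfc V m * (phase (h * ?s) n m * corr \<rho> h \<psi> (d t) (n + m) (?\<eta> m))) = corr \<rho> h \<psi> e n \<eta>"
      by simp
    show "cmod (corr \<rho> h \<psi> d' n \<eta> - \<i> * \<sigma> * (\<Sum>m\<in>F. rfc V m * (phase (h * ?s) n m * corr \<rho> h \<psi> (d t) (n + m) (?\<eta> m)))) \<le> \<bar>\<sigma>\<bar> * tail (rfc V) F"
      unfolding eq
    proof (rule corr_bound[OF \<rho> h \<psi>(1,2)])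
      fix K :: "(int \<times> int) set" assume K: "finite K"
      have "(\<Sum>k\<in>K. (cmod (e k))\<^sup>2) = \<sigma>\<^sup>2 * (\<Sum>k\<in>K. (cmod (fc g k))\<^sup>2)"
        by (simp add: e_def norm_mult power_mult_distrib sum_distrib_left)
      also have "\<dots> \<le> \<sigma>\<^sup>2 * ((tail (rfc V) F)\<^sup>2 * 1)"
      proof (rule mult_left_mono)
        have "(tail (rfc V) F)\<^sup>2 * sqnorm (u ?s) \<le> (tail (rfc V) F)\<^sup>2 * 1"
          using \<psi>(3) by (intro mult_left_mono) auto
        then show "(\<Sum>k\<in>K. (cmod (fc g k))\<^sup>2) \<le> (tail (rfc V) F)\<^sup>2 * 1"
          using bessel[OF g(1) K] g(2) by linarith
      qed simp
      finally show "(\<Sum>k\<in>K. (cmod (e k))\<^sup>2) \<le> (\<bar>\<sigma>\<bar> * tail (rfc V) F)\<^sup>2"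
        by (simp add: power_mult_distrib)
    qed (simp add: tail_nonneg)
  qed
qed

section \<open>The limiting correlations and their hierarchy\<close>

lemma has_vector_derivative_integral_param:
  fixes f f' :: "real \<Rightarrow> 'a \<Rightarrow> complex"
  assumes M: "finite_measure M" and t: "t \<in> {0..T}"
    and der: "\<And>s z. s \<in> {0..T} \<Longrightarrow> ((\<lambda>s. f s z) has_vector_derivative f' s z) (at s within {0..T})"
    and bd: "\<And>s z. s \<in> {0..T} \<Longrightarrow> cmod (f' s z) \<le> B"
    and int: "\<And>s. s \<in> {0..T} \<Longrightarrow> integrable M (f s)" and meas: "f' t \<in> borel_measurable M"
  shows "((\<lambda>s. \<integral>z. f s z \<partial>M) has_vector_derivative (\<integral>z. f' t z \<partial>M)) (at t within {0..T})"
proof -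
  interpret M: finite_measure M by fact
  have int': "integrable M (f' t)"
    by (rule M.integrable_const_bound[of _ B]) (use bd[OF t] meas in auto)
  \<comment> \<open>The normalized first-order remainder at \<open>t\<close>, which tends to 0 for
    each \<open>z\<close>. Two values of \<open>f'\<close> differ by at most \<open>2 * B\<close>,
    so the mean value inequality dominates \<open>q\<close> by \<open>2 * B\<close>.\<close>
  define q where "q s z = (1 / norm (s - t)) *\<^sub>R (f s z - (f t z + (s - t) *\<^sub>R f' t z))" for s z
  have q_int: "integrable M (q s)" if "s \<in> {0..T}" for s
    unfolding q_def using int[OF that] int[OF t] int' by auto
  have lim: "((\<lambda>s. \<integral>z. q s z \<partial>M) \<longlongrightarrow> 0) (at t within {0..T})"
    unfolding tendsto_at_iff_sequentially o_def
  proof (intro allI impI)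
    fix X :: "nat \<Rightarrow> real" assume X: "\<forall>i. X i \<in> {0..T} - {t}" "X \<longlonglongrightarrow> t"
    have "(\<lambda>i. \<integral>z. q (X i) z \<partial>M) \<longlonglongrightarrow> (\<integral>z. 0 \<partial>M)"
    proof (rule integral_dominated_convergence[where w = "\<lambda>_. 2 * B"])
      show "q (X i) \<in> borel_measurable M" for i
        using q_int[of "X i"] X(1) by auto
      show "AE z in M. (\<lambda>i. q (X i) z) \<longlonglongrightarrow> 0"
      proof (rule AE_I2)
        fix z
        have "((\<lambda>s. q s z) \<longlongrightarrow> 0) (at t within {0..T})"
          using der[OF t, of z] unfolding q_def has_vector_derivative_def has_derivative_within by simp
        then show "(\<lambda>i. q (X i) z) \<longlonglongrightarrow> 0"
          using X unfolding tendsto_at_iff_sequentially o_def by blast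
      qed
      have "norm (q s z) \<le> 2 * B" if s: "s \<in> {0..T}" "s \<noteq> t" for s z
      proof -
        have "norm (f s z - f t z - (s - t) *\<^sub>R f' t z) \<le> norm (s - t) * (2 * B)"
        proof (rule vector_differentiable_bound_linearization[where S = "{0..T}"])
          show "closed_segment t s \<subseteq> {0..T}"
            using t s by (intro closed_segment_subset) auto
          show "norm (f' x z - f' t z) \<le> 2 * B" if "x \<in> {0..T}" for x
            using norm_triangle_ineq4[of "f' x z" "f' t z"] bd[OF that, of z] bd[OF t, of z] by linarith
        qed (use der t in auto)
        moreover have "norm (q s z) = norm (f s z - f t z - (s - t) *\<^sub>R f' t z) / norm (s - t)"
          by (simp add: q_def diff_diff_eq)
        ultimately show ?thesis
          using s by (simp only: pos_divide_le_eq zero_less_norm_iff right_minus_eq mult.commute not_False_eq_True)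
      qed
      then show "AE z in M. norm (q (X i) z) \<le> 2 * B" for i
        using X(1) by auto
    qed auto
    then show "(\<lambda>i. \<integral>z. q (X i) z \<partial>M) \<longlonglongrightarrow> 0" by simp
  qed
  have eq: "(\<integral>z. q s z \<partial>M) = (1 / norm (s - t)) *\<^sub>R ((\<integral>z. f s z \<partial>M) - ((\<integral>z. f t z \<partial>M) + (s - t) *\<^sub>R (\<integral>z. f' t z \<partial>M)))"
    if "s \<in> {0..T}" for s
    unfolding q_def using int[OF that] int[OF t] int' by simp
  have "((\<lambda>s. (1 / norm (s - t)) *\<^sub>R ((\<integral>z. f s z \<partial>M) - ((\<integral>z. f t z \<partial>M) + (s - t) *\<^sub>R (\<integral>z. f' t z \<partial>M)))) \<longlongrightarrow> 0) (at t within {0..T})"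
    by (rule Lim_transform_eventually[OF lim]) (simp add: eventually_at_filter eq)
  then show ?thesis
    unfolding has_vector_derivative_def has_derivative_within by (simp add: bounded_linear_scaleR_left)
qed

text \<open>The integral of \<open>V\<close> along the flow run at speed \<open>\<tau>\<close>: 1 is
  the geodesic flow, 0 freezes it and -1 runs it backwards.\<close>

definition Theta :: "(pt \<Rightarrow> real) \<Rightarrow> real \<Rightarrow> real \<Rightarrow> pt \<times> pt \<Rightarrow> real" where
  "Theta V \<tau> t z = integral {0..t} (\<lambda>s. V (fst z + (s * \<tau>) *\<^sub>R snd z))"

lemma continuous_Theta:
  assumes "continuous_on UNIV V"
  shows "continuous_on UNIV (Theta V \<tau> t)"
proof -
  have "continuous_on (UNIV \<times> cbox 0 t) (\<lambda>(z::pt \<times> pt, s). V (fst z + (s * \<tau>) *\<^sub>R snd z))"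
    unfolding case_prod_unfold
    by (rule continuous_on_compose2[OF assms]) (auto intro!: continuous_intros)
  from integral_continuous_on_param[OF this] show ?thesis
    by (simp add: Theta_def[abs_def])
qed

lemma Theta_deriv:
  assumes "continuous_on UNIV V" "t \<in> {0..T}"
  shows "((\<lambda>s. Theta V \<tau> s z) has_real_derivative V (fst z + (t * \<tau>) *\<^sub>R snd z)) (at t within {0..T})"
  unfolding Theta_def has_real_derivative_iff_has_vector_derivative
  by (intro integral_has_vector_derivative assms continuous_on_compose2[OF assms(1)]) (auto intro!: continuous_intros)

definition lcorr :: "real \<Rightarrow> (pt \<times> pt) measure \<Rightarrow> (pt \<Rightarrow> real) \<Rightarrow> real \<Rightarrow> real \<Rightarrow> real \<Rightarrow> int \<times> int \<Rightarrow> pt \<Rightarrow> complex" where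
  "lcorr \<rho> M V \<tau> \<sigma> t n \<eta> = (\<integral>z. obs \<rho> n \<eta> z * cis (\<sigma> * Theta V \<tau> t z) \<partial>M)"

lemma cmod_obs_le: "cmod (obs \<rho> n \<eta> z) \<le> 1"
  using chi_bounds[of \<rho> "snd z"] by (simp add: obs_def norm_mult)

lemma continuous_obs: "continuous_on UNIV (obs \<rho> n \<eta>)"
proof -
  have "continuous_on UNIV (\<lambda>z::pt \<times> pt. chi \<rho> (snd z))" "continuous_on UNIV (\<lambda>z::pt \<times> pt. ek n (fst z))"
    by (rule continuous_on_compose2[OF continuous_chi] continuous_on_compose2[OF continuous_ek[of UNIV]];
        auto intro: continuous_intros)+
  then show ?thesis
    unfolding obs_def[abs_def] by (intro continuous_intros)
qed

text \<open>This is why the limiting hierarchy closes: a mode of \<open>V\<close> transported along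
  the flow turns one observable into another with the same cutoff.\<close>

lemma obs_shift: "obs \<rho> n \<eta> z * ek m (fst z + s *\<^sub>R snd z) = obs \<rho> (n + m) (\<eta> + (2 * pi * s) *\<^sub>R vec m) z"
proof -
  have "cis (\<eta> \<bullet> snd z) * ek m (fst z + s *\<^sub>R snd z) = ek m (fst z) * cis ((\<eta> + (2 * pi * s) *\<^sub>R vec m) \<bullet> snd z)"
    unfolding ek_vec cis_mult
    by (rule arg_cong[where f = cis]) (simp add: inner_add_left inner_add_right algebra_simps)
  then show ?thesis
    by (simp add: obs_def ek_add mult_ac)
qed

text \<open>Differentiating the exponential brings down \<open>\<i> * \<sigma>\<close> times
  \<open>V\<close> along the flow. Its truncated Fourier series is absorbed by
  \<open>obs_shift\<close>; the remainder costs its uniform bound times the mass of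
  \<open>M\<close>.\<close>

lemma lcorr_deriv:
  assumes V: "smooth V" "periodic V" and M: "finite_measure M" "sets M = sets borel" and t: "t \<in> {0..T}"
  obtains D' where "\<And>n \<eta>. ((\<lambda>s. lcorr \<rho> M V \<tau> \<sigma> s n \<eta>) has_vector_derivative D' n \<eta>) (at t within {0..T})"
    "\<And>n \<eta> F. finite F \<Longrightarrow> cmod (D' n \<eta> - \<i> * \<sigma> * (\<Sum>m\<in>F. rfc V m *
        lcorr \<rho> M V \<tau> \<sigma> t (n + m) (\<eta> + (2 * pi * (t * \<tau>)) *\<^sub>R vec m))) \<le> \<bar>\<sigma>\<bar> * tail (rfc V) F * measure M (space M)"
proof -
  interpret M: finite_measure M by fact
  have cV: "continuous_on UNIV V" by (rule smooth_continuous) fact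
  have meas: "g \<in> borel_measurable M" if "continuous_on UNIV g" for g :: "pt \<times> pt \<Rightarrow> complex"
    using borel_measurable_continuous_onI[OF that] M(2) measurable_cong_sets by blast
  have cc: "continuous_on UNIV (\<lambda>z. cis (\<sigma> * Theta V \<tau> s z))" for s
    by (intro continuous_intros continuous_Theta cV)
  have bint: "integrable M g" if "continuous_on UNIV g" "\<And>z. cmod (g z) \<le> B" for g B
    by (rule M.integrable_const_bound[of _ B]) (use that meas in auto)
  let ?f = "\<lambda>n \<eta> s z. obs \<rho> n \<eta> z * cis (\<sigma> * Theta V \<tau> s z)"
  let ?V = "\<lambda>s z. V (fst z + (s * \<tau>) *\<^sub>R snd z)"
  let ?f' = "\<lambda>n \<eta> s z. obs \<rho> n \<eta> z * (\<i> * of_real (\<sigma> * ?V s z) * cis (\<sigma> * Theta V \<tau> s z))"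
  have fint: "integrable M (?f n \<eta> s)" for n \<eta> s
    by (rule bint[of _ 1]) (auto intro!: continuous_intros continuous_obs cc simp: norm_mult cmod_obs_le)
  \<comment> \<open>The empty truncation: \<open>V\<close> is bounded by the l1 norm of its
    coefficients.\<close>
  have Vb: "\<bar>V x\<bar> \<le> tail (rfc V) {}" for x
    using fourier_series[OF V, of "{}" x] by simp
  have cf': "continuous_on UNIV (?f' n \<eta> s)" for n \<eta> s
  proof -
    have "continuous_on UNIV (\<lambda>z::pt \<times> pt. V (fst z + (s * \<tau>) *\<^sub>R snd z))"
      by (rule continuous_on_compose2[OF cV]) (auto intro!: continuous_intros)
    then show ?thesis by (intro continuous_intros continuous_obs cc)
  qed
  have bf': "cmod (?f' n \<eta> s z) \<le> \<bar>\<sigma>\<bar> * tail (rfc V) {}" for n \<eta> s z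
  proof -
    have "cmod (?f' n \<eta> s z) = cmod (obs \<rho> n \<eta> z) * (\<bar>\<sigma>\<bar> * \<bar>?V s z\<bar>)"
      by (simp add: norm_mult abs_mult)
    also have "\<dots> \<le> 1 * (\<bar>\<sigma>\<bar> * tail (rfc V) {})"
      by (intro mult_mono cmod_obs_le mult_left_mono Vb) auto
    finally show ?thesis by simp
  qed
  show ?thesis
  proof (rule that[of "\<lambda>n \<eta>. \<integral>z. ?f' n \<eta> t z \<partial>M"])
    fix n \<eta>
    show "((\<lambda>s. lcorr \<rho> M V \<tau> \<sigma> s n \<eta>) has_vector_derivative (\<integral>z. ?f' n \<eta> t z \<partial>M)) (at t within {0..T})"
      unfolding lcorr_def
    proof (rule has_vector_derivative_integral_param[OF M(1) t _ bf' fint meas[OF cf']])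
      fix s z assume s: "s \<in> {0..T}"
      have "((\<lambda>s. \<sigma> * Theta V \<tau> s z) has_real_derivative \<sigma> * ?V s z) (at s within {0..T})"
        by (intro DERIV_cmult Theta_deriv cV s)
      then show "((\<lambda>s. ?f n \<eta> s z) has_vector_derivative ?f' n \<eta> s z) (at s within {0..T})"
        by (intro has_vector_derivative_mult_right has_vector_derivative_cis)
    qed
  next
    fix n \<eta> and F :: "(int \<times> int) set" assume F: "finite F"
    let ?\<eta> = "\<lambda>m. \<eta> + (2 * pi * (t * \<tau>)) *\<^sub>R vec m"
    have i: "integrable M (\<lambda>z. \<Sum>m\<in>F. rfc V m * ?f (n + m) (?\<eta> m) t z)"
      using fint by auto
    have "\<i> * \<sigma> * (\<Sum>m\<in>F. rfc V m * lcorr \<rho> M V \<tau> \<sigma> t (n + m) (?\<eta> m)) =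
       (\<integral>z. \<i> * \<sigma> * (\<Sum>m\<in>F. rfc V m * ?f (n + m) (?\<eta> m) t z) \<partial>M)"
      using fint by (simp add: lcorr_def)
    then have 1: "(\<integral>z. ?f' n \<eta> t z \<partial>M) - \<i> * \<sigma> * (\<Sum>m\<in>F. rfc V m * lcorr \<rho> M V \<tau> \<sigma> t (n + m) (?\<eta> m)) =
       (\<integral>z. ?f' n \<eta> t z - \<i> * \<sigma> * (\<Sum>m\<in>F. rfc V m * ?f (n + m) (?\<eta> m) t z) \<partial>M)"
      using i bint[OF cf' bf'] by (subst Bochner_Integration.integral_diff) auto
    have "cmod (\<integral>z. ?f' n \<eta> t z - \<i> * \<sigma> * (\<Sum>m\<in>F. rfc V m * ?f (n + m) (?\<eta> m) t z) \<partial>M) \<le> (\<integral>z. \<bar>\<sigma>\<bar> * tail (rfc V) F \<partial>M)"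
    proof (rule Bochner_Integration.integral_norm_bound_integral)
      show "integrable M (\<lambda>z. ?f' n \<eta> t z - \<i> * \<sigma> * (\<Sum>m\<in>F. rfc V m * ?f (n + m) (?\<eta> m) t z))"
        using i bint[OF cf' bf'] by (intro Bochner_Integration.integrable_diff) auto
      fix z
      have "?f' n \<eta> t z - \<i> * \<sigma> * (\<Sum>m\<in>F. rfc V m * ?f (n + m) (?\<eta> m) t z) =
        \<i> * \<sigma> * obs \<rho> n \<eta> z * cis (\<sigma> * Theta V \<tau> t z) *
         (of_real (?V t z) - (\<Sum>m\<in>F. rfc V m * ek m (fst z + (t * \<tau>) *\<^sub>R snd z)))"
        by (simp add: right_diff_distrib sum_distrib_left flip: obs_shift) (simp add: mult_ac)
      also have "cmod \<dots> = \<bar>\<sigma>\<bar> * cmod (obs \<rho> n \<eta> z) * cmod (of_real (?V t z) - (\<Sum>m\<in>F. rfc V m * ek m (fst z + (t * \<tau>) *\<^sub>R snd z)))"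
        by (simp only: norm_mult norm_ii norm_of_real norm_cis mult_1 mult_1_right)
      also have "\<dots> \<le> \<bar>\<sigma>\<bar> * 1 * tail (rfc V) F"
        by (intro mult_mono fourier_series V F cmod_obs_le mult_left_mono) (auto simp: cmod_obs_le)
      finally show "cmod (?f' n \<eta> t z - \<i> * \<sigma> * (\<Sum>m\<in>F. rfc V m * ?f (n + m) (?\<eta> m) t z)) \<le> \<bar>\<sigma>\<bar> * tail (rfc V) F"
        by simp
    qed auto
    moreover have "(\<integral>z. \<bar>\<sigma>\<bar> * tail (rfc V) F \<partial>M) = \<bar>\<sigma>\<bar> * tail (rfc V) F * measure M (space M)"
      by (simp add: mult.commute)
    ultimately show "cmod ((\<integral>z. ?f' n \<eta> t z \<partial>M) - \<i> * \<sigma> * (\<Sum>m\<in>F. rfc V m * lcorr \<rho> M V \<tau> \<sigma> t (n + m) (?\<eta> m)))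
       \<le> \<bar>\<sigma>\<bar> * tail (rfc V) F * measure M (space M)"
      by (simp only: 1)
  qed
qed

subsection \<open>The semiclassical limit\<close>

text \<open>The difference \<open>D\<close> of the two kinds of correlation falls under
  \<open>hierarchy_vanishes\<close> with index \<open>b = (n, \<eta>)\<close>. Subtracting the
  hierarchies leaves \<open>D\<close> at shifted indices, truncation errors, and the errors from the
  phase and from \<open>T i\<close> in place of \<open>\<tau>\<close>.\<close>

lemma corr_limit:
  fixes V :: "pt \<Rightarrow> real" and h ep T :: "nat \<Rightarrow> real"
  assumes V: "smooth V" "periodic V" and M: "finite_measure M" "sets M = sets borel" and \<rho>: "\<rho> > 0"
    and h: "\<And>i. h i > 0" "h \<longlonglongrightarrow> 0" and T: "T \<longlonglongrightarrow> \<tau>" and \<sigma>: "\<And>i. T i / h i * ep i = \<sigma>"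
    and sol: "\<And>i. schr_sol (h i) (\<lambda>x. ep i * V x) (\<psi> i) (u i)"
    and \<psi>: "\<And>i. sqL2 (\<psi> i)" "\<And>i. sqnorm (\<psi> i) \<le> 1"
    and scm: "\<And>n \<eta>. (\<lambda>i. ip (\<psi> i) (Op (h i) (obs \<rho> n \<eta>) (\<psi> i))) \<longlonglongrightarrow> (\<integral>z. obs \<rho> n \<eta> z \<partial>M)"
    and d: "\<And>i s k. d i s k = cis (freq (h i) k * s * T i) * fc (u i (s * T i)) k"
    and t: "t \<ge> 0"
  shows "(\<lambda>i. corr \<rho> (h i) (\<psi> i) (d i t) n \<eta>) \<longlonglongrightarrow> lcorr \<rho> M V \<tau> \<sigma> t n \<eta>"
proof -
  interpret M: finite_measure M by fact
  define m0 where "m0 = measure M (space M)"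
  have m0: "m0 \<ge> 0" by (simp add: m0_def)
  define v where "v = rfc V"
  note sv = rfc_summable[OF V, folded v_def]
  have cV: "continuous_on UNIV (\<lambda>x. ep i * V x)" for i
    by (intro continuous_intros smooth_continuous V)
  have nu: "sqnorm (u i (s * T i)) \<le> 1" if "s \<ge> 0" for i s
    using norm_conservation[OF sol h(1) cV that] \<psi>(2) by simp
  have su: "sqL2 (u i s)" for i s
    using sol L2_sqL2 by (simp add: schr_sol_def)
  have dK: "(\<Sum>k\<in>K. (cmod (d i s k))\<^sup>2) \<le> 1" if "s \<ge> 0" "finite K" for i s K
  proof -
    have "(\<Sum>k\<in>K. (cmod (d i s k))\<^sup>2) = (\<Sum>k\<in>K. (cmod (fc (u i (s * T i)) k))\<^sup>2)"
      by (simp add: d norm_mult)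
    then show ?thesis using bessel[OF su that(2), of i "s * T i"] nu[OF that(1), of i] by linarith
  qed
  define G where "G i s b = corr \<rho> (h i) (\<psi> i) (d i s) (fst b) (snd b)" for i s and b :: "(int \<times> int) \<times> pt"
  define G0 where "G0 s b = lcorr \<rho> M V \<tau> \<sigma> s (fst b) (snd b)" for s and b :: "(int \<times> int) \<times> pt"
  define sh where "sh r m b = (fst b + m, snd b + (2 * pi * r) *\<^sub>R vec m)" for r m and b :: "(int \<times> int) \<times> pt"
  define D where "D i s b = G i s b - G0 s b" for i s b
  have Gb: "cmod (G i s b) \<le> 1" if "s \<ge> 0" for i s b
    unfolding G_def using dK[OF that] by (intro corr_bound \<rho> h \<psi>) auto
  have G0b: "cmod (G0 s b) \<le> m0" for s b
  proof -
    have "cmod (G0 s b) \<le> (\<integral>z. 1 \<partial>M)"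
      unfolding G0_def lcorr_def
    proof (rule Bochner_Integration.integral_norm_bound_integral)
      have "continuous_on UNIV (\<lambda>z. obs \<rho> (fst b) (snd b) z * cis (\<sigma> * Theta V \<tau> s z))"
        by (intro continuous_intros continuous_obs continuous_Theta smooth_continuous V)
      then have "(\<lambda>z. obs \<rho> (fst b) (snd b) z * cis (\<sigma> * Theta V \<tau> s z)) \<in> borel_measurable M"
        using borel_measurable_continuous_onI M(2) measurable_cong_sets by blast
      then show "integrable M (\<lambda>z. obs \<rho> (fst b) (snd b) z * cis (\<sigma> * Theta V \<tau> s z))"
        by (intro M.integrable_const_bound[of _ 1]) (auto simp: norm_mult cmod_obs_le)
    qed (auto simp: norm_mult cmod_obs_le)
    then show ?thesis by (simp add: m0_def)
  qed
  define P where "P i s D' \<longleftrightarrow> (\<forall>b. ((\<lambda>s. G i s b) has_vector_derivative D' b) (at s within {0..t})) \<and>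
     (\<forall>b F. finite F \<longrightarrow> cmod (D' b - \<i> * \<sigma> * (\<Sum>m\<in>F. v m * (phase (h i * (s * T i)) (fst b) m * G i s (sh (s * T i) m b)))) \<le> \<bar>\<sigma>\<bar> * tail v F)"
    for i s and D' :: "(int \<times> int) \<times> pt \<Rightarrow> complex"
  have ex: "\<exists>D'. P i s D'" if "s \<in> {0..t}" for i s
  proof -
    have s0: "s \<ge> 0" using that by simp
    obtain D' where "\<And>n \<eta>. ((\<lambda>s. corr \<rho> (h i) (\<psi> i) (d i s) n \<eta>) has_vector_derivative D' n \<eta>) (at s)"
      "\<And>n \<eta> F. finite F \<Longrightarrow> cmod (D' n \<eta> - \<i> * \<sigma> * (\<Sum>m\<in>F. rfc V m * (phase (h i * (s * T i)) n m *
        corr \<rho> (h i) (\<psi> i) (d i s) (n + m) (\<eta> + (2 * pi * (s * T i)) *\<^sub>R vec m)))) \<le> \<bar>\<sigma>\<bar> * tail (rfc V) F"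
      by (rule corr_deriv[where t = s, OF V \<rho> h(1) sol \<psi>(1,2) nu[OF s0] \<sigma> d]) (rule that)
    then show ?thesis
      by (intro exI[of _ "\<lambda>b. D' (fst b) (snd b)"])
         (auto simp: P_def G_def sh_def v_def intro: has_vector_derivative_at_within)
  qed
  \<comment> \<open>For each \<open>i\<close> and \<open>s\<close> only the existence of a
    derivative, common to all indices and truncations, is known; choice makes it a function.\<close>
  define D1 where "D1 i s = (SOME D'. P i s D')" for i s
  have "P i s (D1 i s)" if "s \<in> {0..t}" for i s
    unfolding D1_def by (rule someI_ex[OF ex[OF that]])
  then have D1: "\<And>i s b. s \<in> {0..t} \<Longrightarrow> ((\<lambda>s. G i s b) has_vector_derivative D1 i s b) (at s within {0..t})"
    "\<And>i s b F. s \<in> {0..t} \<Longrightarrow> finite F \<Longrightarrow> cmod (D1 i s b - \<i> * \<sigma> * (\<Sum>m\<in>F. v m * (phase (h i * (s * T i)) (fst b) m * G i s (sh (s * T i) m b)))) \<le> \<bar>\<sigma>\<bar> * tail v F"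
    unfolding P_def by blast+
  define P0 where "P0 s D' \<longleftrightarrow> (\<forall>b. ((\<lambda>s. G0 s b) has_vector_derivative D' b) (at s within {0..t})) \<and>
     (\<forall>b F. finite F \<longrightarrow> cmod (D' b - \<i> * \<sigma> * (\<Sum>m\<in>F. v m * G0 s (sh (s * \<tau>) m b))) \<le> \<bar>\<sigma>\<bar> * tail v F * m0)"
    for s and D' :: "(int \<times> int) \<times> pt \<Rightarrow> complex"
  have ex0: "\<exists>D'. P0 s D'" if s: "s \<in> {0..t}" for s
  proof -
    obtain D' where "\<And>n \<eta>. ((\<lambda>s. lcorr \<rho> M V \<tau> \<sigma> s n \<eta>) has_vector_derivative D' n \<eta>) (at s within {0..t})"
      "\<And>n \<eta> F. finite F \<Longrightarrow> cmod (D' n \<eta> - \<i> * \<sigma> * (\<Sum>m\<in>F. rfc V m *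
        lcorr \<rho> M V \<tau> \<sigma> s (n + m) (\<eta> + (2 * pi * (s * \<tau>)) *\<^sub>R vec m))) \<le> \<bar>\<sigma>\<bar> * tail (rfc V) F * measure M (space M)"
      by (rule lcorr_deriv[OF V M s]) (rule that)
    then show ?thesis
      by (intro exI[of _ "\<lambda>b. D' (fst b) (snd b)"]) (auto simp: P0_def G0_def sh_def v_def m0_def)
  qed
  define D2 where "D2 s = (SOME D'. P0 s D')" for s
  have "P0 s (D2 s)" if "s \<in> {0..t}" for s
    unfolding D2_def by (rule someI_ex[OF ex0[OF that]])
  then have D2: "\<And>s b. s \<in> {0..t} \<Longrightarrow> ((\<lambda>s. G0 s b) has_vector_derivative D2 s b) (at s within {0..t})"
    "\<And>s b F. s \<in> {0..t} \<Longrightarrow> finite F \<Longrightarrow> cmod (D2 s b - \<i> * \<sigma> * (\<Sum>m\<in>F. v m * G0 s (sh (s * \<tau>) m b))) \<le> \<bar>\<sigma>\<bar> * tail v F * m0"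
    unfolding P0_def by blast+
  have "(\<lambda>i. D i t (n, \<eta>)) \<longlonglongrightarrow> 0"
  \<comment> \<open>The shift is taken with the limit \<open>\<tau>\<close>, since the rule wants it
    independent of \<open>i\<close>. The weights are \<open>\<bar>\<sigma>\<bar>\<close> times the
    moduli of the coefficients of \<open>V\<close>, and \<open>B\<close> adds the bounds 1 and
    \<open>m0\<close> of the two correlations.\<close>
  proof (rule hierarchy_vanishes[where D = D and D' = "\<lambda>i s b. D1 i s b - D2 s b" and T = t and B = "1 + m0"
        and B' = "\<bar>\<sigma>\<bar> * tail v {} * (1 + m0)" and w = "\<lambda>m. \<bar>\<sigma>\<bar> * cmod (v m)" and C = "\<bar>\<sigma>\<bar> * tail v {}"
        and sh = "\<lambda>s. sh (s * \<tau>)"])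
    fix i s and b :: "(int \<times> int) \<times> pt" assume s: "s \<in> {0..t}"
    show "cmod (D i s b) \<le> 1 + m0"
      unfolding D_def using norm_triangle_ineq4[of "G i s b" "G0 s b"] Gb[of s i b] G0b[of s b] s by simp
    show "((\<lambda>s. D i s b) has_vector_derivative D1 i s b - D2 s b) (at s within {0..t})"
      unfolding D_def by (intro has_vector_derivative_diff D1 D2 s)
    have "cmod (D1 i s b) \<le> \<bar>\<sigma>\<bar> * tail v {}" "cmod (D2 s b) \<le> \<bar>\<sigma>\<bar> * tail v {} * m0"
      using D1(2)[OF s, of "{}" i b] D2(2)[OF s, of "{}" b] by simp_all
    then show "cmod (D1 i s b - D2 s b) \<le> \<bar>\<sigma>\<bar> * tail v {} * (1 + m0)"
      using norm_triangle_ineq4[of "D1 i s b" "D2 s b"] by (simp add: distrib_left)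
  next
    fix s \<epsilon> :: real and b :: "(int \<times> int) \<times> pt" assume s: "s \<in> {0..t}" and \<epsilon>: "\<epsilon> > 0"
    have s0: "s \<ge> 0" using s by simp
    have pos: "2 * ((\<bar>\<sigma>\<bar> + 1) * (1 + m0)) > 0" using m0 by simp
    \<comment> \<open>Chosen so that the two truncation errors, of total factor
      \<open>\<bar>\<sigma>\<bar> * (1 + m0)\<close>, stay within \<open>\<epsilon> / 2\<close>;
      \<open>\<bar>\<sigma>\<bar> + 1\<close> keeps the denominator positive.\<close>
    obtain F where F: "finite F" "tail v F < \<epsilon> / (2 * ((\<bar>\<sigma>\<bar> + 1) * (1 + m0)))"
      using tail_small[OF sv, of "\<epsilon> / (2 * ((\<bar>\<sigma>\<bar> + 1) * (1 + m0)))"] \<epsilon> pos by (metis divide_pos_pos)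
    have "\<bar>\<sigma>\<bar> * tail v F * (1 + m0) \<le> (\<bar>\<sigma>\<bar> + 1) * tail v F * (1 + m0)"
      using tail_nonneg[of v F] m0 by (intro mult_right_mono) auto
    also have "\<dots> = tail v F * (2 * ((\<bar>\<sigma>\<bar> + 1) * (1 + m0))) / 2" by simp
    also have "\<dots> \<le> \<epsilon> / 2"
      using F(2) unfolding pos_less_divide_eq[OF pos] by simp
    finally have tl: "\<bar>\<sigma>\<bar> * tail v F + \<bar>\<sigma>\<bar> * tail v F * m0 \<le> \<epsilon> / 2" by (simp add: distrib_left)
    \<comment> \<open>The price of replacing the quantum transport by the limiting one: the phase
      differs from 1, and the modulation uses \<open>T i\<close> where the limit has
      \<open>\<tau>\<close>, at the Lipschitz cost \<open>\<rho>\<close>. It vanishes for each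
      \<open>m\<close>, which suffices as \<open>F\<close> is finite.\<close>
    define q where "q i m = cmod (phase (h i * (s * T i)) (fst b) m - 1) + norm ((2 * pi * (s * T i) - 2 * pi * (s * \<tau>)) *\<^sub>R vec m) * \<rho>" for i m
    have q0: "(\<lambda>i. \<bar>\<sigma>\<bar> * (\<Sum>m\<in>F. cmod (v m) * q i m)) \<longlonglongrightarrow> \<bar>\<sigma>\<bar> * (\<Sum>m\<in>F. cmod (v m) * 0)"
    proof (intro tendsto_mult_left tendsto_sum)
      fix m
      have "(\<lambda>i. phase (h i * (s * T i)) (fst b) m) \<longlonglongrightarrow> cis (2 * pi\<^sup>2 * (0 * (s * \<tau>)) * (2 * (vec (fst b) \<bullet> vec m) + vec m \<bullet> vec m))"
        unfolding phase_def by (intro tendsto_intros h T)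
      then have p: "(\<lambda>i. phase (h i * (s * T i)) (fst b) m) \<longlonglongrightarrow> 1" by simp
      have "(\<lambda>i. q i m) \<longlonglongrightarrow> cmod (1 - 1) + norm ((2 * pi * (s * \<tau>) - 2 * pi * (s * \<tau>)) *\<^sub>R vec m) * \<rho>"
        unfolding q_def by (intro tendsto_intros p T)
      then show "(\<lambda>i. q i m) \<longlonglongrightarrow> 0" by simp
    qed
    have "\<forall>\<^sub>F i in sequentially. \<bar>\<sigma>\<bar> * (\<Sum>m\<in>F. cmod (v m) * q i m) < \<epsilon> / 2"
      using order_tendstoD(2)[OF q0, of "\<epsilon> / 2"] \<epsilon> by simp
    then have "\<forall>\<^sub>F i in sequentially. cmod (D1 i s b - D2 s b) \<le> (\<Sum>m\<in>F. \<bar>\<sigma>\<bar> * cmod (v m) * cmod (D i s (sh (s * \<tau>) m b))) + \<epsilon>"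
    proof eventually_elim
      case (elim i)
      let ?G = "\<lambda>m. phase (h i * (s * T i)) (fst b) m * G i s (sh (s * T i) m b)"
      let ?H = "\<lambda>m. G0 s (sh (s * \<tau>) m b)"
      have GH: "cmod (?G m - ?H m) \<le> q i m + cmod (D i s (sh (s * \<tau>) m b))" for m
      proof -
        have "?G m - ?H m = (phase (h i * (s * T i)) (fst b) m - 1) * G i s (sh (s * T i) m b)
            + (G i s (sh (s * T i) m b) - G i s (sh (s * \<tau>) m b)) + D i s (sh (s * \<tau>) m b)"
          by (simp add: D_def algebra_simps)
        also have "cmod \<dots> \<le> cmod ((phase (h i * (s * T i)) (fst b) m - 1) * G i s (sh (s * T i) m b))
            + cmod (G i s (sh (s * T i) m b) - G i s (sh (s * \<tau>) m b)) + cmod (D i s (sh (s * \<tau>) m b))"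
          by (intro norm_triangle_le add_mono norm_triangle_ineq order_refl)
        also have "cmod ((phase (h i * (s * T i)) (fst b) m - 1) * G i s (sh (s * T i) m b)) \<le> cmod (phase (h i * (s * T i)) (fst b) m - 1) * 1"
          unfolding norm_mult using Gb[of s] s by (intro mult_left_mono) auto
        also have "cmod (G i s (sh (s * T i) m b) - G i s (sh (s * \<tau>) m b)) \<le>
            norm ((2 * pi * (s * T i) - 2 * pi * (s * \<tau>)) *\<^sub>R vec m) * \<rho>"
          using corr_diff[OF \<rho> h(1) \<psi>(1,2) dK[OF s0], where n = "fst b + m"
              and \<eta> = "snd b + (2 * pi * (s * T i)) *\<^sub>R vec m" and \<eta>' = "snd b + (2 * pi * (s * \<tau>)) *\<^sub>R vec m"]
          by (simp add: G_def sh_def scaleR_left_diff_distrib)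
        finally show ?thesis by (simp add: q_def)
      qed
      define X where "X = D1 i s b - \<i> * \<sigma> * (\<Sum>m\<in>F. v m * ?G m)"
      define Y where "Y = D2 s b - \<i> * \<sigma> * (\<Sum>m\<in>F. v m * ?H m)"
      have Z: "cmod (\<i> * \<sigma> * (\<Sum>m\<in>F. v m * (?G m - ?H m))) \<le> \<bar>\<sigma>\<bar> * (\<Sum>m\<in>F. cmod (v m) * (q i m + cmod (D i s (sh (s * \<tau>) m b))))"
      proof -
        have "cmod (\<Sum>m\<in>F. v m * (?G m - ?H m)) \<le> (\<Sum>m\<in>F. cmod (v m) * (q i m + cmod (D i s (sh (s * \<tau>) m b))))"
          by (rule sum_norm_le) (simp only: norm_mult, intro mult_left_mono GH norm_ge_zero)
        then show ?thesis by (simp add: norm_mult mult_left_mono)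
      qed
      have tri: "cmod (X - Y + W) \<le> cmod X + cmod Y + cmod W" for W
        using norm_triangle_ineq[of "X - Y" W] norm_triangle_ineq4[of X Y] by linarith
      have DXY: "D1 i s b - D2 s b = X - Y + \<i> * \<sigma> * (\<Sum>m\<in>F. v m * (?G m - ?H m))"
        by (simp add: X_def Y_def right_diff_distrib sum_subtractf)
      have "cmod (D1 i s b - D2 s b) \<le> cmod X + cmod Y + cmod (\<i> * \<sigma> * (\<Sum>m\<in>F. v m * (?G m - ?H m)))"
        unfolding DXY by (rule tri)
      moreover have "cmod X \<le> \<bar>\<sigma>\<bar> * tail v F"
        unfolding X_def by (rule D1(2)[OF s F(1)])
      moreover have "cmod Y \<le> \<bar>\<sigma>\<bar> * tail v F * m0"
        unfolding Y_def by (rule D2(2)[OF s F(1)])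
      moreover have "\<bar>\<sigma>\<bar> * (\<Sum>m\<in>F. cmod (v m) * (q i m + cmod (D i s (sh (s * \<tau>) m b)))) =
         \<bar>\<sigma>\<bar> * (\<Sum>m\<in>F. cmod (v m) * q i m) + (\<Sum>m\<in>F. \<bar>\<sigma>\<bar> * cmod (v m) * cmod (D i s (sh (s * \<tau>) m b)))"
        by (simp add: distrib_left sum.distrib sum_distrib_left mult.assoc)
      ultimately show ?case using Z elim tl by linarith
    qed
    then show "\<exists>F. finite F \<and> (\<forall>\<^sub>F i in sequentially. cmod (D1 i s b - D2 s b) \<le> (\<Sum>m\<in>F. \<bar>\<sigma>\<bar> * cmod (v m) * cmod (D i s (sh (s * \<tau>) m b))) + \<epsilon>)"
      using F(1) by blast
  next
    fix F :: "(int \<times> int) set" assume F: "finite F"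
    have "sum (\<lambda>m. cmod (v m)) F \<le> tail v {}"
      using tail_eq[OF sv F] tail_nonneg[of v F] by simp
    then show "(\<Sum>m\<in>F. \<bar>\<sigma>\<bar> * cmod (v m)) \<le> \<bar>\<sigma>\<bar> * tail v {}"
      by (simp add: sum_distrib_left[symmetric] mult_left_mono)
  next
    fix b :: "(int \<times> int) \<times> pt"
    have "G i 0 b = ip (\<psi> i) (Op (h i) (obs \<rho> (fst b) (snd b)) (\<psi> i))" for i
    proof -
      have "d i 0 = fc (\<psi> i)"
      proof
        have "u i 0 = \<psi> i" using sol[of i] unfolding schr_sol_def by blast
        then show "d i 0 k = fc (\<psi> i) k" for k by (simp add: d)
      qed
      then show ?thesis by (simp add: G_def ip_Op_obs \<rho> h \<psi>)
    qed
    moreover have "G0 0 b = (\<integral>z. obs \<rho> (fst b) (snd b) z \<partial>M)"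
      by (simp add: G0_def lcorr_def Theta_def)
    ultimately have "(\<lambda>i. D i 0 b) \<longlonglongrightarrow> G0 0 b - G0 0 b"
      unfolding D_def using scm[of "fst b" "snd b"] by (intro tendsto_diff tendsto_const) simp
    then show "(\<lambda>i. D i 0 b) \<longlonglongrightarrow> 0" by simp
  qed (use t in auto)
  then have "(\<lambda>i. D i t (n, \<eta>) + G0 t (n, \<eta>)) \<longlonglongrightarrow> 0 + G0 t (n, \<eta>)"
    by (intro tendsto_add tendsto_const)
  then show ?thesis by (simp add: D_def G_def G0_def)
qed

text \<open>The cutoff acts on the coefficients of \<open>\<psi>\<close> only. Where
  \<open>eigv h k\<close> is at least \<open>R\<close>, the loss is at most the spectral projection
  of \<open>\<psi>\<close>; elsewhere the momentum has norm at most \<open>sqrt R\<close> and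
  \<open>1 - chi\<close> is at most \<open>\<epsilon>\<close>. Cauchy-Schwarz pairs this with
  \<open>w\<close>, of norm at most 1.\<close>

lemma overlap_corr_diff:
  assumes \<rho>: "\<rho> > 0" and h: "h > 0" and \<psi>: "sqL2 \<psi>" "sqnorm \<psi> \<le> 1" and w: "sqL2 w" "sqnorm w \<le> 1" and v: "sqL2 v"
    and fv: "\<And>k. fc v k = cis (- (freq h k * s)) * fc \<psi> k"
    and d: "\<And>k. d k = cis (freq h k * s) * fc w k"
    and \<epsilon>: "\<epsilon> \<ge> 0" "\<And>\<xi>. norm \<xi> \<le> sqrt R \<Longrightarrow> 1 - \<epsilon> \<le> chi \<rho> \<xi>" and R: "R \<ge> 0"
  shows "cmod (ip w v - corr \<rho> h \<psi> d 0 0) \<le> specproj_norm {R..} h \<psi> + \<epsilon>"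
proof -
  let ?X = "\<lambda>k. complex_of_real (chi \<rho> (xi h k))"
  let ?S = "specproj_norm {R..} h \<psi>"
  have S0: "?S \<ge> 0"
    by (simp add: specproj_norm_def infsum_nonneg)
  have b: "(\<Sum>k\<in>K. (cmod (fc \<psi> k))\<^sup>2) \<le> 1" if "finite K" for K
    using bessel[OF \<psi>(1) that] \<psi>(2) by linarith
  have dK: "(\<Sum>k\<in>K. (cmod (d k))\<^sup>2) \<le> 1\<^sup>2" if "finite K" for K
    using bessel[OF w(1) that] w(2) by (simp add: d norm_mult)
  \<comment> \<open>\<open>d\<close> removes the free phase from \<open>w\<close>, while
    \<open>v\<close> carries that phase on top of \<open>\<psi>\<close>; the overlap is therefore a
    pairing of \<open>d\<close> with the initial datum.\<close>
  have "(\<lambda>k. cnj (d k) * fc \<psi> k) = (\<lambda>k. cnj (fc w k) * fc v k)"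
    by (simp add: d fv fun_eq_iff cis_cnj)
  then have s1: "((\<lambda>k. cnj (d k) * fc \<psi> k) has_sum ip w v) UNIV"
    using parseval[OF w(1) v] by simp
  have "((\<lambda>k. cnj (d k) * (?X k * fc \<psi> k)) has_sum corr \<rho> h \<psi> d 0 0) (supp \<rho> h)"
    by (rule has_sum_finiteI[OF finite_supp[OF \<rho> h]]) (simp add: corr_def)
  then have s2: "((\<lambda>k. cnj (d k) * (?X k * fc \<psi> k)) has_sum corr \<rho> h \<psi> d 0 0) UNIV"
    by (subst has_sum_cong_neutral[where T = "supp \<rho> h"]) (auto simp: supp_def)
  have "((\<lambda>k. cnj (d k) * ((1 - ?X k) * fc \<psi> k)) has_sum (ip w v - corr \<rho> h \<psi> d 0 0)) UNIV"
    using has_sum_add[OF s1 has_sum_cmult_right[OF s2, of "- 1"]] by (simp add: algebra_simps)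
  then have eq: "ip w v - corr \<rho> h \<psi> d 0 0 = (\<Sum>\<^sub>\<infinity>k. cnj (d k) * ((1 - ?X k) * fc \<psi> k))"
    by (simp add: infsumI)
  have g: "(\<Sum>k\<in>K. (cmod ((1 - ?X k) * fc \<psi> k))\<^sup>2) \<le> (?S + \<epsilon>)\<^sup>2" if K: "finite K" for K
  proof -
    let ?A = "{k \<in> K. eigv h k \<in> {R..}}" and ?B = "{k \<in> K. eigv h k \<notin> {R..}}"
    have X: "cmod ((1 - ?X k) * fc \<psi> k) = (1 - chi \<rho> (xi h k)) * cmod (fc \<psi> k)" for k
    proof -
      have "1 - ?X k = of_real (1 - chi \<rho> (xi h k))" by simp
      then show ?thesis
        using chi_bounds[of \<rho> "xi h k"] by (simp only: norm_mult norm_of_real)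
    qed
    have sm: "(\<lambda>k. (cmod (fc \<psi> k))\<^sup>2) summable_on {k. eigv h k \<in> {R..}}"
      by (rule nonneg_bdd_above_summable_on) (use b in \<open>auto intro!: bdd_aboveI2\<close>)
    have "(\<Sum>k\<in>?A. (cmod ((1 - ?X k) * fc \<psi> k))\<^sup>2) \<le> (\<Sum>k\<in>?A. (cmod (fc \<psi> k))\<^sup>2)"
      unfolding X using chi_bounds[of \<rho>]
      by (intro sum_mono power_mono mult_left_le_one_le mult_nonneg_nonneg) auto
    also have "\<dots> \<le> ?S\<^sup>2"
    proof -
      have "(\<Sum>k\<in>?A. (cmod (fc \<psi> k))\<^sup>2) \<le> (\<Sum>\<^sub>\<infinity>k\<in>{k. eigv h k \<in> {R..}}. (cmod (fc \<psi> k))\<^sup>2)"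
        by (rule finite_sum_le_infsum[OF sm]) (use K in auto)
      then show ?thesis
        unfolding specproj_norm_def by (simp only: real_sqrt_pow2[OF infsum_nonneg] zero_le_power2)
    qed
    finally have A: "(\<Sum>k\<in>?A. (cmod ((1 - ?X k) * fc \<psi> k))\<^sup>2) \<le> ?S\<^sup>2" .
    have "(\<Sum>k\<in>?B. (cmod ((1 - ?X k) * fc \<psi> k))\<^sup>2) \<le> (\<Sum>k\<in>?B. \<epsilon>\<^sup>2 * (cmod (fc \<psi> k))\<^sup>2)"
    proof (rule sum_mono)
      fix k assume "k \<in> ?B"
      then have "(norm (xi h k))\<^sup>2 \<le> R" by (simp add: eigv_xi)
      then have "1 - chi \<rho> (xi h k) \<le> \<epsilon>"
        using \<epsilon>(2)[of "xi h k"] real_le_rsqrt by auto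
      then have "(1 - chi \<rho> (xi h k)) * cmod (fc \<psi> k) \<le> \<epsilon> * cmod (fc \<psi> k)"
        by (intro mult_right_mono) auto
      then have "((1 - chi \<rho> (xi h k)) * cmod (fc \<psi> k))\<^sup>2 \<le> (\<epsilon> * cmod (fc \<psi> k))\<^sup>2"
        using chi_bounds[of \<rho> "xi h k"] by (intro power_mono) auto
      then show "(cmod ((1 - ?X k) * fc \<psi> k))\<^sup>2 \<le> \<epsilon>\<^sup>2 * (cmod (fc \<psi> k))\<^sup>2"
        unfolding X by (simp add: power_mult_distrib)
    qed
    also have "\<dots> \<le> \<epsilon>\<^sup>2 * 1"
      unfolding sum_distrib_left[symmetric] using K by (intro mult_left_mono b) auto
    finally have B: "(\<Sum>k\<in>?B. (cmod ((1 - ?X k) * fc \<psi> k))\<^sup>2) \<le> \<epsilon>\<^sup>2" by simp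
    have "(\<Sum>k\<in>K. (cmod ((1 - ?X k) * fc \<psi> k))\<^sup>2) = (\<Sum>k\<in>?A \<union> ?B. (cmod ((1 - ?X k) * fc \<psi> k))\<^sup>2)"
      by (intro sum.cong) auto
    also have "\<dots> = (\<Sum>k\<in>?A. (cmod ((1 - ?X k) * fc \<psi> k))\<^sup>2) + (\<Sum>k\<in>?B. (cmod ((1 - ?X k) * fc \<psi> k))\<^sup>2)"
      using K by (intro sum.union_disjoint) auto
    also have "\<dots> \<le> ?S\<^sup>2 + \<epsilon>\<^sup>2" using A B by linarith
    also have "\<dots> \<le> (?S + \<epsilon>)\<^sup>2" using S0 \<epsilon>(1) by (simp add: power2_sum)
    finally show ?thesis .
  qed
  show ?thesis
    unfolding eq using abs_summable_prod(2)[OF dK g] S0 \<epsilon>(1) by simp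
qed

text \<open>The sign \<open>\<sigma>\<close> of the time is moved into the time scale, so that only \<open>t \<ge> 0\<close> has to be
  considered.\<close>

lemma overlap_limit:
  fixes V :: "pt \<Rightarrow> real" and eps :: "real \<Rightarrow> real" and \<psi> :: "real \<Rightarrow> pt \<Rightarrow> complex"
    and u ue :: "real \<Rightarrow> real \<Rightarrow> pt \<Rightarrow> complex"
  assumes V: "smooth V" "periodic V"
    and eps: "\<And>h. 0 < h \<Longrightarrow> h \<le> 1 \<Longrightarrow> eps h > 0"
    and psi: "\<And>h. 0 < h \<Longrightarrow> h \<le> 1 \<Longrightarrow> L2 (\<psi> h) \<and> L2norm (\<psi> h) = 1"
    and high: "((\<lambda>R. Limsup (at_right 0) (\<lambda>h. ereal (specproj_norm {R..} h (\<psi> h)))) \<longlongrightarrow> 0) at_top"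
    and M: "finite_measure M" "sets M = sets borel"
    and scm: "\<And>a. symbol a \<Longrightarrow> ((\<lambda>h. ip (\<psi> h) (Op h a (\<psi> h))) \<longlongrightarrow> integral\<^sup>L M a) (at_right 0)"
    and free: "\<And>h. 0 < h \<Longrightarrow> h \<le> 1 \<Longrightarrow> schr_sol h (\<lambda>x. 0) (\<psi> h) (u h)"
    and pert: "\<And>h. 0 < h \<Longrightarrow> h \<le> 1 \<Longrightarrow> schr_sol h (\<lambda>x. eps h * V x) (\<psi> h) (ue h)"
    and \<tau>: "((\<lambda>h. \<sigma> * (h / eps h)) \<longlongrightarrow> \<tau>) (at_right 0)" and t: "t \<ge> 0"
  shows "((\<lambda>h. ip (ue h (t * (\<sigma> * (h / eps h)))) (u h (t * (\<sigma> * (h / eps h))))) \<longlongrightarrow>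
      (\<integral>z. cis (\<sigma> * Theta V \<tau> t z) \<partial>M)) (at_right 0)"
\<comment> \<open>Sequences are what the dominated convergence in \<open>hierarchy_vanishes\<close>
  works with; the bound 1 keeps every \<open>S i\<close> in the range of the hypotheses.\<close>
proof (rule tendsto_at_right_sequentially[of 0 1])
  show "(0::real) < 1" by simp
  fix S :: "nat \<Rightarrow> real"
  assume S: "\<And>n. 0 < S n" "\<And>n. S n < 1" "decseq S" "S \<longlonglongrightarrow> 0"
  interpret M: finite_measure M by fact
  have S1: "S i \<le> 1" for i using S(2)[of i] by simp
  have "S i \<noteq> 0" for i using S(1)[of i] by simp
  then have Sf: "filterlim S (at_right 0) sequentially"
    using S by (simp add: filterlim_at)
  define T where "T i = \<sigma> * (S i / eps (S i))" for i
  define L where "L = (\<integral>z. cis (\<sigma> * Theta V \<tau> t z) \<partial>M)"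
  define ov where "ov i = ip (ue (S i) (t * T i)) (u (S i) (t * T i))" for i
  define d where "d i s k = cis (freq (S i) k * s * T i) * fc (ue (S i) (s * T i)) k" for i s k
  have Tl: "T \<longlonglongrightarrow> \<tau>"
    unfolding T_def by (rule filterlim_compose[OF \<tau> Sf])
  have T\<sigma>: "T i / S i * eps (S i) = \<sigma>" for i
    using S(1)[of i] eps[OF S(1) S1, of i] by (simp add: T_def)
  have \<psi>: "sqL2 (\<psi> (S i))" "sqnorm (\<psi> (S i)) \<le> 1" for i
    using psi[OF S(1) S1, of i] L2_sqL2 by (auto simp flip: L2norm_sqnorm)
  have C: "(\<lambda>i. corr \<rho> (S i) (\<psi> (S i)) (d i t) 0 0) \<longlonglongrightarrow> lcorr \<rho> M V \<tau> \<sigma> t 0 0" if \<rho>: "\<rho> > 0" for \<rho>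
  proof (rule corr_limit[OF V M \<rho> S(1) S(4) Tl T\<sigma> pert[OF S(1) S1] \<psi> _ d_def t])
    show "(\<lambda>i. ip (\<psi> (S i)) (Op (S i) (obs \<rho> n \<eta>) (\<psi> (S i)))) \<longlonglongrightarrow> (\<integral>z. obs \<rho> n \<eta> z \<partial>M)" for n \<eta>
      by (rule filterlim_compose[OF scm[OF symbol_obs[OF \<rho>]] Sf])
  qed
  have LC: "(\<lambda>n. lcorr (real (Suc n)) M V \<tau> \<sigma> t 0 0) \<longlonglongrightarrow> L"
    unfolding lcorr_def L_def
  proof (rule integral_dominated_convergence[where w = "\<lambda>_. 1"])
    have m: "g \<in> borel_measurable M" if "continuous_on UNIV g" for g :: "pt \<times> pt \<Rightarrow> complex"
      using borel_measurable_continuous_onI[OF that] M(2) measurable_cong_sets by blast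
    show "(\<lambda>z. cis (\<sigma> * Theta V \<tau> t z)) \<in> borel_measurable M"
      by (intro m continuous_intros continuous_Theta smooth_continuous V)
    show "(\<lambda>z. obs (real (Suc n)) 0 0 z * cis (\<sigma> * Theta V \<tau> t z)) \<in> borel_measurable M" for n
      by (intro m continuous_intros continuous_Theta smooth_continuous V continuous_obs)
    show "AE z in M. (\<lambda>n. obs (real (Suc n)) 0 0 z * cis (\<sigma> * Theta V \<tau> t z)) \<longlonglongrightarrow> cis (\<sigma> * Theta V \<tau> t z)"
    proof (rule AE_I2)
      fix z
      have "(\<lambda>n. ek 0 (fst z) * cis (0 \<bullet> snd z) * of_real (chi (real (Suc n)) (snd z)) * cis (\<sigma> * Theta V \<tau> t z)) \<longlonglongrightarrow>
        ek 0 (fst z) * cis (0 \<bullet> snd z) * of_real 1 * cis (\<sigma> * Theta V \<tau> t z)"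
        by (intro tendsto_intros chi_tendsto_1)
      then show "(\<lambda>n. obs (real (Suc n)) 0 0 z * cis (\<sigma> * Theta V \<tau> t z)) \<longlonglongrightarrow> cis (\<sigma> * Theta V \<tau> t z)"
        by (simp add: obs_def)
    qed
  qed (auto simp: norm_mult cmod_obs_le)
  have "ov \<longlonglongrightarrow> L"
  proof (rule LIMSEQ_I)
    fix r :: real assume "r > 0"
    \<comment> \<open>Four errors: the high frequency mass, the cutoff below it, and the
      convergences of \<open>c\<close> to \<open>lcorr\<close> and of \<open>lcorr\<close> to
      \<open>L\<close>. The order matters: \<open>R\<close> is fixed first, then the cutoff radius
      through \<open>n\<close>, then \<open>i\<close> grows.\<close>
    define \<epsilon> where "\<epsilon> = r / 4"
    have \<epsilon>: "\<epsilon> > 0" using \<open>r > 0\<close> by (simp add: \<epsilon>_def)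
    have "\<forall>\<^sub>F R in at_top. Limsup (at_right 0) (\<lambda>h. ereal (specproj_norm {R..} h (\<psi> h))) < ereal \<epsilon>"
      using \<epsilon> by (intro order_tendstoD(2)[OF high]) auto
    then have "\<forall>\<^sub>F R in at_top. Limsup (at_right 0) (\<lambda>h. ereal (specproj_norm {R..} h (\<psi> h))) < ereal \<epsilon> \<and> R \<ge> 0"
      using eventually_ge_at_top[of 0] by eventually_elim simp
    then obtain R where R: "Limsup (at_right 0) (\<lambda>h. ereal (specproj_norm {R..} h (\<psi> h))) < ereal \<epsilon>" "R \<ge> 0"
      using eventually_happens'[OF trivial_limit_at_top_linorder] by blast
    have "\<forall>\<^sub>F h in at_right 0. ereal (specproj_norm {R..} h (\<psi> h)) < ereal \<epsilon>"
      using Limsup_lessD[OF R(1)] .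
    then have sp: "\<forall>\<^sub>F i in sequentially. specproj_norm {R..} (S i) (\<psi> (S i)) < \<epsilon>"
      using Sf by (auto simp: filterlim_iff)
    have "\<forall>\<^sub>F n in sequentially. norm (lcorr (real (Suc n)) M V \<tau> \<sigma> t 0 0 - L) < \<epsilon>"
      using tendstoD[OF LC \<epsilon>] by (simp add: dist_norm)
    then have "\<forall>\<^sub>F n in sequentially. norm (lcorr (real (Suc n)) M V \<tau> \<sigma> t 0 0 - L) < \<epsilon> \<and>
        (\<forall>\<xi>. norm \<xi> \<le> sqrt R \<longrightarrow> 1 - \<epsilon> \<le> chi (real (Suc n)) \<xi>)"
      using chi_eventually_ge[OF \<epsilon>, of "sqrt R"] by (rule eventually_conj)
    then obtain n where n: "norm (lcorr (real (Suc n)) M V \<tau> \<sigma> t 0 0 - L) < \<epsilon>"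
      "\<And>\<xi>. norm \<xi> \<le> sqrt R \<Longrightarrow> 1 - \<epsilon> \<le> chi (real (Suc n)) \<xi>"
      using eventually_happens'[OF sequentially_bot] by blast
    define c where "c i = corr (real (Suc n)) (S i) (\<psi> (S i)) (d i t) 0 0" for i
    have "\<forall>\<^sub>F i in sequentially. norm (c i - lcorr (real (Suc n)) M V \<tau> \<sigma> t 0 0) < \<epsilon>"
      unfolding c_def using tendstoD[OF C[of "real (Suc n)"] \<epsilon>] by (simp add: dist_norm)
    with sp have "\<forall>\<^sub>F i in sequentially. norm (ov i - L) < r"
    proof eventually_elim
      case (elim i)
      have cV: "continuous_on UNIV (\<lambda>x. eps (S i) * V x)"
        by (intro continuous_intros smooth_continuous V)
      have "cmod (ov i - c i) \<le> specproj_norm {R..} (S i) (\<psi> (S i)) + \<epsilon>"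
        unfolding ov_def c_def
      proof (rule overlap_corr_diff[where s = "t * T i"])
        show "sqL2 (ue (S i) (t * T i))" "sqL2 (u (S i) (t * T i))"
          using free[OF S(1) S1, of i] pert[OF S(1) S1, of i] L2_sqL2 by (auto simp: schr_sol_def)
        show "sqnorm (ue (S i) (t * T i)) \<le> 1"
          using norm_conservation[OF pert[OF S(1) S1] S(1) cV t] \<psi>(2) by simp
        show "fc (u (S i) (t * T i)) k = cis (- (freq (S i) k * (t * T i))) * fc (\<psi> (S i)) k" for k
          by (rule free_coeff[OF free[OF S(1) S1] S(1)])
        show "d i t k = cis (freq (S i) k * (t * T i)) * fc (ue (S i) (t * T i)) k" for k
          by (simp add: d_def mult.assoc)
      qed (use S \<psi> n R \<epsilon> in auto)
      moreover have "norm (ov i - L) \<le> norm (ov i - c i) + norm (c i - lcorr (real (Suc n)) M V \<tau> \<sigma> t 0 0) + norm (lcorr (real (Suc n)) M V \<tau> \<sigma> t 0 0 - L)"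
        using norm_triangle_ineq[of "ov i - c i" "c i - L"]
          norm_triangle_ineq[of "c i - lcorr (real (Suc n)) M V \<tau> \<sigma> t 0 0" "lcorr (real (Suc n)) M V \<tau> \<sigma> t 0 0 - L"] by simp
      ultimately show ?case using elim n(1) by (simp add: \<epsilon>_def)
    qed
    then show "\<exists>no. \<forall>n\<ge>no. norm (ov n - L) < r"
      by (simp add: eventually_sequentially)
  qed
  then show "(\<lambda>n. ip (ue (S n) (t * (\<sigma> * (S n / eps (S n))))) (u (S n) (t * (\<sigma> * (S n / eps (S n)))))) \<longlonglongrightarrow>
      (\<integral>z. cis (\<sigma> * Theta V \<tau> t z) \<partial>M)"
    by (simp add: ov_def[abs_def] L_def T_def)
qed

section \<open>Signed times and the two regimes\<close>

lemma LBINT_eq_Theta: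
  fixes V :: "pt \<Rightarrow> real"
  assumes "continuous_on UNIV V"
  shows "(LBINT s=0..ereal t. V (fst (fst z) + s * fst (snd z), snd (fst z) + s * snd (snd z))) =
    (if t \<ge> 0 then Theta V 1 t z else - Theta V (- 1) (- t) z)"
proof -
  let ?g = "\<lambda>\<tau> s. V (fst z + (s * \<tau>) *\<^sub>R snd z)"
  have g: "set_integrable lborel {0..a} (?g \<tau>)" for \<tau> a
    by (rule borel_integrable_atLeastAtMost')
       (rule continuous_on_compose2[OF assms], auto intro!: continuous_intros)
  have Th: "(LBINT s=0..ereal a. ?g \<tau> s) = Theta V \<tau> a z" if "a \<ge> 0" for \<tau> a
    using interval_integral_eq_integral[OF that g] by (simp add: Theta_def zero_ereal_def)
  have eq: "V (fst (fst z) + s * fst (snd z), snd (fst z) + s * snd (snd z)) = ?g 1 s" for s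
    by (cases z) (auto simp: plus_prod_def scaleR_prod_def)
  show ?thesis
  proof (cases "t \<ge> 0")
    case True
    then show ?thesis unfolding eq using Th[of t 1] by simp
  next
    case False
    \<comment> \<open>Reversing the endpoints gives the outer sign; reflecting \<open>s\<close> runs
      the flow backwards, hence the arguments \<open>- 1\<close> and \<open>- t\<close>.\<close>
    have "(LBINT s=0..ereal t. ?g 1 s) = - (LBINT s=ereal t..0. ?g 1 s)"
      by (rule interval_integral_endpoints_reverse)
    also have "(LBINT s=ereal t..0. ?g 1 s) = (LBINT s=0..ereal (- t). ?g 1 (- s))"
      by (subst interval_integral_reflect) simp
    also have "\<dots> = Theta V (- 1) (- t) z"
      using Th[of "- t" "- 1"] False by simp
    finally show ?thesis unfolding eq using False by simp
  qed
qed

theorem theoremA1: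
  fixes V :: "pt \<Rightarrow> real"
    and eps :: "real \<Rightarrow> real"
    and \<psi> :: "real \<Rightarrow> pt \<Rightarrow> complex"
    and F0 :: "(pt \<times> pt) measure"
    and u ue :: "real \<Rightarrow> real \<Rightarrow> pt \<Rightarrow> complex"
  assumes V: "smooth V" "periodic V"
    and eps: "\<And>h. 0 < h \<Longrightarrow> h \<le> 1 \<Longrightarrow> h \<le> eps h \<and> eps h \<le> 1"
    and psi_L2: "\<And>h. 0 < h \<Longrightarrow> h \<le> 1 \<Longrightarrow> L2 (\<psi> h) \<and> L2norm (\<psi> h) = 1"
    and low: "((\<lambda>\<delta>. Limsup (at_right 0) (\<lambda>h. ereal (specproj_norm {0..\<delta>} h (\<psi> h))))
                 \<longlongrightarrow> 0) (at_right 0)"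
    and high: "((\<lambda>R. Limsup (at_right 0) (\<lambda>h. ereal (specproj_norm {R..} h (\<psi> h))))
                 \<longlongrightarrow> 0) at_top"
    and F0: "cotorus_measure F0"
    and scm: "\<And>a. symbol a \<Longrightarrow>
               ((\<lambda>h. ip (\<psi> h) (Op h a (\<psi> h))) \<longlongrightarrow> integral\<^sup>L F0 a) (at_right 0)"
    and free: "\<And>h. 0 < h \<Longrightarrow> h \<le> 1 \<Longrightarrow> schr_sol h (\<lambda>x. 0) (\<psi> h) (u h)"
    and pert: "\<And>h. 0 < h \<Longrightarrow> h \<le> 1 \<Longrightarrow> schr_sol h (\<lambda>x. eps h * V x) (\<psi> h) (ue h)"
  shows
    "((\<forall>h. 0 < h \<and> h \<le> 1 \<longrightarrow> eps h = h) \<longrightarrow>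
       (\<forall>t::real.
         ((\<lambda>h. (cmod (ip (ue h (t * (h / eps h))) (u h (t * (h / eps h)))))\<^sup>2) \<longlongrightarrow>
            (cmod (\<integral>z. cis (LBINT s=0..ereal t. V (fst (fst z) + s * fst (snd z),
                                                      snd (fst z) + s * snd (snd z))) \<partial>F0))\<^sup>2)
         (at_right 0)))
   \<and>
     (((\<lambda>h. h / eps h) \<longlongrightarrow> 0) (at_right 0) \<longrightarrow>
       (\<forall>t::real.
         ((\<lambda>h. (cmod (ip (ue h (t * (h / eps h))) (u h (t * (h / eps h)))))\<^sup>2) \<longlongrightarrow>
            (cmod (\<integral>z. cis (t * V (fst z)) \<partial>F0))\<^sup>2)
         (at_right 0)))"
proof (intro conjI impI allI)
  have eps0: "\<And>h. 0 < h \<Longrightarrow> h \<le> 1 \<Longrightarrow> eps h > 0"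
    using eps by fastforce
  have M: "finite_measure F0" "sets F0 = sets borel"
    using F0 by (auto simp: cotorus_measure_def)
  have cV: "continuous_on UNIV V" by (rule smooth_continuous) (rule V)
  have lim: "((\<lambda>h. ip (ue h (t * (\<sigma> * (h / eps h)))) (u h (t * (\<sigma> * (h / eps h))))) \<longlongrightarrow>
      (\<integral>z. cis (\<sigma> * Theta V \<tau> t z) \<partial>F0)) (at_right 0)"
    if "((\<lambda>h. \<sigma> * (h / eps h)) \<longlongrightarrow> \<tau>) (at_right 0)" "t \<ge> 0" for \<sigma> \<tau> t
    by (rule overlap_limit) (fact V eps0 psi_L2 high M scm free pert that)+
  {
    fix t :: real
    assume e: "\<forall>h. 0 < h \<and> h \<le> 1 \<longrightarrow> eps h = h"
    \<comment> \<open>The sign of \<open>t\<close>, so that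
      \<open>\<bar>t\<bar> * \<sigma> = t\<close> and the limit for nonnegative times reaches
      negative \<open>t\<close>. As \<open>h / eps h\<close> is 1 near 0, the flow speed
      \<open>\<tau>\<close> is \<open>\<sigma>\<close> itself.\<close>
    define \<sigma> :: real where "\<sigma> = (if t \<ge> 0 then 1 else - 1)"
    have "((\<lambda>h. \<sigma> * (h / eps h)) \<longlongrightarrow> \<sigma>) (at_right 0)"
    proof (rule tendsto_eventually)
      have "\<forall>\<^sub>F h in at_right (0::real). 0 < h \<and> h < 1"
        by (auto simp: eventually_at_right_field intro!: exI[of _ 1])
      then show "\<forall>\<^sub>F h in at_right 0. \<sigma> * (h / eps h) = \<sigma>"
        by eventually_elim (use e in auto)
    qed
    from lim[OF this, of "\<bar>t\<bar>"]
    have "((\<lambda>h. ip (ue h (\<bar>t\<bar> * (\<sigma> * (h / eps h)))) (u h (\<bar>t\<bar> * (\<sigma> * (h / eps h))))) \<longlongrightarrow>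
      (\<integral>z. cis (\<sigma> * Theta V \<sigma> \<bar>t\<bar> z) \<partial>F0)) (at_right 0)" by simp
    moreover have "\<bar>t\<bar> * (\<sigma> * x) = t * x" for x by (simp add: \<sigma>_def)
    moreover have "\<sigma> * Theta V \<sigma> \<bar>t\<bar> z = (LBINT s=0..ereal t. V (fst (fst z) + s * fst (snd z), snd (fst z) + s * snd (snd z)))" for z
      unfolding LBINT_eq_Theta[OF cV] by (simp add: \<sigma>_def)
    ultimately show "((\<lambda>h. (cmod (ip (ue h (t * (h / eps h))) (u h (t * (h / eps h)))))\<^sup>2) \<longlongrightarrow>
            (cmod (\<integral>z. cis (LBINT s=0..ereal t. V (fst (fst z) + s * fst (snd z),
                                                      snd (fst z) + s * snd (snd z))) \<partial>F0))\<^sup>2)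
         (at_right 0)"
      by (intro tendsto_power tendsto_norm) simp
  }
  {
    fix t :: real
    assume e: "((\<lambda>h. h / eps h) \<longlongrightarrow> 0) (at_right 0)"
    define \<sigma> :: real where "\<sigma> = (if t \<ge> 0 then 1 else - 1)"
    have "((\<lambda>h. \<sigma> * (h / eps h)) \<longlongrightarrow> 0) (at_right 0)"
      using tendsto_mult_left[OF e, of \<sigma>] by simp
    from lim[OF this, of "\<bar>t\<bar>"]
    have "((\<lambda>h. ip (ue h (\<bar>t\<bar> * (\<sigma> * (h / eps h)))) (u h (\<bar>t\<bar> * (\<sigma> * (h / eps h))))) \<longlongrightarrow>
      (\<integral>z. cis (\<sigma> * Theta V 0 \<bar>t\<bar> z) \<partial>F0)) (at_right 0)" by simp
    moreover have "\<bar>t\<bar> * (\<sigma> * x) = t * x" for x by (simp add: \<sigma>_def)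
    \<comment> \<open>At speed 0 the orbit stays at \<open>fst z\<close>, so \<open>Theta\<close>
      integrates a constant over a time \<open>\<bar>t\<bar>\<close>.\<close>
    moreover have "\<sigma> * Theta V 0 \<bar>t\<bar> z = t * V (fst z)" for z
      by (simp add: \<sigma>_def Theta_def)
    ultimately show "((\<lambda>h. (cmod (ip (ue h (t * (h / eps h))) (u h (t * (h / eps h)))))\<^sup>2) \<longlongrightarrow>
            (cmod (\<integral>z. cis (t * V (fst z)) \<partial>F0))\<^sup>2)
         (at_right 0)"
      by (intro tendsto_power tendsto_norm) simp
  }
qed

end
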